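(* Let $d\ge1$, $0<s<1$ and $z>0$. For $u\in L^2(\mathbb R^{d+1})$ if $0<s\le\frac12$, and for $u\in\operatorname{Dom}(\mathcal L^s)$ if $\frac12<s<1$, define $U$ by $\widehat U(\xi,z,\tau)=m_s(z;\xi,\tau)\,\widehat u(\xi,\tau)$ and set $T_zu(x,t)=U(x,z,t)$. Then: (i) if $0<s\le\frac12$, $T_z:L^2(\mathbb R^{d+1})\to L^2(\mathbb R^{d+1})$ is a bounded linear operator for every $z>0$; moreover $U(\cdot,z,\cdot)\to u$ strongly in $L^2(\mathbb R^{d+1})$ as $z\to0^+$ for every $u\in L^2(\mathbb R^{d+1})$; (ii) if $\frac12<s<1$, $T_z:\operatorname{Dom}(\mathcal L^s)\to L^2(\mathbb R^{d+1})$ is a bounded linear operator for every $z>0$; moreover $U(\cdot,z,\cdot)\to u$ strongly in $L^2(\mathbb R^{d+1})$ as $z\to0^+$ for every $u\in\operatorname{Dom}(\mathcal L^s)$.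
   Context: Fourier transform on $\mathbb R^{d+1}=\mathbb R^d_x\times\mathbb R_t$: $\widehat u(\xi,\tau)=\int e^{-2\pi i(\tau t+\langle\xi,x\rangle)}u(x,t)\,dx\,dt$; $\widehat U(\xi,z,\tau)$ is the transform in $(x,t)$ for fixed $z$. $p(\xi,\tau)=2\pi\tau+4\pi^2|\xi|^2$. $\theta(\xi,\tau)=1$ if $p>0$, $\theta=-i$ if $p<0$. For $p(\xi,\tau)\ne0$, $$m_s(z;\xi,\tau)=\frac{2^{1-s}}{\Gamma(s)}\bigl(z\theta|p|^{1/2}\bigr)^sK_s\bigl(z\theta|p|^{1/2}\bigr),$$ with principal-branch powers and $K_s$ the modified Bessel function of the third kind. $\operatorname{Dom}(\mathcal L^s)=\{u\in L^2(\mathbb R^{d+1}):|p|^s\widehat u\in L^2(\mathbb R^{d+1})\}$, $\widehat{\mathcal L^su}=(ip)^s\widehat u$ (principal branch), equipped with the graph norm $\|u\|_{L^2}+\|\mathcal L^su\|_{L^2}$. *)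

theory Defs
  imports "HOL-Analysis.Analysis"
begin

text \<open>
  Elements of $L^2$ are represented by Borel functions; two representatives are identified when
  they agree almost everywhere, so equations between elements of $L^2$ are stated with
  \<open>AE\<close>.
\<close>

definition L2 :: "('a::euclidean_space \<Rightarrow> complex) set" where
  "L2 = {u. u \<in> borel_measurable lborel \<and> integrable lborel (\<lambda>x. (cmod (u x))\<^sup>2)}"

definition L2norm :: "('a::euclidean_space \<Rightarrow> complex) \<Rightarrow> real" where
  "L2norm u = sqrt (\<integral>x. (cmod (u x))\<^sup>2 \<partial>lborel)"

text \<open>
  Membership in \<^const>\<open>L2\<close> is required explicitly, because \<^const>\<open>L2norm\<close> is 0 on functions
  whose square is not integrable.
\<close>

definition L2_tendsto ::
  "('b \<Rightarrow> 'a::euclidean_space \<Rightarrow> complex) \<Rightarrow> ('a \<Rightarrow> complex) \<Rightarrow> 'b filter \<Rightarrow> bool" where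
  "L2_tendsto f l F \<longleftrightarrow>
     l \<in> L2 \<and> (\<forall>\<^sub>F z in F. f z \<in> L2) \<and>
     ((\<lambda>z. L2norm (\<lambda>x. f z x - l x)) \<longlongrightarrow> 0) F"

text \<open>
  \<open>D\<close> is a linear subspace of $L^2$ (a union of classes modulo \<open>AE\<close>) with norm \<open>N\<close>, and \<open>T\<close>
  induces a bounded complex-linear operator from \<open>(D, N)\<close> to $L^2$.
\<close>

definition bounded_L2_operator ::
  "('a::euclidean_space \<Rightarrow> complex) set \<Rightarrow> (('a \<Rightarrow> complex) \<Rightarrow> real) \<Rightarrow>
   (('a \<Rightarrow> complex) \<Rightarrow> ('a \<Rightarrow> complex)) \<Rightarrow> bool" where
  "bounded_L2_operator D N T \<longleftrightarrow>
     D \<subseteq> L2 \<and> (\<lambda>x. 0) \<in> D \<and>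
     (\<forall>u\<in>D. \<forall>v\<in>D. (\<lambda>x. u x + v x) \<in> D) \<and>
     (\<forall>c. \<forall>u\<in>D. (\<lambda>x. c * u x) \<in> D) \<and>
     (\<forall>u\<in>D. \<forall>v\<in>L2. (AE x in lborel. u x = v x) \<longrightarrow> v \<in> D) \<and>
     (\<forall>u\<in>D. T u \<in> L2) \<and>
     (\<forall>u\<in>D. \<forall>v\<in>D. (AE x in lborel. u x = v x) \<longrightarrow> (AE x in lborel. T u x = T v x)) \<and>
     (\<forall>u\<in>D. \<forall>v\<in>D. AE x in lborel. T (\<lambda>y. u y + v y) x = T u x + T v x) \<and>
     (\<forall>c. \<forall>u\<in>D. AE x in lborel. T (\<lambda>y. c * u y) x = c * T u x) \<and>
     (\<exists>C. \<forall>u\<in>D. L2norm (T u) \<le> C * N u)"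

text \<open>
  On a product \<open>'a \<times> real\<close> the inner product below is \<open>\<xi> \<bullet> x + \<tau> * t\<close>, and \<^const>\<open>lborel\<close> is
  the product Lebesgue measure.
\<close>

definition fourier_integral ::
  "('a::euclidean_space \<Rightarrow> complex) \<Rightarrow> 'a \<Rightarrow> complex" where
  "fourier_integral u \<zeta> = (\<integral>y. exp (- (2 * pi * \<i> * of_real (\<zeta> \<bullet> y))) * u y \<partial>lborel)"

text \<open>
  The Fourier transform on $L^2$ is the continuous extension of the Fourier integral from
  $L^1 \cap L^2$; \<open>v\<close> is determined by \<open>u\<close> only up to a null set.
\<close>

definition has_fourier ::
  "('a::euclidean_space \<Rightarrow> complex) \<Rightarrow> ('a \<Rightarrow> complex) \<Rightarrow> bool" where
  "has_fourier u v \<longleftrightarrow>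
     (\<exists>f :: nat \<Rightarrow> 'a \<Rightarrow> complex.
        (\<forall>n. f n \<in> L2 \<and> integrable lborel (f n)) \<and>
        L2_tendsto f u sequentially \<and>
        L2_tendsto (\<lambda>n. fourier_integral (f n)) v sequentially)"

definition fourier :: "('a::euclidean_space \<Rightarrow> complex) \<Rightarrow> ('a \<Rightarrow> complex)" where
  "fourier u = (SOME v. has_fourier u v)"

text \<open>A representative of the \<open>U\<close> in $L^2$ whose Fourier transform is \<open>m\<close> times that of \<open>u\<close>.\<close>

definition fourier_multiplier ::
  "('a::euclidean_space \<Rightarrow> complex) \<Rightarrow> ('a \<Rightarrow> complex) \<Rightarrow> ('a \<Rightarrow> complex)" where
  "fourier_multiplier m u = (SOME U. has_fourier U (\<lambda>\<zeta>. m \<zeta> * fourier u \<zeta>))"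

text \<open>
  Modified Bessel functions of the first and third kind, with the principal branch of the power
  and $1/\Gamma$ extended by 0 at the poles of $\Gamma$. The formula for \<open>bessel_K\<close> is the
  definition for non-integer order only.
\<close>

definition bessel_I :: "real \<Rightarrow> complex \<Rightarrow> complex" where
  "bessel_I \<nu> w =
     (w / 2) powr of_real \<nu> * (\<Sum>k. (w / 2) ^ (2 * k) * of_real (rGamma (\<nu> + real k + 1)) / fact k)"

definition bessel_K :: "real \<Rightarrow> complex \<Rightarrow> complex" where
  "bessel_K \<nu> w = of_real pi / 2 * (bessel_I (- \<nu>) w - bessel_I \<nu> w) / of_real (sin (\<nu> * pi))"

fun symb :: "'a::euclidean_space \<times> real \<Rightarrow> real" where
  "symb (\<xi>, \<tau>) = 2 * pi * \<tau> + 4 * pi\<^sup>2 * (norm \<xi>)\<^sup>2"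

text \<open>
  The values of \<open>theta\<close> and \<open>msym\<close> on the null set where \<^const>\<open>symb\<close> vanishes are arbitrary.
\<close>

definition theta :: "'a::euclidean_space \<times> real \<Rightarrow> complex" where
  "theta \<zeta> = (if symb \<zeta> > 0 then 1 else - \<i>)"

definition msym :: "real \<Rightarrow> real \<Rightarrow> 'a::euclidean_space \<times> real \<Rightarrow> complex" where
  "msym s z \<zeta> =
     (let w = of_real z * theta \<zeta> * of_real (\<bar>symb \<zeta>\<bar> powr (1/2))
      in of_real (2 powr (1 - s) / Gamma s) * w powr of_real s * bessel_K s w)"

definition Dom_Ls :: "real \<Rightarrow> ('a::euclidean_space \<times> real \<Rightarrow> complex) set" where
  "Dom_Ls s = {u \<in> L2. (\<lambda>\<zeta>. of_real (\<bar>symb \<zeta>\<bar> powr s) * fourier u \<zeta>) \<in> L2}"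

definition Ls ::
  "real \<Rightarrow> ('a::euclidean_space \<times> real \<Rightarrow> complex) \<Rightarrow> ('a \<times> real \<Rightarrow> complex)" where
  "Ls s = fourier_multiplier (\<lambda>\<zeta>. (\<i> * of_real (symb \<zeta>)) powr of_real s)"

definition graph_norm :: "real \<Rightarrow> ('a::euclidean_space \<times> real \<Rightarrow> complex) \<Rightarrow> real" where
  "graph_norm s u = L2norm u + L2norm (Ls s u)"

definition T_op ::
  "real \<Rightarrow> real \<Rightarrow> ('a::euclidean_space \<times> real \<Rightarrow> complex) \<Rightarrow> ('a \<times> real \<Rightarrow> complex)" where
  "T_op s z = fourier_multiplier (msym s z)"

end

theory Submission
  imports Defs "HOL-Probability.Characteristic_Functions" "HOL-Real_Asymp.Real_Asymp"
begin

text \<open>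
  On the Fourier side \<^const>\<open>T_op\<close> is multiplication by \<^const>\<open>msym\<close>. By Plancherel's theorem the
  statement is therefore about the size of one function: a multiplier that is bounded by a constant
  acts boundedly on $L^2$, one that is bounded by a constant times $1 + |p|^s$ maps the domain of
  $\mathcal L^s$ boundedly into $L^2$, and if the multipliers tend to 1 almost everywhere as
  $z \to 0^+$ under a bound of this kind that is uniform in $z$, then dominated convergence on the
  Fourier side gives strong convergence to the identity.

  The size of the symbol. Write $w = z \theta |p|^{1/2}$ and $x = (w/2)^2 = z^2 p / 4$, a real number.
  The reflection formula gives
  $m_s = \Gamma(1-s) (C_{-s}(x) - (w/2)^{2s} C_s(x))$ with the entire Bessel--Clifford
  functions $C_\nu$ (\<open>msym_eq_profile\<close>). Letting $x \to 0$ shows that $m_s \to 1$. For large $|x|$ the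
  two half lines need different arguments, both taken from the differential equation and the power
  series, without integral representations.

  For $x > 0$ the bracket is $g_s(x) = C_{-s}(x) - x^s C_s(x)$, with derivative
  $- x^{s-1} g_{1-s}(x)$. Once both $g_s$ and $g_{1-s}$ are known to be nonnegative, $g_s$ is
  decreasing and hence between 0 and $g_s(0)$ (\<open>macdonald_le\<close>). Nonnegativity (\<open>macdonald_nonneg\<close>)
  is the recessive character of $K_s$: a constant positive Wronskian makes the quotient
  $x^s C_s / C_{-s}$ increase, and a comparison of coefficients shows that it cannot stay above 1.

  For $x = -y < 0$ the functions oscillate. An energy that is almost conserved along the
  Bessel equation shows that $C_\nu(-y)$ is at most of order $y^{-\nu/2-1/4}$
  (\<open>bessel_clifford_decay\<close>), so $m_s$ is at most of order $y^{s/2-1/4}$. The exponent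
  is at most 0 exactly for $s \le 1/2$, and always at most $s$; this is the reason for the two cases of the theorem.

  Plancherel's theorem. For $f \in L^1 \cap L^2$ the function $|\hat f|^2$ is the Fourier
  integral of the autocorrelation of $f$, which is continuous at 0 with value $\|f\|^2$ there.
  Testing with dilated Gaussians recovers that value as the integral of $|\hat f|^2$
  (\<open>Plancherel\<close>). Completeness of $L^2$ extends the transform to all of $L^2$, and the adjoint
  relation with the inverse transform shows that it is onto (\<open>has_fourier_surj\<close>), so that
  the function $U$ exists whenever $m_s \hat u$ lies in $L^2$.
\<close>

section \<open>Bessel--Clifford functions\<close>

definition bc_coeff :: "real \<Rightarrow> nat \<Rightarrow> real" where
  "bc_coeff \<nu> k = rGamma (\<nu> + real k + 1) / fact k"

text \<open>
  The Bessel--Clifford function $C_\nu$: $I_\nu(w) = (w/2)^\nu C_\nu(w^2/4)$ and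
  $J_\nu(w) = (w/2)^\nu C_\nu(-w^2/4)$. It is entire in $x$, involves no branch of a power,
  and is real on the real line, so that the two rays $w > 0$ and $w \in -i (0, \infty)$ become the two
  half lines of one real variable.
\<close>

definition bessel_clifford :: "real \<Rightarrow> real \<Rightarrow> real" where
  "bessel_clifford \<nu> x = (\<Sum>k. bc_coeff \<nu> k * x ^ k)"

lemma bc_coeff_Suc: "(real k + 1) * bc_coeff \<nu> (Suc k) = bc_coeff (\<nu> + 1) k"
proof -
  have "(real k + 1) * (r / fact (Suc k)) = r / fact k" for r :: real
    unfolding fact_Suc by (simp add: divide_simps)
  moreover have "\<nu> + real (Suc k) + 1 = \<nu> + 1 + real k + 1" by simp
  ultimately show ?thesis unfolding bc_coeff_def by metis
qed

lemma bc_coeff_shift: "(\<nu> + real k + 1) * bc_coeff (\<nu> + 1) k = bc_coeff \<nu> k"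
  using rGamma_plus1[of "\<nu> + real k + 1"] by (simp add: bc_coeff_def algebra_simps)

lemma bc_coeff_Suc_Suc: "(\<nu> + real k + 1) * (real k + 1) * bc_coeff \<nu> (Suc k) = bc_coeff \<nu> k"
  using bc_coeff_Suc[of k \<nu>] bc_coeff_shift[of \<nu> k] by (metis mult.assoc)

lemma summable_bessel_clifford: "summable (\<lambda>k. bc_coeff \<nu> k * x ^ k)"
proof (rule summable_ratio_test)
  define N where "N = nat \<lceil>2 * \<bar>x\<bar> + \<bar>\<nu>\<bar> + 1\<rceil>"
  show "(1/2 :: real) < 1" by simp
  fix n assume "n \<ge> N"
  then have n: "real n \<ge> 2 * \<bar>x\<bar> + \<bar>\<nu>\<bar> + 1" unfolding N_def by linarith
  define P where "P = (\<nu> + real n + 1) * (real n + 1)"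
  have pos: "0 < P"
    unfolding P_def using n by (intro mult_pos_pos) linarith+
  have "1 * (real n + 1) \<le> P"
    unfolding P_def using n by (intro mult_right_mono) linarith+
  then have xP: "\<bar>x\<bar> \<le> P / 2" using n by simp
  have "P * (bc_coeff \<nu> (Suc n) * x ^ Suc n) = bc_coeff \<nu> n * x ^ n * x"
    using bc_coeff_Suc_Suc[of \<nu> n] by (simp add: P_def mult_ac)
  then have "P * norm (bc_coeff \<nu> (Suc n) * x ^ Suc n) = norm (bc_coeff \<nu> n * x ^ n) * \<bar>x\<bar>"
    using pos by (metis abs_mult abs_of_pos real_norm_def)
  also have "\<dots> \<le> norm (bc_coeff \<nu> n * x ^ n) * (P / 2)"
    by (intro mult_left_mono xP) simp
  finally show "norm (bc_coeff \<nu> (Suc n) * x ^ Suc n) \<le> 1/2 * norm (bc_coeff \<nu> n * x ^ n)"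
    using pos by (simp add: field_simps)
qed

lemma bessel_clifford_sums: "(\<lambda>k. bc_coeff \<nu> k * x ^ k) sums bessel_clifford \<nu> x"
  unfolding bessel_clifford_def by (rule summable_sums[OF summable_bessel_clifford])

lemma bessel_clifford_0: "bessel_clifford \<nu> 0 = rGamma (\<nu> + 1)"
  unfolding bessel_clifford_def by (subst powser_zero) (simp add: bc_coeff_def)

lemma bessel_clifford_diffs: "diffs (bc_coeff \<nu>) = bc_coeff (\<nu> + 1)"
  using bc_coeff_Suc[of _ \<nu>] by (simp add: diffs_def fun_eq_iff add.commute)

lemma has_derivative_bessel_clifford [derivative_intros]:
  "(f has_real_derivative f') (at x within S) \<Longrightarrow>
   ((\<lambda>x. bessel_clifford \<nu> (f x)) has_real_derivative bessel_clifford (\<nu> + 1) (f x) * f') (at x within S)"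
proof -
  have "(bessel_clifford \<nu> has_real_derivative bessel_clifford (\<nu> + 1) y) (at y)" for y
    using termdiffs_strong_converges_everywhere[OF summable_bessel_clifford[of \<nu>], of y]
    unfolding bessel_clifford_diffs bessel_clifford_def[abs_def] .
  from DERIV_chain2[OF this] show "(f has_real_derivative f') (at x within S) \<Longrightarrow> ?thesis" .
qed

lemma isCont_bessel_clifford: "isCont (bessel_clifford \<nu>) x"
  by (rule DERIV_isCont[OF has_derivative_bessel_clifford[OF DERIV_ident]])

lemma bessel_clifford_weighted_sums:
  "(\<lambda>k. real k * (bc_coeff \<nu> k * x ^ k)) sums (x * bessel_clifford (\<nu> + 1) x)"
proof -
  have "(\<lambda>k. x * (bc_coeff (\<nu> + 1) k * x ^ k)) sums (x * bessel_clifford (\<nu> + 1) x)"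
    by (rule sums_mult[OF bessel_clifford_sums])
  also have "(\<lambda>k. x * (bc_coeff (\<nu> + 1) k * x ^ k)) = (\<lambda>k. real (Suc k) * (bc_coeff \<nu> (Suc k) * x ^ Suc k))"
    unfolding bc_coeff_Suc[symmetric] by (simp add: fun_eq_iff algebra_simps)
  finally show ?thesis by (subst (asm) sums_Suc_iff) simp
qed

text \<open>
  The factor \<open>k * (k + \<nu>)\<close> shifts the coefficient sequence by one place. Read as a statement about the
  weights \<open>bc_coeff \<nu> k * x ^ k\<close>, the average of \<open>k * (k + \<nu>)\<close> is exactly \<open>x\<close>: the series is
  concentrated near \<open>k = sqrt x\<close>, which is all that is needed about its behaviour for large \<open>x\<close>.
\<close>

lemma bessel_clifford_weighted_sums2:
  "(\<lambda>k. real k * (real k + \<nu>) * (bc_coeff \<nu> k * x ^ k)) sums (x * bessel_clifford \<nu> x)"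
proof -
  have "(\<lambda>k. x * (bc_coeff \<nu> k * x ^ k)) sums (x * bessel_clifford \<nu> x)"
    by (intro sums_mult bessel_clifford_sums)
  also have "(\<lambda>k. x * (bc_coeff \<nu> k * x ^ k)) =
      (\<lambda>k. real (Suc k) * (real (Suc k) + \<nu>) * (bc_coeff \<nu> (Suc k) * x ^ Suc k))"
  proof
    fix k
    show "x * (bc_coeff \<nu> k * x ^ k) = real (Suc k) * (real (Suc k) + \<nu>) * (bc_coeff \<nu> (Suc k) * x ^ Suc k)"
      unfolding bc_coeff_Suc_Suc[of \<nu> k, symmetric] by (simp add: mult_ac add_ac)
  qed
  finally show ?thesis by (subst (asm) sums_Suc_iff) simp
qed

text \<open>
  Together with the derivative formula this is the Bessel equation as a first-order system for
  $(C_\nu, C_{\nu+1})$.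
\<close>

lemma bessel_clifford_rec:
  "bessel_clifford \<nu> x = x * bessel_clifford (\<nu> + 2) x + (\<nu> + 1) * bessel_clifford (\<nu> + 1) x"
proof -
  have "(\<lambda>k. real k * (bc_coeff (\<nu> + 1) k * x ^ k) + (\<nu> + 1) * (bc_coeff (\<nu> + 1) k * x ^ k))
     sums (x * bessel_clifford (\<nu> + 1 + 1) x + (\<nu> + 1) * bessel_clifford (\<nu> + 1) x)"
    by (intro sums_add sums_mult bessel_clifford_weighted_sums bessel_clifford_sums)
  also have "(\<lambda>k. real k * (bc_coeff (\<nu> + 1) k * x ^ k) + (\<nu> + 1) * (bc_coeff (\<nu> + 1) k * x ^ k)) =
      (\<lambda>k. bc_coeff \<nu> k * x ^ k)"
    using bc_coeff_shift[of \<nu>] by (simp add: fun_eq_iff add_ac flip: distrib_right mult.assoc)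
  finally have "bessel_clifford \<nu> x = x * bessel_clifford (\<nu> + 1 + 1) x + (\<nu> + 1) * bessel_clifford (\<nu> + 1) x"
    using bessel_clifford_sums sums_unique2 by blast
  then show ?thesis by (simp add: add.assoc)
qed

lemma rGamma_pos: "(x::real) > 0 \<Longrightarrow> rGamma x > 0"
  by (simp add: rGamma_inverse_Gamma Gamma_real_pos)

lemma bc_coeff_pos: "\<nu> > -1 \<Longrightarrow> bc_coeff \<nu> k > 0"
  unfolding bc_coeff_def by (intro divide_pos_pos rGamma_pos) auto

lemma bessel_clifford_pos:
  assumes "\<nu> > -1" "x \<ge> 0" shows "bessel_clifford \<nu> x > 0"
proof -
  have "bessel_clifford \<nu> x \<ge> (\<Sum>k<1. bc_coeff \<nu> k * x ^ k)"
    unfolding bessel_clifford_def using assms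
    by (intro sum_le_suminf summable_bessel_clifford) (auto intro!: mult_nonneg_nonneg less_imp_le[OF bc_coeff_pos])
  moreover have "bc_coeff \<nu> 0 > 0" using assms by (intro bc_coeff_pos) simp
  ultimately show ?thesis by simp
qed

text \<open>
  The average of \<open>k\<close> is at most the square root of the average of $k^2$. It suffices to average the
  inequality $2 k \sqrt x \le k^2 + x$ and to use $k^2 \le k (k + \nu)$.
\<close>

lemma bessel_clifford_derivative_bound:
  assumes "\<nu> \<ge> 0" "x > 0"
  shows "x * bessel_clifford (\<nu> + 1) x \<le> sqrt x * bessel_clifford \<nu> x"
proof -
  let ?c = "\<lambda>k. bc_coeff \<nu> k * x ^ k"
  have c: "?c k \<ge> 0" for k
    using assms by (intro mult_nonneg_nonneg less_imp_le[OF bc_coeff_pos]) auto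
  have sq: "sqrt x > 0" "sqrt x * sqrt x = x" using assms by auto
  have "(\<lambda>k. (1 / (2 * sqrt x)) * (real k * (real k + \<nu>) * ?c k) + (sqrt x / 2) * ?c k) sums
     ((1 / (2 * sqrt x)) * (x * bessel_clifford \<nu> x) + (sqrt x / 2) * bessel_clifford \<nu> x)"
    by (intro sums_add sums_mult bessel_clifford_weighted_sums2 bessel_clifford_sums)
  also have "(1 / (2 * sqrt x)) * (x * bessel_clifford \<nu> x) + (sqrt x / 2) * bessel_clifford \<nu> x = sqrt x * bessel_clifford \<nu> x"
  proof -
    have "(1 / (2 * q)) * ((q * q) * B) + (q / 2) * B = q * B" if "q > 0" for q B :: real
      using that by (simp add: field_simps)
    from this[OF sq(1)] show ?thesis unfolding sq(2) .
  qed
  finally have S: "(\<lambda>k. (1 / (2 * sqrt x)) * (real k * (real k + \<nu>) * ?c k) + (sqrt x / 2) * ?c k) sums (sqrt x * bessel_clifford \<nu> x)" .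
  show ?thesis
  proof (rule sums_le[OF _ bessel_clifford_weighted_sums S])
    fix k
    have "real k \<le> (1 / (2 * sqrt x)) * (real k * (real k + \<nu>)) + sqrt x / 2"
    proof -
      have "0 \<le> (real k - sqrt x)\<^sup>2 + real k * \<nu>" using assms by simp
      also have "\<dots> = real k * (real k + \<nu>) + sqrt x * sqrt x - 2 * sqrt x * real k"
        by (simp add: power2_eq_square algebra_simps)
      finally show ?thesis using sq(1) by (simp add: field_simps del: real_sqrt_mult_self)
    qed
    from mult_right_mono[OF this c[of k]]
    show "real k * ?c k \<le> (1 / (2 * sqrt x)) * (real k * (real k + \<nu>) * ?c k) + (sqrt x / 2) * ?c k"
      by (simp add: algebra_simps)
  qed
qed

text \<open>
  Here $a + 2t$ is interpolated between $a$ and $a + 2$, where the functional equation is available.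
\<close>

lemma Gamma_shift_two_le:
  fixes a t :: real
  assumes "a > 0" "0 < t" "t < 1"
  shows "Gamma (a + 2 * t) \<le> Gamma a * (a * (a + 1)) powr t"
proof -
  have aa: "0 < a * (a + 1)" and G: "0 < Gamma a"
    using assms by (auto intro!: Gamma_real_pos)
  have "(ln \<circ> Gamma) ((1 - t) *\<^sub>R a + t *\<^sub>R (a + 2)) \<le> (1 - t) * (ln \<circ> Gamma) a + t * (ln \<circ> Gamma) (a + 2)"
    using assms by (intro convex_onD[OF log_convex_Gamma_real]) auto
  moreover have "(1 - t) *\<^sub>R a + t *\<^sub>R (a + 2) = a + 2 * t" by (simp add: algebra_simps)
  moreover have "Gamma (a + 2) = Gamma a * (a * (a + 1))"
  proof -
    have "Gamma (a + 1 + 1) = (a + 1) * Gamma (a + 1)"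
      using assms by (intro Gamma_plus1) (auto elim!: nonpos_Ints_cases)
    moreover have "Gamma (a + 1) = a * Gamma a"
      using assms by (intro Gamma_plus1) (auto elim!: nonpos_Ints_cases)
    ultimately show ?thesis by (simp add: add.assoc mult_ac)
  qed
  ultimately have "ln (Gamma (a + 2 * t)) \<le> (1 - t) * ln (Gamma a) + t * ln (Gamma a * (a * (a + 1)))"
    by simp
  also have "\<dots> = ln (Gamma a) + t * ln (a * (a + 1))"
    using ln_mult_pos[OF G aa] by (simp only: algebra_simps)
  also have "\<dots> = ln (Gamma a * (a * (a + 1)) powr t)"
    using ln_mult_pos[OF G, of "(a * (a + 1)) powr t"] aa assms(1) by (simp add: ln_powr)
  finally show ?thesis
    using assms G aa Gamma_real_pos[of "a + 2 * t"] by (subst (asm) ln_le_cancel_iff) auto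
qed

text \<open>
  The two solutions $C_{-\nu}$ and $x^\nu C_\nu$ of the same equation are asymptotically equal, and
  one of the two inequalities is elementary. By log-convexity of the Gamma function and Young's
  inequality, the $k$-th coefficient on the left is at most $x^\nu$ times that of $C_\nu$ times an
  expression linear in $k(k+\nu)/x$, whose average is 1 up to lower order terms. The reverse
  inequality would need a genuine concentration argument; it is recovered from this one, applied to
  the order $1-\nu$, through the Wronskian.
\<close>

lemma bessel_clifford_neg_order_le:
  assumes "0 < \<nu>" "\<nu> < 1" "x > 0"
  shows "bessel_clifford (-\<nu>) x \<le> x powr \<nu> * bessel_clifford \<nu> x * (1 + 3 / sqrt x + 2 / x)"
proof -
  let ?c = "\<lambda>k. bc_coeff \<nu> k * x ^ k"
  have c: "?c k \<ge> 0" for k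
    using assms by (intro mult_nonneg_nonneg less_imp_le[OF bc_coeff_pos]) auto
  have S: "(\<lambda>k. x powr \<nu> * ((1 - \<nu>) * ?c k + \<nu> / x * (real k * (real k + \<nu>) * ?c k + 3 * (real k * ?c k) + 2 * ?c k)))
     sums (x powr \<nu> * ((1 - \<nu>) * bessel_clifford \<nu> x + \<nu> / x * (x * bessel_clifford \<nu> x + 3 * (x * bessel_clifford (\<nu> + 1) x) + 2 * bessel_clifford \<nu> x)))"
    by (intro sums_add sums_mult bessel_clifford_weighted_sums2 bessel_clifford_sums bessel_clifford_weighted_sums)
  have alg: "r * (P * ((1 - v) + v * ((A + 3 * m + 2) / x))) * (X / f) =
      P * ((1 - v) * (r / f * X) + v / x * (A * (r / f * X) + 3 * (m * (r / f * X)) + 2 * (r / f * X)))"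
    for r P v A m X f :: real
    by (simp add: divide_inverse algebra_simps)
  have alg2: "(1 - v) * B + v / x * (x * B + 3 * (x * C) + 2 * B) = B + v * ((3 * (x * C) + 2 * B) / x)"
    if "x \<noteq> 0" for v B C x :: real
    using that by (simp add: field_simps)
  have alg3: "B + 1 * ((3 * (q * B) + 2 * B) / x) = B * (1 + 3 * (q / x) + 2 / x)" for B q x :: real
    by (simp add: divide_inverse algebra_simps)
  have "bessel_clifford (-\<nu>) x \<le> x powr \<nu> * ((1 - \<nu>) * bessel_clifford \<nu> x + \<nu> / x * (x * bessel_clifford \<nu> x + 3 * (x * bessel_clifford (\<nu> + 1) x) + 2 * bessel_clifford \<nu> x))"
  proof (rule sums_le[OF _ bessel_clifford_sums S])
    fix k
    define a where "a = real k + 1 - \<nu>"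
    have a: "a > 0" using assms by (simp add: a_def)
    have aa: "0 < a * (a + 1)" using a by simp
    have "Gamma (\<nu> + real k + 1) \<le> Gamma a * (a * (a + 1)) powr \<nu>"
      using Gamma_shift_two_le[OF a assms(1,2)] by (simp add: a_def algebra_simps)
    then have "rGamma a \<le> rGamma (\<nu> + real k + 1) * (a * (a + 1)) powr \<nu>"
      using a assms Gamma_real_pos[of a] Gamma_real_pos[of "\<nu> + real k + 1"]
      by (simp add: rGamma_inverse_Gamma field_simps)
    also have "(a * (a + 1)) powr \<nu> \<le> x powr \<nu> * ((1 - \<nu>) + \<nu> * (a * (a + 1) / x))"
    proof -
      have "(a * (a + 1) / x) powr \<nu> * 1 powr (1 - \<nu>) \<le> \<nu> * (a * (a + 1) / x) + (1 - \<nu>) * 1"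
        using assms aa by (intro Youngs_inequality_0) auto
      then have "x powr \<nu> * (a * (a + 1) / x) powr \<nu> \<le> x powr \<nu> * ((1 - \<nu>) + \<nu> * (a * (a + 1) / x))"
        by (intro mult_left_mono) auto
      moreover have "x powr \<nu> * (a * (a + 1) / x) powr \<nu> = (a * (a + 1)) powr \<nu>"
        using assms aa by (subst powr_mult[symmetric]) auto
      ultimately show ?thesis by simp
    qed
    also have "a * (a + 1) \<le> real k * (real k + \<nu>) + 3 * real k + 2"
    proof -
      have "a * (a + 1) = real k * (real k + \<nu>) + 3 * real k + 2 - (3 * \<nu> * real k + (3 - \<nu>) * \<nu>)"
        by (simp add: a_def algebra_simps power2_eq_square)
      moreover have "0 \<le> 3 * \<nu> * real k + (3 - \<nu>) * \<nu>" using assms by simp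
      ultimately show ?thesis by linarith
    qed
    finally have "rGamma a \<le> rGamma (\<nu> + real k + 1) * (x powr \<nu> * ((1 - \<nu>) + \<nu> * ((real k * (real k + \<nu>) + 3 * real k + 2) / x)))"
      using assms rGamma_pos[of "\<nu> + real k + 1"] by (simp add: mult_left_mono divide_right_mono)
    then have "rGamma a * (x ^ k / fact k) \<le> rGamma (\<nu> + real k + 1) * (x powr \<nu> * ((1 - \<nu>) + \<nu> * ((real k * (real k + \<nu>) + 3 * real k + 2) / x))) * (x ^ k / fact k)"
      using assms by (intro mult_right_mono) auto
    also have "\<dots> = x powr \<nu> * ((1 - \<nu>) * ?c k + \<nu> / x * (real k * (real k + \<nu>) * ?c k + 3 * (real k * ?c k) + 2 * ?c k))"
      unfolding bc_coeff_def by (rule alg)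
    also have "rGamma a * (x ^ k / fact k) = bc_coeff (-\<nu>) k * x ^ k"
      by (simp add: a_def bc_coeff_def algebra_simps)
    finally show "bc_coeff (-\<nu>) k * x ^ k \<le>
       x powr \<nu> * ((1 - \<nu>) * ?c k + \<nu> / x * (real k * (real k + \<nu>) * ?c k + 3 * (real k * ?c k) + 2 * ?c k))" .
  qed
  also have "\<dots> = x powr \<nu> * (bessel_clifford \<nu> x + \<nu> * ((3 * (x * bessel_clifford (\<nu> + 1) x) + 2 * bessel_clifford \<nu> x) / x))"
    by (subst alg2) (use assms in auto)
  also have "\<dots> \<le> x powr \<nu> * (bessel_clifford \<nu> x + 1 * ((3 * (sqrt x * bessel_clifford \<nu> x) + 2 * bessel_clifford \<nu> x) / x))"
    using assms bessel_clifford_derivative_bound[of \<nu> x] bessel_clifford_pos[of "\<nu>+1" x] bessel_clifford_pos[of "\<nu>" x]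
    by (intro mult_left_mono add_left_mono mult_mono divide_right_mono) auto
  also have "\<dots> = x powr \<nu> * bessel_clifford \<nu> x * (1 + 3 * (sqrt x / x) + 2 / x)"
    by (simp only: alg3 mult.assoc)
  also have "sqrt x / x = 1 / sqrt x"
    using assms by (simp add: real_div_sqrt sqrt_divide_self_eq inverse_eq_divide)
  finally show ?thesis by simp
qed


section \<open>The recessive solution on the positive half line\<close>

lemma bessel_clifford_rec':
  "x * bessel_clifford (\<nu> + 1) x = bessel_clifford (\<nu> - 1) x - \<nu> * bessel_clifford \<nu> x"
  using bessel_clifford_rec[of "\<nu> - 1" x] by (simp add: algebra_simps)

text \<open>
  The derivative of the left-hand side vanishes by the recurrence, and the value of the constant is
  read off at 0. For $0 < s < 1$ it is positive.
\<close>

lemma bessel_clifford_wronskian: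
  "bessel_clifford (-s) x * bessel_clifford (s - 1) x - x * bessel_clifford s x * bessel_clifford (1 - s) x
     = rGamma (1 - s) * rGamma s"
proof -
  let ?W = "\<lambda>x. bessel_clifford (-s) x * bessel_clifford (s - 1) x - x * bessel_clifford s x * bessel_clifford (1 - s) x"
  have "(?W has_real_derivative 0) (at y)" for y
  proof -
    have r1: "y * bessel_clifford (s + 1) y = bessel_clifford (s - 1) y - s * bessel_clifford s y"
      by (rule bessel_clifford_rec')
    have r2: "y * bessel_clifford (2 - s) y = bessel_clifford (- s) y - (1 - s) * bessel_clifford (1 - s) y"
      using bessel_clifford_rec'[of y "1 - s"] by simp
    have "(?W has_real_derivative
        (bessel_clifford (1 - s) y * bessel_clifford (s - 1) y + bessel_clifford (-s) y * bessel_clifford s y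
         - (bessel_clifford s y * bessel_clifford (1 - s) y + (y * bessel_clifford (s + 1) y) * bessel_clifford (1 - s) y
            + bessel_clifford s y * (y * bessel_clifford (2 - s) y)))) (at y)"
      by (auto intro!: derivative_eq_intros simp: algebra_simps)
    then show ?thesis unfolding r1 r2 by (simp add: algebra_simps)
  qed
  then have "?W x = ?W 0"
    by (intro DERIV_isconst_all) auto
  then show ?thesis by (simp add: bessel_clifford_0)
qed

lemma has_derivative_powr_bessel_clifford:
  assumes "x > 0"
  shows "((\<lambda>x. x powr s * bessel_clifford s x) has_real_derivative x powr (s - 1) * bessel_clifford (s - 1) x) (at x)"
proof -
  have "((\<lambda>x. x powr s * bessel_clifford s x) has_real_derivative
     (s * x powr (s - 1) * bessel_clifford s x + x powr s * bessel_clifford (s + 1) x)) (at x)"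
    using assms by (auto intro!: derivative_eq_intros)
  also have "x powr s = x powr (s - 1) * x"
    using assms by (simp add: powr_diff)
  also have "s * x powr (s - 1) * bessel_clifford s x + x powr (s - 1) * x * bessel_clifford (s + 1) x =
     x powr (s - 1) * (s * bessel_clifford s x + x * bessel_clifford (s + 1) x)"
    by (simp add: algebra_simps)
  finally show ?thesis unfolding bessel_clifford_rec' by simp
qed

text \<open>
  The Macdonald function on the positive half line in the variable $x = w^2/4$: up to a constant factor
  this is $w^s K_s(w)$.
\<close>

definition macdonald :: "real \<Rightarrow> real \<Rightarrow> real" where
  "macdonald s x = bessel_clifford (-s) x - x powr s * bessel_clifford s x"

text \<open>
  Suppose that the combination is negative at $x$. Then $p = x^s C_s / C_{-s}$ exceeds 1 at $x$, and
  $p$ increases since the Wronskian is positive. On the other hand the positive Wronskian says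
  that $p$ is less than the quotient $C_{s-1} / (x^{1-s} C_{1-s})$, which is at most $1 + o(1)$ by the
  comparison above for the order $1-s$. So $p$ cannot stay above a number greater than 1.
\<close>

lemma macdonald_nonneg:
  assumes s: "0 < s" "s < 1" and x: "x > 0"
  shows "macdonald s x \<ge> 0"
proof (rule ccontr)
  let ?p = "\<lambda>x. (x powr s * bessel_clifford s x) / bessel_clifford (-s) x"
  let ?d = "\<lambda>x::real. 1 + 3 / sqrt x + 2 / x"
  have pos: "bessel_clifford (-s) y > 0" "bessel_clifford (1 - s) y > 0" "bessel_clifford s y > 0"
    if "y > 0" for y
    using s that by (auto intro!: bessel_clifford_pos)
  have W: "bessel_clifford (-s) y * bessel_clifford (s - 1) y - y * bessel_clifford s y * bessel_clifford (1 - s) y > 0" for y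
    unfolding bessel_clifford_wronskian using s by (intro mult_pos_pos rGamma_pos) auto
  assume "\<not> macdonald s x \<ge> 0"
  then have p1: "?p x > 1"
    using pos[OF x] by (simp add: macdonald_def field_simps)
  have upper: "?p y < ?d y" if y: "y > 0" for y
  proof -
    have "bessel_clifford (s - 1) y \<le> y powr (1 - s) * bessel_clifford (1 - s) y * ?d y"
      using bessel_clifford_neg_order_le[of "1 - s" y] s y by simp
    then have "bessel_clifford (-s) y * bessel_clifford (s - 1) y
       \<le> bessel_clifford (-s) y * (y powr (1 - s) * bessel_clifford (1 - s) y * ?d y)"
      using pos(1)[OF y] by (intro mult_left_mono) auto
    then have "y * bessel_clifford s y * bessel_clifford (1 - s) y
       < bessel_clifford (-s) y * (y powr (1 - s) * bessel_clifford (1 - s) y * ?d y)"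
      using W[of y] by linarith
    moreover have "y = y powr (1 - s) * y powr s"
      using y by (simp flip: powr_add)
    ultimately have "(y powr (1 - s) * bessel_clifford (1 - s) y) * (y powr s * bessel_clifford s y)
       < (y powr (1 - s) * bessel_clifford (1 - s) y) * (bessel_clifford (-s) y * ?d y)"
      by (metis (no_types, lifting) mult.assoc mult.commute mult.left_commute)
    then have "y powr s * bessel_clifford s y < bessel_clifford (-s) y * ?d y"
      using pos(2)[OF y] y by (subst (asm) mult_less_cancel_left_pos) auto
    then show ?thesis
      using pos(1)[OF y] by (simp add: pos_divide_less_eq mult.commute)
  qed
  have incr: "?p x \<le> ?p y" if "x \<le> y" for y
  proof (rule DERIV_nonneg_imp_nondecreasing[OF that])
    fix t assume "x \<le> t" "t \<le> y"
    then have t: "t > 0" using x by simp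
    have "(?p has_real_derivative
        ((t powr (s - 1) * bessel_clifford (s - 1) t) * bessel_clifford (-s) t
         - (t powr s * bessel_clifford s t) * (bessel_clifford (-s + 1) t * 1))
          / (bessel_clifford (-s) t * bessel_clifford (-s) t)) (at t)"
      using pos(1)[OF t]
      by (intro DERIV_divide has_derivative_powr_bessel_clifford[OF t] has_derivative_bessel_clifford DERIV_ident) auto
    moreover have "(t powr (s - 1) * bessel_clifford (s - 1) t) * bessel_clifford (-s) t
         - (t powr s * bessel_clifford s t) * (bessel_clifford (-s + 1) t * 1) =
       t powr (s - 1) * (bessel_clifford (-s) t * bessel_clifford (s - 1) t - t * bessel_clifford s t * bessel_clifford (1 - s) t)"
    proof -
      have "t powr s = t powr (s - 1) * t" using t by (simp add: powr_diff)
      then show ?thesis by (simp add: algebra_simps)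
    qed
    ultimately show "\<exists>z. (?p has_real_derivative z) (at t) \<and> 0 \<le> z"
      using less_imp_le[OF W[of t]] by (intro exI conjI) (assumption, simp)
  qed
  have "(?d \<longlongrightarrow> 1) at_top" by real_asymp
  from order_tendstoD(2)[OF this p1] have "eventually (\<lambda>y. ?d y < ?p x) at_top" .
  then have "eventually (\<lambda>y. ?d y < ?p x \<and> x \<le> y) at_top"
    using eventually_ge_at_top by (rule eventually_conj)
  then obtain y where y: "?d y < ?p x" "x \<le> y"
    by (metis (no_types, lifting) eventually_happens' trivial_limit_at_top_linorder)
  with upper[of y] incr[of y] x show False by linarith
qed

text \<open>
  The derivative is $-x^{s-1}$ times the same combination for the order $1-s$, so the function
  decreases from its value at 0.
\<close>

lemma macdonald_le:
  assumes s: "0 < s" "s < 1" and x: "x > 0"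
  shows "macdonald s x \<le> rGamma (1 - s)"
proof -
  have "macdonald s x \<le> macdonald s 0"
  proof (rule DERIV_nonpos_imp_decreasing_open[OF less_imp_le[OF x]])
    fix t assume t: "0 < t" "t < x"
    have "(macdonald s has_real_derivative
        bessel_clifford (-s + 1) t * 1 - t powr (s - 1) * bessel_clifford (s - 1) t) (at t)"
      unfolding macdonald_def[abs_def]
      by (intro DERIV_diff has_derivative_powr_bessel_clifford[OF t(1)] has_derivative_bessel_clifford DERIV_ident)
    also have "bessel_clifford (-s + 1) t * 1 - t powr (s - 1) * bessel_clifford (s - 1) t =
       - (t powr (s - 1)) * macdonald (1 - s) t"
      using t by (simp add: macdonald_def algebra_simps flip: powr_add)
    finally show "\<exists>y. (macdonald s has_real_derivative y) (at t) \<and> y \<le> 0"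
      using macdonald_nonneg[of "1 - s" t] s t by (intro exI conjI) (assumption, simp)
  next
    have "continuous_on {0..x} (bessel_clifford \<nu>)" for \<nu>
      by (intro continuous_at_imp_continuous_on ballI isCont_bessel_clifford)
    then show "continuous_on {0..x} (macdonald s)"
      unfolding macdonald_def[abs_def] using s by (intro continuous_intros continuous_on_powr') auto
  qed
  then show ?thesis using s by (simp add: macdonald_def bessel_clifford_0)
qed

section \<open>Decay on the negative half line\<close>

text \<open>
  With $a = C_\nu(-y)$, $b = C_{\nu+1}(-y)$ and $\mu = \nu + 1/2$ the equations are $a' = -b$ and
  $y b' = a - (\nu+1) b$. The weighted energy $y^\mu (a^2 + y b^2)$ has a derivative of its own size
  divided by $y$; after subtracting the cross term $\mu y^\mu a b$ only $\frac{\mu}{2} y^{\mu-1} a b$ is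
  left, which is smaller by a factor $y^{-1/2}$ and hence integrable against the energy. So the
  energy stays bounded.
\<close>

lemma bessel_clifford_decay:
  assumes \<nu>: "\<bar>\<nu>\<bar> \<le> 1"
  obtains C where "\<And>y. y \<ge> 4 \<Longrightarrow> \<bar>bessel_clifford \<nu> (-y)\<bar> \<le> C * y powr (- \<nu> / 2 - 1 / 4)"
proof -
  define a where "a y = bessel_clifford \<nu> (-y)" for y
  define b where "b y = bessel_clifford (\<nu> + 1) (-y)" for y
  define \<mu> where "\<mu> = \<nu> + 1 / 2"
  have \<mu>: "\<bar>\<mu>\<bar> \<le> 3 / 2" using \<nu> unfolding \<mu>_def by linarith
  define Q where "Q y = (a y)\<^sup>2 + y * (b y)\<^sup>2" for y
  define E where "E y = y powr \<mu> * (Q y - \<mu> * (a y * b y))" for y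
  have ab: "\<bar>a y * b y\<bar> \<le> Q y / (2 * sqrt y)" if "y \<ge> 4" for y
  proof -
    have sq: "sqrt y > 0" "sqrt y * sqrt y = y" using that by auto
    have "0 \<le> (\<bar>a y\<bar> - sqrt y * \<bar>b y\<bar>)\<^sup>2" by simp
    also have "\<dots> = \<bar>a y\<bar>\<^sup>2 + (sqrt y * sqrt y) * \<bar>b y\<bar>\<^sup>2 - 2 * sqrt y * (\<bar>a y\<bar> * \<bar>b y\<bar>)"
      by (simp add: power2_eq_square algebra_simps del: real_sqrt_mult_self abs_mult_self_eq)
    finally have "2 * sqrt y * \<bar>a y * b y\<bar> \<le> Q y" unfolding sq(2) Q_def by (simp add: abs_mult)
    then show ?thesis using sq(1) by (simp add: field_simps)
  qed
  have Q0: "Q y \<ge> 0" if "y \<ge> 4" for y using that by (simp add: Q_def)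
  have sq2: "sqrt y \<ge> 2" if "y \<ge> 4" for y
    using real_sqrt_le_mono[OF that] by simp
  \<comment> \<open>From y = 4 on the cross term is absorbed by the energy.\<close>
  have ab4: "\<bar>a y * b y\<bar> \<le> Q y / 4" if "y \<ge> 4" for y
  proof -
    have "Q y / (2 * sqrt y) \<le> Q y / (2 * 2)"
      using that sq2[OF that] Q0[OF that] by (intro divide_left_mono mult_pos_pos mult_left_mono) auto
    then show ?thesis using ab[OF that] by simp
  qed
  have EQ: "5 / 8 * (y powr \<mu> * Q y) \<le> E y" if "y \<ge> 4" for y
  proof -
    have "\<bar>\<mu> * (a y * b y)\<bar> \<le> 3 / 2 * (Q y / 4)"
      unfolding abs_mult[of \<mu>] using \<mu> ab4[OF that] by (intro mult_mono) auto
    then have "5 / 8 * Q y \<le> Q y - \<mu> * (a y * b y)" by linarith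
    from mult_left_mono[OF this, of "y powr \<mu>"] show ?thesis by (simp add: E_def mult_ac)
  qed
  have da: "(a has_real_derivative - b y) (at y)" for y
    unfolding a_def[abs_def] b_def by (auto intro!: derivative_eq_intros)
  have db: "(b has_real_derivative (a y - (\<nu> + 1) * b y) / y) (at y)" if "y \<ge> 4" for y
  proof -
    have "(b has_real_derivative - bessel_clifford (\<nu> + 1 + 1) (-y)) (at y)"
      unfolding b_def[abs_def] by (auto intro!: derivative_eq_intros)
    moreover have "- bessel_clifford (\<nu> + 1 + 1) (-y) = (a y - (\<nu> + 1) * b y) / y"
      using bessel_clifford_rec[of \<nu> "-y"] that by (simp add: a_def b_def field_simps)
    ultimately show ?thesis by simp
  qed
  have dE: "(E has_real_derivative \<mu> / 2 * y powr (\<mu> - 1) * (a y * b y)) (at y)" if y: "y \<ge> 4" for y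
  proof -
    let ?b' = "(a y - (\<nu> + 1) * b y) / y"
    have "(E has_real_derivative
        (\<mu> * y powr (\<mu> - 1) * (Q y - \<mu> * (a y * b y)) + y powr \<mu> *
         ((2 * a y * (- b y) + ((b y)\<^sup>2 + y * (2 * b y * ?b'))) - \<mu> * (- b y * b y + a y * ?b')))) (at y)"
      unfolding E_def[abs_def] Q_def[abs_def]
      using y by (auto intro!: derivative_eq_intros da db)
    also have "y powr \<mu> = y powr (\<mu> - 1) * y" using y by (simp add: powr_diff)
    also have "\<mu> * y powr (\<mu> - 1) * (Q y - \<mu> * (a y * b y)) + y powr (\<mu> - 1) * y *
         ((2 * a y * (- b y) + ((b y)\<^sup>2 + y * (2 * b y * ?b'))) - \<mu> * (- b y * b y + a y * ?b')) =
       y powr (\<mu> - 1) * (\<mu> * (Q y - \<mu> * (a y * b y)) +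
         (2 * a y * (- b y) * y + (y * (b y)\<^sup>2 + y * (2 * b y * (y * ?b')))) - \<mu> * (- y * b y * b y + a y * (y * ?b')))"
      by (simp add: algebra_simps)
    also have "y * ?b' = a y - (\<nu> + 1) * b y" using y by simp
    also have "\<mu> * (Q y - \<mu> * (a y * b y)) +
         (2 * a y * (- b y) * y + (y * (b y)\<^sup>2 + y * (2 * b y * (a y - (\<nu> + 1) * b y)))) - \<mu> * (- y * b y * b y + a y * (a y - (\<nu> + 1) * b y))
       = \<mu> / 2 * (a y * b y)"
      by (simp add: Q_def \<mu>_def power2_eq_square field_simps)
    finally show ?thesis by (simp add: mult_ac)
  qed
  \<comment> \<open>The integrating factor for the differential inequality that bounds the derivative of E by
     y powr (-3/2) times E.\<close>
  define H where "H y = E y * exp (2 * y powr (-1/2))" for y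
  have H_le: "H y \<le> H 4" if "y \<ge> 4" for y
  proof (rule DERIV_nonpos_imp_nonincreasing[OF that])
    fix y :: real assume y: "4 \<le> y" 
    have "(H has_real_derivative
       (\<mu> / 2 * y powr (\<mu> - 1) * (a y * b y)) * exp (2 * y powr (-1/2)) + E y * (exp (2 * y powr (-1/2)) * (2 * ((-1/2) * y powr (-1/2 - 1))))) (at y)"
      unfolding H_def[abs_def] using y by (auto intro!: derivative_eq_intros dE)
    also have "(\<mu> / 2 * y powr (\<mu> - 1) * (a y * b y)) * exp (2 * y powr (-1/2)) + E y * (exp (2 * y powr (-1/2)) * (2 * ((-1/2) * y powr (-1/2 - 1))))
       = exp (2 * y powr (-1/2)) * (\<mu> / 2 * y powr (\<mu> - 1) * (a y * b y) - y powr (-3/2) * E y)"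
      by (simp add: algebra_simps)
    finally have D: "(H has_real_derivative exp (2 * y powr (-1/2)) * (\<mu> / 2 * y powr (\<mu> - 1) * (a y * b y) - y powr (-3/2) * E y)) (at y)" .
    have "\<bar>\<mu> / 2 * y powr (\<mu> - 1) * (a y * b y)\<bar> \<le> (3/4) * y powr (\<mu> - 1) * (Q y / (2 * sqrt y))"
      unfolding abs_mult[of _ "a y * b y"] abs_mult[of "\<mu> / 2"] using \<mu> ab[OF y] Q0[OF y] by (intro mult_mono) auto
    also have "\<dots> = 3/8 * (y powr (\<mu> - 1) * y powr (-1/2) * Q y)"
      using y by (simp add: powr_minus powr_half_sqrt field_simps)
    also have "y powr (\<mu> - 1) * y powr (-1/2) = y powr (-3/2) * y powr \<mu>"
      by (simp flip: powr_add)
    also have "3/8 * (y powr (-3/2) * y powr \<mu> * Q y) \<le> y powr (-3/2) * (5/8 * (y powr \<mu> * Q y))"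
      using Q0[OF y] by simp
    also have "\<dots> \<le> y powr (-3/2) * E y"
      by (intro mult_left_mono EQ[OF y]) auto
    finally have "\<mu> / 2 * y powr (\<mu> - 1) * (a y * b y) - y powr (-3/2) * E y \<le> 0" by linarith
    then show "\<exists>d. (H has_real_derivative d) (at y) \<and> d \<le> 0"
      using D by (intro exI conjI) (assumption, simp add: mult_nonneg_nonpos)
  qed
  show ?thesis
  proof (rule that[of "sqrt (8/5 * H 4)"])
    fix y :: real assume y: "y \<ge> 4"
    have "5/8 * (y powr \<mu> * (a y)\<^sup>2) \<le> 5/8 * (y powr \<mu> * Q y)"
      using y by (intro mult_left_mono) (auto simp: Q_def)
    also have "\<dots> \<le> E y * 1" using EQ[OF y] by simp
    also have "\<dots> \<le> H y"
    proof -
      have "0 \<le> 5 / 8 * (y powr \<mu> * Q y)" using Q0[OF y] by simp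
      then have "E y \<ge> 0" using EQ[OF y] by (rule order_trans)
      then show ?thesis unfolding H_def by (intro mult_left_mono) auto
    qed
    also have "\<dots> \<le> H 4" by (rule H_le[OF y])
    finally have "y powr \<mu> * (a y)\<^sup>2 \<le> 8/5 * H 4" by simp
    then have "sqrt (y powr \<mu> * (a y)\<^sup>2) \<le> sqrt (8/5 * H 4)" by simp
    then have "y powr (\<mu> / 2) * \<bar>a y\<bar> \<le> sqrt (8/5 * H 4)"
      using powr_half_sqrt[of "y powr \<mu>"] by (simp add: real_sqrt_mult powr_powr)
    then have "y powr (- (\<mu> / 2)) * (y powr (\<mu> / 2) * \<bar>a y\<bar>) \<le> y powr (- (\<mu> / 2)) * sqrt (8/5 * H 4)"
      by (intro mult_left_mono) auto
    also have "y powr (- (\<mu> / 2)) * (y powr (\<mu> / 2) * \<bar>a y\<bar>) = \<bar>a y\<bar>"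
      using y by (simp flip: powr_add mult.assoc)
    also have "- (\<mu> / 2) = - \<nu> / 2 - 1 / 4" by (simp add: \<mu>_def add_divide_distrib)
    finally show "\<bar>bessel_clifford \<nu> (-y)\<bar> \<le> sqrt (8/5 * H 4) * y powr (- \<nu> / 2 - 1 / 4)"
      by (simp add: a_def mult.commute)
  qed
qed

section \<open>The symbol as a function of one real variable\<close>

lemma bessel_I_eq:
  assumes "(w / 2)\<^sup>2 = of_real x"
  shows "bessel_I \<nu> w = (w / 2) powr of_real \<nu> * of_real (bessel_clifford \<nu> x)"
proof -
  have "(\<lambda>k. complex_of_real (bc_coeff \<nu> k * x ^ k)) sums of_real (bessel_clifford \<nu> x)"
    by (intro sums_of_real bessel_clifford_sums)
  also have "(\<lambda>k. complex_of_real (bc_coeff \<nu> k * x ^ k)) =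
      (\<lambda>k. (w / 2) ^ (2 * k) * of_real (rGamma (\<nu> + real k + 1)) / fact k)"
    by (simp add: fun_eq_iff power_mult assms bc_coeff_def)
  finally show ?thesis unfolding bessel_I_def by (simp add: sums_iff)
qed

text \<open>
  The symbol as a function of $x = z^2 p / 4$. On the half line $x < 0$ one has $\theta = -i$, and the
  exponential factor is the principal value of $(w/2)^{2s} / |x|^s$.
\<close>

definition msym_profile :: "real \<Rightarrow> real \<Rightarrow> complex" where
  "msym_profile s x = of_real (Gamma (1 - s)) *
     (of_real (bessel_clifford (-s) x) -
       (if x > 0 then 1 else exp (- (\<i> * of_real (pi * s)))) * of_real (\<bar>x\<bar> powr s * bessel_clifford s x))"

text \<open>
  Multiplying by $(w/2)^s$ cancels the power in front of $C_{-s}$ and leaves $(w/2)^{2s}$ in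
  front of $C_s$; the constants combine by $\Gamma(s) \Gamma(1-s) = \pi / \sin (\pi s)$.
\<close>

lemma msym_eq_profile:
  assumes s: "0 < s" "s < 1" and z: "z > 0" and p: "symb \<zeta> \<noteq> 0"
  shows "msym s z \<zeta> = msym_profile s (z\<^sup>2 * symb \<zeta> / 4)"
proof -
  define r where "r = z * \<bar>symb \<zeta>\<bar> powr (1/2) / 2"
  define x where "x = z\<^sup>2 * symb \<zeta> / 4"
  define w where "w = of_real z * theta \<zeta> * of_real (\<bar>symb \<zeta>\<bar> powr (1/2))"
  have r: "r > 0" using z p by (simp add: r_def)
  have w2: "w / 2 = of_real r * theta \<zeta>" by (simp add: w_def r_def)
  have w: "w = of_real 2 * (of_real r * theta \<zeta>)" using w2 by simp
  have th: "theta \<zeta> \<noteq> 0" by (simp add: theta_def)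
  have x: "\<bar>x\<bar> = r\<^sup>2" using z p
    by (simp add: x_def r_def power_mult_distrib power_divide abs_mult powr_half_sqrt)
  have sgx: "x > 0 \<longleftrightarrow> symb \<zeta> > 0" using z by (simp add: x_def zero_less_mult_iff)
  have w2x: "(w / 2)\<^sup>2 = of_real x"
  proof (cases "symb \<zeta> > 0")
    case True
    then show ?thesis using x sgx by (simp add: w2 theta_def flip: of_real_power)
  next
    case False
    then have "x = - (r\<^sup>2)" using x sgx by linarith
    with False show ?thesis by (simp add: w2 theta_def power_mult_distrib)
  qed
  have Ln: "Ln (of_real r * theta \<zeta>) = of_real (ln r) + (if x > 0 then 0 else - (\<i> * pi / 2))"
    using r th sgx Ln_of_real[OF r] by (simp add: Ln_times_of_real theta_def)
  have v2: "(w / 2) powr of_real s * (w / 2) powr of_real s =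
      (if x > 0 then 1 else exp (- (\<i> * of_real (pi * s)))) * of_real (\<bar>x\<bar> powr s)"
  proof -
    have "(w / 2) powr of_real s * (w / 2) powr of_real s = exp (2 * of_real s * Ln (of_real r * theta \<zeta>))"
      using r th by (simp add: w2 powr_def mult.assoc flip: exp_add)
    also have "\<dots> = exp (if x > 0 then 0 else - (\<i> * of_real (pi * s))) * exp (of_real (2 * s * ln r))"
      unfolding Ln exp_add[symmetric] by (rule arg_cong[where f = exp]) (simp add: distrib_left)
    also have "exp (of_real (2 * s * ln r)) = complex_of_real (\<bar>x\<bar> powr s)"
      unfolding x exp_of_real using r by (simp add: powr_def ln_realpow mult_ac)
    finally show ?thesis by simp
  qed
  have wpow: "w powr of_real s = of_real (2 powr s) * (w / 2) powr of_real s"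
  proof -
    have "w powr of_real s = exp (of_real s * (Ln (of_real 2 * (of_real r * theta \<zeta>))))"
      using r th w by (simp add: powr_def)
    also have "Ln (of_real 2 * (of_real r * theta \<zeta>)) = of_real (ln 2) + Ln (of_real r * theta \<zeta>)"
      using r th Ln_of_real[of 2] by (subst Ln_times_of_real) auto
    also have "exp (of_real s * (of_real (ln 2) + Ln (of_real r * theta \<zeta>))) = of_real (2 powr s) * (w / 2) powr of_real s"
      using r th by (simp add: w2 powr_def exp_add distrib_left exp_of_real flip: of_real_mult)
    finally show ?thesis .
  qed
  have vm: "(w / 2) powr of_real s * (w / 2) powr of_real (-s) = 1"
    using r th by (simp add: w2 powr_def flip: exp_add)
  have alg: "A / G * (P * V) * (q / 2 * (V' * b - V * c) / S) = (A * P / of_real 2 * (q / S) / G) * ((V * V') * b - (V * V) * c)"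
    for A G P V q V' b c S :: complex
  proof -
    have "A / G * (P * V) * (q / 2 * D / S) = A * P / of_real 2 * (q / S) / G * (V * D)" for D
      by (simp add: mult_ac)
    moreover have "V * (V' * b - V * c) = (V * V') * b - (V * V) * c"
      by (simp add: right_diff_distrib mult.assoc)
    ultimately show ?thesis by (simp only:)
  qed
  let ?B1 = "complex_of_real (bessel_clifford (-s) x)" and ?B2 = "complex_of_real (bessel_clifford s x)"
  have "msym s z \<zeta> = of_real (2 powr (1 - s) / Gamma s) * w powr of_real s * bessel_K s w"
    by (simp add: msym_def w_def Let_def)
  also have "bessel_K s w = of_real pi / 2 * ((w / 2) powr of_real (-s) * ?B1 - (w / 2) powr of_real s * ?B2) / of_real (sin (s * pi))"
    unfolding bessel_K_def bessel_I_eq[OF w2x] ..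
  also have "of_real (2 powr (1 - s) / Gamma s) * w powr of_real s * (of_real pi / 2 * ((w / 2) powr of_real (-s) * ?B1 - (w / 2) powr of_real s * ?B2) / of_real (sin (s * pi)))
     = of_real (2 powr (1 - s) * 2 powr s / 2 * (pi / sin (s * pi)) / Gamma s) *
       (((w / 2) powr of_real s * (w / 2) powr of_real (-s)) * ?B1 - ((w / 2) powr of_real s * (w / 2) powr of_real s) * ?B2)"
    unfolding wpow of_real_mult of_real_divide by (rule alg)
  also have "2 powr (1 - s) * 2 powr s / 2 * (pi / sin (s * pi)) / Gamma s = Gamma (1 - s)"
  proof -
    have "complex_of_real (Gamma s * Gamma (1 - s)) = of_real (pi / sin (s * pi))"
      using Gamma_reflection_complex[of "of_real s"]
        Gamma_complex_of_real[of s] Gamma_complex_of_real[of "1 - s"]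
      by (simp add: sin_of_real mult.commute flip: of_real_mult)
    then have R: "Gamma s * Gamma (1 - s) = pi / sin (s * pi)" by (simp only: of_real_eq_iff)
    have P: "2 powr (1 - s) * 2 powr s = (2::real)" by (simp flip: powr_add)
    have "Gamma s > 0" using s by simp
    then show ?thesis unfolding R[symmetric] P by simp
  qed
  also have "of_real (Gamma (1 - s)) *
       (((w / 2) powr of_real s * (w / 2) powr of_real (-s)) * ?B1 - ((w / 2) powr of_real s * (w / 2) powr of_real s) * ?B2)
     = msym_profile s x"
    unfolding v2 vm msym_profile_def by (simp add: mult.assoc)
  finally show ?thesis unfolding x_def .
qed

lemma norm_msym_profile_pos:
  assumes s: "0 < s" "s < 1" and x: "x > 0"
  shows "norm (msym_profile s x) \<le> 1"
proof -
  have G: "Gamma (1 - s) > 0" using s by simp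
  have "msym_profile s x = of_real (Gamma (1 - s) * macdonald s x)"
    using x by (simp add: msym_profile_def macdonald_def)
  then have "norm (msym_profile s x) = Gamma (1 - s) * macdonald s x"
    using G macdonald_nonneg[OF s x] by (simp add: norm_mult)
  also have "\<dots> \<le> Gamma (1 - s) * rGamma (1 - s)"
    using G macdonald_le[OF s x] by (intro mult_left_mono) auto
  also have "\<dots> = 1" using G by (simp add: rGamma_inverse_Gamma)
  finally show ?thesis .
qed

lemma norm_msym_profile_le:
  assumes "0 < s" "s < 1"
  shows "norm (msym_profile s x) \<le> Gamma (1 - s) * (\<bar>bessel_clifford (-s) x\<bar> + \<bar>x\<bar> powr s * \<bar>bessel_clifford s x\<bar>)"
proof -
  have "norm (msym_profile s x) \<le> Gamma (1 - s) * (norm (of_real (bessel_clifford (-s) x) :: complex) +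
     norm ((if x > 0 then 1 else exp (- (\<i> * of_real (pi * s)))) * complex_of_real (\<bar>x\<bar> powr s * bessel_clifford s x)))"
    unfolding msym_profile_def norm_mult[of "of_real (Gamma (1 - s))"]
    using assms by (intro mult_mono norm_triangle_ineq4) auto
  also have "norm ((if x > 0 then 1 else exp (- (\<i> * of_real (pi * s)))) * complex_of_real (\<bar>x\<bar> powr s * bessel_clifford s x)) = \<bar>x\<bar> powr s * \<bar>bessel_clifford s x\<bar>"
    by (simp add: norm_mult abs_mult)
  finally show ?thesis by simp
qed

text \<open>
  The positive half line is covered by the bounds on \<^const>\<open>macdonald\<close>, the interval from $-4$ to 0 by
  compactness. For $x < -4$ the decay estimate gives $|x|^{s/2-1/4}$ for both terms, since
  $|x|^s |x|^{-s/2-1/4}$ has the same exponent.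
\<close>

lemma msym_profile_growth:
  assumes s: "0 < s" "s < 1"
  obtains C where "C \<ge> 1" "\<And>x. norm (msym_profile s x) \<le> C * (max 1 \<bar>x\<bar>) powr (max 0 (s / 2 - 1 / 4))"
proof -
  obtain C1 where C1: "\<And>y. y \<ge> 4 \<Longrightarrow> \<bar>bessel_clifford (-s) (-y)\<bar> \<le> C1 * y powr (- (-s) / 2 - 1 / 4)"
    using bessel_clifford_decay[of "-s"] s by auto
  obtain C2 where C2: "\<And>y. y \<ge> 4 \<Longrightarrow> \<bar>bessel_clifford s (-y)\<bar> \<le> C2 * y powr (- s / 2 - 1 / 4)"
    using bessel_clifford_decay[of s] s by auto
  have cont: "continuous_on {-4..0::real} (\<lambda>x. Gamma (1 - s) * (\<bar>bessel_clifford (-s) x\<bar> + \<bar>x\<bar> powr s * \<bar>bessel_clifford s x\<bar>))"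
  proof -
    have "continuous_on {-4..0::real} (bessel_clifford \<nu>)" for \<nu>
      by (intro continuous_at_imp_continuous_on ballI isCont_bessel_clifford)
    then show ?thesis using s by (intro continuous_intros continuous_on_powr') auto
  qed
  have "compact ((\<lambda>x. Gamma (1 - s) * (\<bar>bessel_clifford (-s) x\<bar> + \<bar>x\<bar> powr s * \<bar>bessel_clifford s x\<bar>)) ` {-4..0::real})"
    by (intro compact_continuous_image cont) auto
  then obtain C3 where C3: "\<And>x. x \<in> {-4..0::real} \<Longrightarrow>
      norm (Gamma (1 - s) * (\<bar>bessel_clifford (-s) x\<bar> + \<bar>x\<bar> powr s * \<bar>bessel_clifford s x\<bar>)) \<le> C3"
    using compact_imp_bounded bounded_iff by (metis (no_types, lifting) imageI)
  let ?e = "max 0 (s / 2 - 1 / 4)"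
  let ?C = "max 1 (max C3 (Gamma (1 - s) * (\<bar>C1\<bar> + \<bar>C2\<bar>)))"
  show ?thesis
  proof (rule that[of ?C])
    fix x :: real
    have G: "Gamma (1 - s) > 0" using s by simp
    have one: "(max 1 \<bar>x\<bar>) powr ?e \<ge> 1" by (intro ge_one_powr_ge_zero) auto
    consider "x > 0" | "x \<in> {-4..0}" | "x < -4" by force
    then show "norm (msym_profile s x) \<le> ?C * (max 1 \<bar>x\<bar>) powr ?e"
    proof cases
      case 1
      then have "norm (msym_profile s x) \<le> 1 * 1" using norm_msym_profile_pos[OF s] by simp
      also have "\<dots> \<le> ?C * (max 1 \<bar>x\<bar>) powr ?e" using one by (intro mult_mono) auto
      finally show ?thesis .
    next
      case 2
      then have "norm (msym_profile s x) \<le> C3 * 1"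
        using norm_msym_profile_le[OF s, of x] C3[of x] by simp
      also have "\<dots> \<le> ?C * 1" by simp
      also have "\<dots> \<le> ?C * (max 1 \<bar>x\<bar>) powr ?e" using one by (intro mult_left_mono) auto
      finally show ?thesis .
    next
      case 3
      define y where "y = - x"
      have y: "y \<ge> 4" "y > 1" "x = - y" using 3 by (auto simp: y_def)
      have "norm (msym_profile s x) \<le> Gamma (1 - s) * (\<bar>bessel_clifford (-s) (-y)\<bar> + y powr s * \<bar>bessel_clifford s (-y)\<bar>)"
        using norm_msym_profile_le[OF s, of x] y by simp
      also have "\<dots> \<le> Gamma (1 - s) * (C1 * y powr (- (-s) / 2 - 1 / 4) + y powr s * (C2 * y powr (- s / 2 - 1 / 4)))"
        using G C1[OF y(1)] C2[OF y(1)] by (intro mult_left_mono add_mono) auto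
      also have "\<dots> = Gamma (1 - s) * (C1 + C2) * y powr (s / 2 - 1 / 4)"
      proof -
        have "y powr s * y powr (- s / 2 - 1 / 4) = y powr (s / 2 - 1 / 4)"
          by (simp flip: powr_add)
        then show ?thesis by (simp add: algebra_simps)
      qed
      also have "\<dots> \<le> ?C * y powr ?e"
        using G y by (intro mult_mono powr_mono) (auto intro!: max.coboundedI2 mult_left_mono)
      also have "y powr ?e = (max 1 \<bar>x\<bar>) powr ?e" using y by simp
      finally show ?thesis .
    qed
  qed simp
qed

lemma msym_profile_tendsto:
  assumes s: "0 < s" "s < 1"
  shows "(msym_profile s \<longlongrightarrow> 1) (at 0)"
proof -
  let ?c = "\<lambda>x::real. if x > 0 then 1 else exp (- (\<i> * of_real (pi * s)))"
  have B: "(bessel_clifford \<nu> \<longlongrightarrow> rGamma (\<nu> + 1)) (at 0)" for \<nu>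
    using isCont_bessel_clifford[where \<nu> = \<nu> and x = 0] unfolding isCont_def bessel_clifford_0 .
  have "((\<lambda>x::real. \<bar>x\<bar> powr s * bessel_clifford s x) \<longlongrightarrow> 0 powr s * rGamma (s + 1)) (at 0)"
    using s by (intro tendsto_mult B tendsto_powr') (auto intro!: tendsto_eq_intros)
  then have "((\<lambda>x::real. \<bar>x\<bar> powr s * bessel_clifford s x) \<longlongrightarrow> 0) (at 0)" by simp
  from tendsto_rabs_zero[OF this] have "((\<lambda>x. ?c x * of_real (\<bar>x\<bar> powr s * bessel_clifford s x)) \<longlongrightarrow> 0) (at 0)"
    by (subst tendsto_norm_zero_iff[symmetric]) (simp add: norm_mult if_distrib[of norm] abs_mult cong: if_cong)
  then have "(msym_profile s \<longlongrightarrow> of_real (Gamma (1 - s)) * (of_real (rGamma (-s + 1)) - 0)) (at 0)"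
    unfolding msym_profile_def[abs_def] by (intro tendsto_intros B)
  also have "of_real (Gamma (1 - s)) * (of_real (rGamma (-s + 1)) - 0) = (1 :: complex)"
  proof -
    have G: "Gamma (1 - s) > 0" using s by simp
    have "Gamma (1 - s) * rGamma (1 - s) = 1" using G by (simp add: rGamma_inverse_Gamma)
    then show ?thesis by (simp flip: of_real_mult)
  qed
  finally show ?thesis .
qed

lemma measurable_msym_profile [measurable]: "msym_profile s \<in> borel_measurable borel"
proof -
  have [measurable]: "bessel_clifford \<nu> \<in> borel_measurable borel" for \<nu>
    by (intro borel_measurable_continuous_onI continuous_at_imp_continuous_on ballI isCont_bessel_clifford)
  show ?thesis unfolding msym_profile_def[abs_def] by measurable
qed

section \<open>The space of square integrable functions\<close>

lemma borel_measurable_cnj [measurable (raw)]: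
  "f \<in> borel_measurable M \<Longrightarrow> (\<lambda>x. cnj (f x)) \<in> borel_measurable M"
  using measurable_compose[of f M borel cnj borel]
    borel_measurable_continuous_onI[OF continuous_on_cnj[OF continuous_on_id]] by simp

lemma L2_measurable [measurable_dest]: "u \<in> L2 \<Longrightarrow> u \<in> borel_measurable borel"
  by (simp add: L2_def)

lemma L2_integrable: "u \<in> L2 \<Longrightarrow> integrable lborel (\<lambda>x. (cmod (u x))\<^sup>2)"
  by (simp add: L2_def)

lemma L2I: "u \<in> borel_measurable borel \<Longrightarrow> integrable lborel (\<lambda>x. (cmod (u x))\<^sup>2) \<Longrightarrow> u \<in> L2"
  by (simp add: L2_def)

lemma L2norm_nonneg [simp]: "0 \<le> L2norm u"
  by (simp add: L2norm_def)

lemma L2norm_power2: "(L2norm u)\<^sup>2 = (\<integral>x. (cmod (u x))\<^sup>2 \<partial>lborel)"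
  by (simp add: L2norm_def)

lemma L2norm_cong_AE:
  assumes [measurable]: "u \<in> borel_measurable borel" "v \<in> borel_measurable borel"
    and "AE x in lborel. u x = v x"
  shows "L2norm u = L2norm v"
  unfolding L2norm_def using assms(3) by (intro arg_cong[where f = sqrt] integral_cong_AE) auto

lemma L2_bounded:
  assumes f: "f \<in> L2" and [measurable]: "g \<in> borel_measurable borel"
    and le: "AE x in lborel. cmod (g x) \<le> C * cmod (f x)" and C: "C \<ge> 0"
  shows "g \<in> L2" "L2norm g \<le> C * L2norm f"
proof -
  note [measurable] = L2_measurable[OF f]
  have sq: "AE x in lborel. (cmod (g x))\<^sup>2 \<le> C\<^sup>2 * (cmod (f x))\<^sup>2"
    using le by eventually_elim (simp add: power_mono flip: power_mult_distrib)
  have i: "integrable lborel (\<lambda>x. C\<^sup>2 * (cmod (f x))\<^sup>2)"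
    using L2_integrable[OF f] by simp
  show "g \<in> L2"
    by (rule L2I[OF _ Bochner_Integration.integrable_bound[OF i]]) (use sq in auto)
  then have "(L2norm g)\<^sup>2 \<le> (\<integral>x. C\<^sup>2 * (cmod (f x))\<^sup>2 \<partial>lborel)"
    unfolding L2norm_power2 by (intro integral_mono_AE L2_integrable i sq)
  also have "\<dots> = (C * L2norm f)\<^sup>2" by (simp add: power_mult_distrib L2norm_power2)
  finally show "L2norm g \<le> C * L2norm f"
    by (rule power2_le_imp_le) (use C in simp)
qed

lemma L2_zero [simp]: "(\<lambda>x. 0) \<in> L2"
  by (rule L2I) auto

lemma L2_add [intro]:
  assumes u: "u \<in> L2" and v: "v \<in> L2"
  shows "(\<lambda>x. u x + v x) \<in> L2"
proof (rule L2I)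
  note [measurable] = L2_measurable[OF u] L2_measurable[OF v]
  show "(\<lambda>x. u x + v x) \<in> borel_measurable borel" by measurable
  have i: "integrable lborel (\<lambda>x. 2 * (cmod (u x))\<^sup>2 + 2 * (cmod (v x))\<^sup>2)"
    using L2_integrable[OF u] L2_integrable[OF v] by simp
  have "(cmod (a + b))\<^sup>2 \<le> 2 * (cmod a)\<^sup>2 + 2 * (cmod b)\<^sup>2" for a b
  proof -
    have "(cmod (a + b))\<^sup>2 \<le> (cmod a + cmod b)\<^sup>2" by (intro power_mono norm_triangle_ineq) auto
    also have "\<dots> \<le> 2 * (cmod a)\<^sup>2 + 2 * (cmod b)\<^sup>2"
      using sum_squares_bound[of "cmod a" "cmod b"] by (simp add: power2_sum)
    finally show ?thesis .
  qed
  then show "integrable lborel (\<lambda>x. (cmod (u x + v x))\<^sup>2)"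
    by (intro Bochner_Integration.integrable_bound[OF i]) auto
qed

lemma L2_cmult [intro]: "u \<in> L2 \<Longrightarrow> (\<lambda>x. c * u x) \<in> L2"
  by (rule L2_bounded(1)[of u _ "cmod c"]) (auto simp: norm_mult)

lemma L2_diff [intro]: "u \<in> L2 \<Longrightarrow> v \<in> L2 \<Longrightarrow> (\<lambda>x. u x - v x) \<in> L2"
  using L2_add[of u "\<lambda>x. (-1) * v x"] L2_cmult[of v "-1"] by simp

lemma L2_cnj [intro]: "u \<in> L2 \<Longrightarrow> (\<lambda>x. cnj (u x)) \<in> L2"
  by (rule L2_bounded(1)[of u _ 1]) auto

lemma L2norm_cnj: "L2norm (\<lambda>x. cnj (u x)) = L2norm u"
  by (simp add: L2norm_def)

lemma L2norm_minus_commute: "L2norm (\<lambda>x. u x - v x) = L2norm (\<lambda>x. v x - u x)"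
  by (simp add: L2norm_def norm_minus_commute)

lemma L2norm_cmult: "L2norm (\<lambda>x. c * u x) = cmod c * L2norm u"
  by (simp add: L2norm_def norm_mult power_mult_distrib real_sqrt_mult)

lemma L2_integrable_mult:
  assumes u: "u \<in> L2" and v: "v \<in> L2"
  shows "integrable lborel (\<lambda>x. u x * v x)"
proof -
  note [measurable] = L2_measurable[OF u] L2_measurable[OF v]
  have i: "integrable lborel (\<lambda>x. (cmod (u x))\<^sup>2 + (cmod (v x))\<^sup>2)"
    using L2_integrable[OF u] L2_integrable[OF v] by simp
  have "cmod (a * b) \<le> (cmod a)\<^sup>2 + (cmod b)\<^sup>2" for a b
  proof -
    have "2 * (cmod a * cmod b) \<le> (cmod a)\<^sup>2 + (cmod b)\<^sup>2"
      using sum_squares_bound[of "cmod a" "cmod b"] by simp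
    moreover have "0 \<le> cmod a * cmod b" by simp
    ultimately show ?thesis unfolding norm_mult by linarith
  qed
  then show ?thesis
    by (intro Bochner_Integration.integrable_bound[OF i]) auto
qed

lemma L2_Cauchy_Schwarz:
  assumes u: "u \<in> L2" and v: "v \<in> L2"
  shows "(\<integral>x. cmod (u x * v x) \<partial>lborel) \<le> L2norm u * L2norm v"
proof -
  note [measurable] = L2_measurable[OF u] L2_measurable[OF v]
  let ?I = "\<integral>x. cmod (u x * v x) \<partial>lborel"
  have n2: "(\<integral>\<^sup>+x. (ennreal (cmod (w x)))\<^sup>2 \<partial>lborel) = ennreal ((L2norm w)\<^sup>2)" if "w \<in> L2" for w :: "'a \<Rightarrow> complex"
    unfolding L2norm_power2 using L2_integrable[OF that] by (simp add: ennreal_power nn_integral_eq_integral)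
  have "(\<integral>\<^sup>+x. ennreal (cmod (u x)) * ennreal (cmod (v x)) \<partial>lborel) = ennreal ?I"
    using integrable_norm[OF L2_integrable_mult[OF u v]]
    by (subst nn_integral_eq_integral[symmetric]) (auto simp: ennreal_mult norm_mult)
  then have "(ennreal ?I)\<^sup>2 \<le> ennreal ((L2norm u)\<^sup>2) * ennreal ((L2norm v)\<^sup>2)"
    using Cauchy_Schwarz_nn_integral[of "\<lambda>x. ennreal (cmod (u x))" lborel "\<lambda>x. ennreal (cmod (v x))"]
    unfolding n2[OF u] n2[OF v] by simp
  then have "?I\<^sup>2 \<le> (L2norm u * L2norm v)\<^sup>2"
    by (simp add: ennreal_power power_mult_distrib flip: ennreal_mult)
  then show ?thesis by (rule power2_le_imp_le) simp
qed

lemma L2norm_triangle: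
  assumes u: "u \<in> L2" and v: "v \<in> L2"
  shows "L2norm (\<lambda>x. u x + v x) \<le> L2norm u + L2norm v"
proof (rule power2_le_imp_le)
  note uv = L2_integrable[OF u] L2_integrable[OF v] integrable_norm[OF L2_integrable_mult[OF u v]]
  have "(L2norm (\<lambda>x. u x + v x))\<^sup>2 \<le> (\<integral>x. (cmod (u x))\<^sup>2 + (cmod (v x))\<^sup>2 + 2 * cmod (u x * v x) \<partial>lborel)"
    unfolding L2norm_power2
  proof (rule integral_mono)
    show "integrable lborel (\<lambda>x. (cmod (u x + v x))\<^sup>2)" by (intro L2_integrable L2_add u v)
    show "integrable lborel (\<lambda>x. (cmod (u x))\<^sup>2 + (cmod (v x))\<^sup>2 + 2 * cmod (u x * v x))" using uv by simp
    fix x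
    have "(cmod (u x + v x))\<^sup>2 \<le> (cmod (u x) + cmod (v x))\<^sup>2" by (intro power_mono norm_triangle_ineq) auto
    then show "(cmod (u x + v x))\<^sup>2 \<le> (cmod (u x))\<^sup>2 + (cmod (v x))\<^sup>2 + 2 * cmod (u x * v x)"
      by (simp add: power2_sum norm_mult)
  qed
  also have "\<dots> = (L2norm u)\<^sup>2 + (L2norm v)\<^sup>2 + 2 * (\<integral>x. cmod (u x * v x) \<partial>lborel)"
    unfolding L2norm_power2 using uv by simp
  also have "\<dots> \<le> (L2norm u + L2norm v)\<^sup>2"
    using L2_Cauchy_Schwarz[OF u v] by (simp add: power2_sum)
  finally show "(L2norm (\<lambda>x. u x + v x))\<^sup>2 \<le> (L2norm u + L2norm v)\<^sup>2" .
qed simp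

lemma L2norm_diff_triangle:
  assumes "u \<in> L2" "v \<in> L2" "w \<in> L2"
  shows "L2norm (\<lambda>x. u x - w x) \<le> L2norm (\<lambda>x. u x - v x) + L2norm (\<lambda>x. v x - w x)"
  using L2norm_triangle[of "\<lambda>x. u x - v x" "\<lambda>x. v x - w x"] assms by (auto simp: L2_diff)

lemma L2norm_diff_le:
  assumes "u \<in> L2" "v \<in> L2"
  shows "\<bar>L2norm u - L2norm v\<bar> \<le> L2norm (\<lambda>x. u x - v x)"
  using L2norm_diff_triangle[of u v "\<lambda>x. 0"] L2norm_diff_triangle[of v u "\<lambda>x. 0"] assms
  by (auto simp: L2norm_minus_commute[of v u])

lemma L2norm_eq_0_imp_AE:
  assumes u: "u \<in> L2" and 0: "L2norm u = 0"
  shows "AE x in lborel. u x = 0"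
proof -
  have "(\<integral>x. (cmod (u x))\<^sup>2 \<partial>lborel) = 0" using 0 L2norm_power2[of u] by simp
  then show ?thesis by (subst (asm) integral_nonneg_eq_0_iff_AE[OF L2_integrable[OF u]]) auto
qed

definition L2_inner :: "('a::euclidean_space \<Rightarrow> complex) \<Rightarrow> ('a \<Rightarrow> complex) \<Rightarrow> complex" where
  "L2_inner u v = (\<integral>x. u x * cnj (v x) \<partial>lborel)"

lemma L2_inner_le:
  assumes "u \<in> L2" "v \<in> L2"
  shows "cmod (L2_inner u v) \<le> L2norm u * L2norm v"
proof -
  have "cmod (L2_inner u v) \<le> (\<integral>x. cmod (u x * cnj (v x)) \<partial>lborel)"
    unfolding L2_inner_def by (rule integral_norm_bound)
  also have "\<dots> \<le> L2norm u * L2norm v"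
    using L2_Cauchy_Schwarz[OF assms(1) L2_cnj[OF assms(2)]] by (simp add: L2norm_cnj)
  finally show ?thesis .
qed

lemma L2_inner_self: "u \<in> L2 \<Longrightarrow> L2_inner u u = of_real ((L2norm u)\<^sup>2)"
  by (simp add: L2_inner_def L2norm_power2 flip: complex_norm_square of_real_power)

lemma L2norm_diff_power2:
  assumes u: "u \<in> L2" and v: "v \<in> L2"
  shows "(L2norm (\<lambda>x. u x - v x))\<^sup>2 = (L2norm u)\<^sup>2 + (L2norm v)\<^sup>2 - 2 * Re (L2_inner u v)"
proof -
  have i: "integrable lborel (\<lambda>x. u x * cnj (v x))" by (intro L2_integrable_mult L2_cnj u v)
  define q where "q x = Re (u x * cnj (v x))" for x
  have q: "integrable lborel q" unfolding q_def[abs_def] by (intro integrable_Re i)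
  have Rq: "Re (L2_inner u v) = (\<integral>x. q x \<partial>lborel)"
    unfolding L2_inner_def q_def by (rule integral_Re[OF i, symmetric])
  have "(cmod (u x - v x))\<^sup>2 = (cmod (u x))\<^sup>2 + (cmod (v x))\<^sup>2 - 2 * q x" for x
    unfolding cmod_power2 q_def by (simp add: power2_eq_square algebra_simps)
  then show ?thesis
    unfolding L2norm_power2 Rq using L2_integrable[OF u] L2_integrable[OF v] q by simp
qed

lemma L2_tendsto_norm:
  assumes "L2_tendsto f l F"
  shows "((\<lambda>n. L2norm (f n)) \<longlongrightarrow> L2norm l) F"
proof -
  have l: "l \<in> L2" and ev: "\<forall>\<^sub>F z in F. f z \<in> L2"
    and lim: "((\<lambda>z. L2norm (\<lambda>x. f z x - l x)) \<longlongrightarrow> 0) F"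
    using assms by (auto simp: L2_tendsto_def)
  have "\<forall>\<^sub>F z in F. norm (L2norm (f z) - L2norm l) \<le> L2norm (\<lambda>x. f z x - l x)"
    using ev by eventually_elim (use L2norm_diff_le l in auto)
  then have "((\<lambda>z. L2norm (f z) - L2norm l) \<longlongrightarrow> 0) F"
    by (rule Lim_null_comparison[OF _ lim])
  then show ?thesis by (subst (asm) LIM_zero_iff)
qed

lemma L2_tendsto_add:
  assumes "L2_tendsto f u F" "L2_tendsto g v F"
  shows "L2_tendsto (\<lambda>n x. f n x + g n x) (\<lambda>x. u x + v x) F"
  unfolding L2_tendsto_def
proof (intro conjI)
  have A: "u \<in> L2" "v \<in> L2" "\<forall>\<^sub>F z in F. f z \<in> L2" "\<forall>\<^sub>F z in F. g z \<in> L2"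
    "((\<lambda>z. L2norm (\<lambda>x. f z x - u x)) \<longlongrightarrow> 0) F" "((\<lambda>z. L2norm (\<lambda>x. g z x - v x)) \<longlongrightarrow> 0) F"
    using assms by (auto simp: L2_tendsto_def)
  show "(\<lambda>x. u x + v x) \<in> L2" using A by auto
  show "\<forall>\<^sub>F z in F. (\<lambda>x. f z x + g z x) \<in> L2"
    using A(3,4) by eventually_elim auto
  have "\<forall>\<^sub>F z in F. norm (L2norm (\<lambda>x. f z x + g z x - (u x + v x))) \<le> L2norm (\<lambda>x. f z x - u x) + L2norm (\<lambda>x. g z x - v x)"
    using A(3,4)
  proof eventually_elim
    case (elim z)
    then show ?case
      using L2norm_triangle[of "\<lambda>x. f z x - u x" "\<lambda>x. g z x - v x"] A by (simp add: L2_diff algebra_simps)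
  qed
  moreover have "((\<lambda>z. L2norm (\<lambda>x. f z x - u x) + L2norm (\<lambda>x. g z x - v x)) \<longlongrightarrow> 0) F"
    using tendsto_add[OF A(5,6)] by simp
  ultimately show "((\<lambda>z. L2norm (\<lambda>x. f z x + g z x - (u x + v x))) \<longlongrightarrow> 0) F"
    by (rule Lim_null_comparison)
qed

lemma L2_tendsto_cmult:
  assumes "L2_tendsto f u F"
  shows "L2_tendsto (\<lambda>n x. c * f n x) (\<lambda>x. c * u x) F"
proof -
  have A: "u \<in> L2" "\<forall>\<^sub>F z in F. f z \<in> L2" "((\<lambda>z. L2norm (\<lambda>x. f z x - u x)) \<longlongrightarrow> 0) F"
    using assms by (auto simp: L2_tendsto_def)
  have "\<forall>\<^sub>F z in F. (\<lambda>x. c * f z x) \<in> L2" using A(2) by eventually_elim auto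
  moreover have "((\<lambda>z. L2norm (\<lambda>x. c * f z x - c * u x)) \<longlongrightarrow> 0) F"
    unfolding right_diff_distrib[symmetric] L2norm_cmult using tendsto_mult_right_zero[OF A(3)] by simp
  ultimately show ?thesis using A by (auto simp: L2_tendsto_def)
qed

lemma L2_tendsto_cong_AE:
  assumes f: "L2_tendsto f u F" and v: "v \<in> borel_measurable borel" and uv: "AE x in lborel. u x = v x"
  shows "L2_tendsto f v F"
proof -
  have A: "u \<in> L2" "\<forall>\<^sub>F z in F. f z \<in> L2" "((\<lambda>z. L2norm (\<lambda>x. f z x - u x)) \<longlongrightarrow> 0) F"
    using f by (auto simp: L2_tendsto_def)
  note [measurable] = L2_measurable[OF A(1)] v
  have "v \<in> L2"
    by (rule L2_bounded(1)[OF A(1) v, of 1]) (use uv in auto)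
  have "\<forall>\<^sub>F z in F. L2norm (\<lambda>x. f z x - u x) = L2norm (\<lambda>x. f z x - v x)"
    using A(2)
  proof eventually_elim
    case (elim z)
    note [measurable] = L2_measurable[OF elim]
    show ?case by (rule L2norm_cong_AE) (use uv in auto)
  qed
  from tendsto_cong[OF this] show ?thesis
    using A \<open>v \<in> L2\<close> by (simp add: L2_tendsto_def)
qed

lemma L2_inner_tendsto:
  assumes "L2_tendsto f u F" "L2_tendsto g v F"
  shows "((\<lambda>n. L2_inner (f n) (g n)) \<longlongrightarrow> L2_inner u v) F"
proof -
  have A: "u \<in> L2" "v \<in> L2" "\<forall>\<^sub>F z in F. f z \<in> L2" "\<forall>\<^sub>F z in F. g z \<in> L2"
    "((\<lambda>z. L2norm (\<lambda>x. f z x - u x)) \<longlongrightarrow> 0) F" "((\<lambda>z. L2norm (\<lambda>x. g z x - v x)) \<longlongrightarrow> 0) F"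
    using assms by (auto simp: L2_tendsto_def)
  have "\<forall>\<^sub>F z in F. norm (L2_inner (f z) (g z) - L2_inner u v) \<le>
      L2norm (\<lambda>x. f z x - u x) * L2norm (g z) + L2norm u * L2norm (\<lambda>x. g z x - v x)"
    using A(3,4)
  proof eventually_elim
    case (elim z)
    have "L2_inner (f z) (g z) - L2_inner u v = L2_inner (\<lambda>x. f z x - u x) (g z) + L2_inner u (\<lambda>x. g z x - v x)"
      using elim A(1,2) by (simp add: L2_inner_def L2_integrable_mult L2_cnj L2_diff algebra_simps)
    also have "norm \<dots> \<le> L2norm (\<lambda>x. f z x - u x) * L2norm (g z) + L2norm u * L2norm (\<lambda>x. g z x - v x)"
      using elim A(1,2) by (intro norm_triangle_mono L2_inner_le L2_diff)
    finally show ?case .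
  qed
  moreover have "((\<lambda>z. L2norm (\<lambda>x. f z x - u x) * L2norm (g z) + L2norm u * L2norm (\<lambda>x. g z x - v x)) \<longlongrightarrow> 0 * L2norm v + L2norm u * 0) F"
    by (intro tendsto_intros A L2_tendsto_norm[OF assms(2)])
  ultimately have "((\<lambda>z. L2_inner (f z) (g z) - L2_inner u v) \<longlongrightarrow> 0) F"
    unfolding mult_zero_left mult_zero_right add_0_left by (rule Lim_null_comparison)
  then show ?thesis by (subst (asm) LIM_zero_iff)
qed

lemma L2_Fatou:
  assumes h: "\<And>k. h k \<in> L2" and le: "\<forall>\<^sub>F k in sequentially. L2norm (h k) \<le> c"
    and lim: "AE x in lborel. (\<lambda>k. h k x) \<longlonglongrightarrow> g x" and [measurable]: "g \<in> borel_measurable borel"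
  shows "g \<in> L2" "L2norm g \<le> c"
proof -
  note [measurable] = L2_measurable[OF h]
  have c: "c \<ge> 0"
    using eventually_happens'[OF sequentially_bot le] L2norm_nonneg order_trans by blast
  have "(\<integral>\<^sup>+x. ennreal ((cmod (g x))\<^sup>2) \<partial>lborel) = (\<integral>\<^sup>+x. liminf (\<lambda>k. ennreal ((cmod (h k x))\<^sup>2)) \<partial>lborel)"
  proof (rule nn_integral_cong_AE)
    show "AE x in lborel. ennreal ((cmod (g x))\<^sup>2) = liminf (\<lambda>k. ennreal ((cmod (h k x))\<^sup>2))"
      using lim
    proof eventually_elim
      case (elim x)
      have "(\<lambda>k. ennreal ((cmod (h k x))\<^sup>2)) \<longlonglongrightarrow> ennreal ((cmod (g x))\<^sup>2)"
        by (intro tendsto_intros elim)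
      then show ?case by (metis lim_imp_Liminf trivial_limit_sequentially)
    qed
  qed
  also have "\<dots> \<le> liminf (\<lambda>k. \<integral>\<^sup>+x. ennreal ((cmod (h k x))\<^sup>2) \<partial>lborel)"
    by (rule nn_integral_liminf) simp
  also have "\<dots> \<le> ennreal (c\<^sup>2)"
  proof (rule Liminf_le)
    show "\<forall>\<^sub>F k in sequentially. (\<integral>\<^sup>+x. ennreal ((cmod (h k x))\<^sup>2) \<partial>lborel) \<le> ennreal (c\<^sup>2)"
      using le
    proof eventually_elim
      case (elim k)
      have "(\<integral>\<^sup>+x. ennreal ((cmod (h k x))\<^sup>2) \<partial>lborel) = ennreal ((L2norm (h k))\<^sup>2)"
        unfolding L2norm_power2 by (intro nn_integral_eq_integral L2_integrable h) auto
      also have "\<dots> \<le> ennreal (c\<^sup>2)" using elim by (intro ennreal_leI power_mono) auto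
      finally show ?case .
    qed
  qed simp
  finally have le2: "(\<integral>\<^sup>+x. ennreal ((cmod (g x))\<^sup>2) \<partial>lborel) \<le> ennreal (c\<^sup>2)" .
  show g: "g \<in> L2"
    by (intro L2I integrableI_bounded) (use le2 in \<open>auto simp: le_less_trans[OF _ ennreal_less_top]\<close>)
  have "ennreal ((L2norm g)\<^sup>2) \<le> ennreal (c\<^sup>2)"
    using le2 unfolding L2norm_power2 by (subst nn_integral_eq_integral[symmetric, OF L2_integrable[OF g]]) auto
  then show "L2norm g \<le> c" using c by (simp add: power2_le_iff_abs_le)
qed

lemma summable_increments_imp_convergent:
  fixes a :: "nat \<Rightarrow> 'a::banach"
  assumes "summable (\<lambda>k. a (Suc k) - a k)"
  shows "convergent a"
proof -
  have "convergent (\<lambda>n. (\<Sum>k<n. a (Suc k) - a k) + a 0)"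
    using assms by (intro convergent_add convergent_const) (simp add: summable_iff_convergent)
  then show ?thesis by (simp add: sum_lessThan_telescope)
qed

text \<open>
  Riesz--Fischer. Along a subsequence the increments $d_k$ have norm at most $2^{-k}$. Then
  $\sum_k 2^k |d_k|^2$ has a finite integral, so that almost everywhere $d_k = O(2^{-k/2})$ and
  the subsequence converges. Fatou's lemma identifies the pointwise limit as the limit in norm.
\<close>

lemma L2_complete:
  fixes f :: "nat \<Rightarrow> 'a::euclidean_space \<Rightarrow> complex"
  assumes f: "\<And>n. f n \<in> L2"
    and cauchy: "\<And>e. e > 0 \<Longrightarrow> \<exists>N. \<forall>m\<ge>N. \<forall>n\<ge>N. L2norm (\<lambda>x. f m x - f n x) \<le> e"
  obtains g where "L2_tendsto f g sequentially"
proof -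
  note [measurable] = L2_measurable[OF f]
  have "\<exists>N. \<forall>m\<ge>N. \<forall>n\<ge>N. L2norm (\<lambda>x. f m x - f n x) \<le> (1/2) ^ k" for k
    by (rule cauchy) simp
  then obtain r where r: "\<And>k m n. m \<ge> r k \<Longrightarrow> n \<ge> r k \<Longrightarrow> L2norm (\<lambda>x. f m x - f n x) \<le> (1/2) ^ k"
    by metis
  \<comment> \<open>Partial sums give indices that grow with k and stay above every earlier threshold.\<close>
  define R where "R k = (\<Sum>i\<le>k. r i)" for k
  have R: "r k \<le> R j" if "k \<le> j" for k j
    unfolding R_def using that by (intro member_le_sum) auto
  define d where "d k x = f (R (Suc k)) x - f (R k) x" for k x
  have d: "d k \<in> L2" for k unfolding d_def[abs_def] by (intro L2_diff f)
  note [measurable] = L2_measurable[OF d]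
  have dn: "L2norm (d k) \<le> (1/2) ^ k" for k
    unfolding d_def[abs_def] by (intro r R) auto
  have "(\<integral>\<^sup>+x. (\<Sum>k. ennreal (2 ^ k * (cmod (d k x))\<^sup>2)) \<partial>lborel) = (\<Sum>k. \<integral>\<^sup>+x. ennreal (2 ^ k * (cmod (d k x))\<^sup>2) \<partial>lborel)"
    by (rule nn_integral_suminf) simp
  also have "\<dots> \<le> (\<Sum>k. ennreal ((1/2) ^ k))"
  proof (intro suminf_le)
    fix k
    have "(\<integral>\<^sup>+x. ennreal (2 ^ k * (cmod (d k x))\<^sup>2) \<partial>lborel) = ennreal (\<integral>x. 2 ^ k * (cmod (d k x))\<^sup>2 \<partial>lborel)"
      using L2_integrable[OF d] by (intro nn_integral_eq_integral) auto
    also have "(\<integral>x. 2 ^ k * (cmod (d k x))\<^sup>2 \<partial>lborel) = 2 ^ k * (L2norm (d k))\<^sup>2"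
      by (simp add: L2norm_power2)
    also have "\<dots> \<le> 2 ^ k * ((1/2) ^ k)\<^sup>2"
      by (intro mult_left_mono power_mono dn) auto
    also have "\<dots> = (1/2) ^ k" by (simp add: power2_eq_square flip: power_mult_distrib mult.assoc)
    finally show "(\<integral>\<^sup>+x. ennreal (2 ^ k * (cmod (d k x))\<^sup>2) \<partial>lborel) \<le> ennreal ((1/2) ^ k)"
      by (simp add: ennreal_leI)
  qed auto
  also have "\<dots> < \<infinity>"
    by (subst suminf_ennreal2) (auto intro: summable_geometric)
  finally have "AE x in lborel. (\<Sum>k. ennreal (2 ^ k * (cmod (d k x))\<^sup>2)) \<noteq> \<infinity>"
    by (intro nn_integral_PInf_AE) auto
  then have conv: "AE x in lborel. convergent (\<lambda>k. f (R k) x)"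
  proof eventually_elim
    case (elim x)
    define M where "M = enn2real (\<Sum>k. ennreal (2 ^ k * (cmod (d k x))\<^sup>2))"
    have M: "(\<Sum>k. ennreal (2 ^ k * (cmod (d k x))\<^sup>2)) = ennreal M"
      using elim unfolding M_def infinity_ennreal_def top.not_eq_extremum by (rule ennreal_enn2real[symmetric])
    have M0: "M \<ge> 0" unfolding M_def by (rule enn2real_nonneg)
    have "cmod (d k x) \<le> sqrt M * (sqrt (1/2)) ^ k" for k
    proof -
      have "(\<Sum>k\<in>{k}. ennreal (2 ^ k * (cmod (d k x))\<^sup>2)) \<le> ennreal M"
        unfolding M[symmetric] by (intro sum_le_suminf) auto
      then have "2 ^ k * (cmod (d k x))\<^sup>2 \<le> M" using M0 by simp
      then have "(cmod (d k x))\<^sup>2 \<le> M * (1/2) ^ k" by (simp add: field_simps power_divide)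
      then have "sqrt ((cmod (d k x))\<^sup>2) \<le> sqrt (M * (1/2) ^ k)" by (rule real_sqrt_le_mono)
      then show ?thesis by (simp add: real_sqrt_mult real_sqrt_power)
    qed
    moreover have "summable (\<lambda>k. sqrt M * (sqrt (1/2)) ^ k)"
      by (intro summable_mult summable_geometric) (simp add: real_less_lsqrt)
    ultimately have "summable (\<lambda>k. d k x)"
      by (intro summable_comparison_test[of "\<lambda>k. d k x" "\<lambda>k. sqrt M * sqrt (1/2) ^ k"] exI[of _ 0] allI impI)
    then show ?case unfolding d_def by (rule summable_increments_imp_convergent)
  qed
  define g where "g x = lim (\<lambda>k. f (R k) x)" for x
  have [measurable]: "g \<in> borel_measurable borel" unfolding g_def[abs_def] by measurable
  have lim: "AE x in lborel. (\<lambda>k. f (R k) x) \<longlonglongrightarrow> g x"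
    using conv by eventually_elim (simp add: g_def convergent_LIMSEQ_iff)
  have F: "(\<lambda>x. f n x - g x) \<in> L2 \<and> L2norm (\<lambda>x. f n x - g x) \<le> (1/2) ^ j" if n: "n \<ge> r j" for n j
  proof -
    have 1: "\<And>k. (\<lambda>x. f n x - f (R k) x) \<in> L2" by (intro L2_diff f)
    have 2: "\<forall>\<^sub>F k in sequentially. L2norm (\<lambda>x. f n x - f (R k) x) \<le> (1/2) ^ j"
      using eventually_ge_at_top[of j] by eventually_elim (use r n R in auto)
    have 3: "AE x in lborel. (\<lambda>k. f n x - f (R k) x) \<longlonglongrightarrow> f n x - g x"
      using lim by eventually_elim (intro tendsto_intros)
    show ?thesis using L2_Fatou[OF 1 2 3] by simp
  qed
  have g: "g \<in> L2"
    using L2_diff[OF f[of "r 0"] conjunct1[OF F[of 0 "r 0"]]] by simp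
  have "(\<lambda>n. L2norm (\<lambda>x. f n x - g x)) \<longlonglongrightarrow> 0"
  proof (rule LIMSEQ_I)
    fix e :: real assume "e > 0"
    then obtain j where j: "(1/2) ^ j < e" using real_arch_pow_inv[of e "1/2"] by auto
    show "\<exists>no. \<forall>n\<ge>no. norm (L2norm (\<lambda>x. f n x - g x) - 0) < e"
      using F[of j] j by (intro exI[of _ "r j"]) force
  qed
  then show ?thesis using g f by (intro that[of g]) (simp add: L2_tendsto_def)
qed

lemma L2_dominated_convergence:
  fixes f :: "nat \<Rightarrow> 'a::euclidean_space \<Rightarrow> complex" and w :: "'a \<Rightarrow> real"
  assumes w: "integrable lborel (\<lambda>x. (w x)\<^sup>2)" and wm [measurable]: "w \<in> borel_measurable borel"
    and [measurable]: "\<And>n. f n \<in> borel_measurable borel" "g \<in> borel_measurable borel"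
    and le: "\<And>n. AE x in lborel. cmod (f n x) \<le> w x"
    and lim: "AE x in lborel. (\<lambda>n. f n x) \<longlonglongrightarrow> g x"
  shows "L2_tendsto f g sequentially"
proof -
  have fn: "f n \<in> L2" for n
  proof (rule L2I[OF _ Bochner_Integration.integrable_bound[OF w]])
    show "AE x in lborel. norm ((cmod (f n x))\<^sup>2) \<le> norm ((w x)\<^sup>2)"
      using le[of n] by eventually_elim (auto intro!: power_mono)
  qed auto
  have "AE x in lborel. \<forall>n. cmod (f n x) \<le> w x" using le by (simp add: AE_all_countable)
  then have gw: "AE x in lborel. cmod (g x) \<le> w x"
    using lim by eventually_elim (rule LIMSEQ_le_const2[OF tendsto_norm], auto)
  have g: "g \<in> L2"
  proof (rule L2I[OF _ Bochner_Integration.integrable_bound[OF w]])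
    show "AE x in lborel. norm ((cmod (g x))\<^sup>2) \<le> norm ((w x)\<^sup>2)"
      using gw by eventually_elim (auto intro!: power_mono)
  qed auto
  have "(\<lambda>n. \<integral>x. (cmod (f n x - g x))\<^sup>2 \<partial>lborel) \<longlonglongrightarrow> (\<integral>x. 0 \<partial>(lborel :: 'a measure))"
  proof (rule integral_dominated_convergence[where w = "\<lambda>x. 4 * (w x)\<^sup>2"])
    show "AE x in lborel. (\<lambda>n. (cmod (f n x - g x))\<^sup>2) \<longlonglongrightarrow> 0"
      using lim by eventually_elim (auto intro!: tendsto_eq_intros)
    show "AE x in lborel. norm ((cmod (f n x - g x))\<^sup>2) \<le> 4 * (w x)\<^sup>2" for n
      using le[of n] gw
    proof eventually_elim
      case (elim x)
      have "cmod (f n x - g x) \<le> 2 * w x" using elim norm_triangle_ineq4[of "f n x" "g x"] by linarith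
      then have "(cmod (f n x - g x))\<^sup>2 \<le> (2 * w x)\<^sup>2" by (intro power_mono) auto
      then show ?case by (simp add: power_mult_distrib)
    qed
  qed (use w in auto)
  then have "(\<lambda>n. L2norm (\<lambda>x. f n x - g x)) \<longlonglongrightarrow> 0"
    unfolding L2norm_def using tendsto_real_sqrt[of _ 0] by fastforce
  then show ?thesis using g fn by (simp add: L2_tendsto_def)
qed

text \<open>
  Cutting off large values makes the function bounded, cutting off small values makes it supported on a
  set of finite measure. The result lies in every $L^p$.
\<close>

definition truncate :: "nat \<Rightarrow> ('a \<Rightarrow> complex) \<Rightarrow> 'a \<Rightarrow> complex" where
  "truncate n f x = (if 1 / (real n + 1) \<le> cmod (f x) \<and> cmod (f x) \<le> real n + 1 then f x else 0)"

lemma truncate_measurable [measurable (raw)]: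
  assumes [measurable]: "f \<in> borel_measurable M"
  shows "truncate n f \<in> borel_measurable M"
  unfolding truncate_def[abs_def] by measurable

lemma truncate_le: "cmod (truncate n f x) \<le> real n + 1" "cmod (truncate n f x) \<le> cmod (f x)"
  by (auto simp: truncate_def)

lemma truncate_L2: "f \<in> L2 \<Longrightarrow> truncate n f \<in> L2"
  by (rule L2_bounded(1)[of f _ 1]) (auto simp: truncate_le)

lemma truncate_integrable:
  assumes f: "f \<in> L2"
  shows "integrable lborel (truncate n f)"
proof (rule Bochner_Integration.integrable_bound)
  note [measurable] = L2_measurable[OF f]
  show "integrable lborel (\<lambda>x. (real n + 1) * (cmod (f x))\<^sup>2)" using L2_integrable[OF f] by simp
  show "truncate n f \<in> borel_measurable lborel" by simp
  have "cmod (truncate n f x) \<le> (real n + 1) * (cmod (f x))\<^sup>2" for x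
  proof (cases "1 / (real n + 1) \<le> cmod (f x)")
    case True
    then have "1 * cmod (f x) \<le> ((real n + 1) * cmod (f x)) * cmod (f x)"
      by (intro mult_right_mono) (auto simp: field_simps)
    then show ?thesis by (auto simp: truncate_def power2_eq_square mult.assoc)
  qed (simp add: truncate_def)
  then show "AE x in lborel. norm (truncate n f x) \<le> norm ((real n + 1) * (cmod (f x))\<^sup>2)"
    by auto
qed

lemma truncate_tendsto:
  assumes f: "f \<in> L2"
  shows "L2_tendsto (\<lambda>n. truncate n f) f sequentially"
proof (rule L2_dominated_convergence[where w = "\<lambda>x. cmod (f x)"])
  note [measurable] = L2_measurable[OF f]
  show "integrable lborel (\<lambda>x. (cmod (f x))\<^sup>2)" by (rule L2_integrable[OF f])
  have "(\<lambda>n. truncate n f x) \<longlonglongrightarrow> f x" for x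
  proof (cases "f x = 0")
    case False
    have 1: "(\<lambda>n. 1 / (real n + 1)) \<longlonglongrightarrow> 0" using LIMSEQ_inverse_real_of_nat by (simp add: inverse_eq_divide add.commute)
    have 2: "\<forall>\<^sub>F n in sequentially. 1 / (real n + 1) < cmod (f x)"
      by (rule order_tendstoD(2)[OF 1]) (use False in simp)
    have "\<forall>\<^sub>F n in sequentially. truncate n f x = f x"
      using 2 eventually_ge_at_top[of "nat \<lceil>cmod (f x)\<rceil>"]
    proof eventually_elim
      case (elim n)
      then have "cmod (f x) \<le> real n + 1" by linarith
      then show ?case using elim by (simp add: truncate_def)
    qed
    then show ?thesis by (rule tendsto_eventually)
  qed (simp add: truncate_def)
  then show "AE x in lborel. (\<lambda>n. truncate n f x) \<longlonglongrightarrow> f x" by simp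
qed (use f in \<open>auto simp: truncate_le L2_measurable\<close>)

section \<open>Continuity of translations\<close>

lemma lborel_integrable_shift:
  fixes f :: "'a::euclidean_space \<Rightarrow> 'b::{banach, second_countable_topology}"
  assumes "integrable lborel f"
  shows "integrable lborel (\<lambda>x. f (h + x))"
  using assms integrable_distr_eq[of "(+) h" lborel borel f]
  unfolding lborel_distr_plus by simp

lemma lborel_integral_shift:
  fixes f :: "'a::euclidean_space \<Rightarrow> 'b::{banach, second_countable_topology}"
  assumes "f \<in> borel_measurable borel"
  shows "(\<integral>x. f (h + x) \<partial>lborel) = (\<integral>x. f x \<partial>lborel)"
  using assms integral_distr[of "(+) h" lborel borel f]
  unfolding lborel_distr_plus by simp

lemma lborel_integral_scale:
  fixes f :: "'a::euclidean_space \<Rightarrow> 'b::{banach, second_countable_topology}"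
  assumes "c \<noteq> 0" "f \<in> borel_measurable borel"
  shows "(\<integral>x. f x \<partial>lborel) = \<bar>c\<bar> ^ DIM('a) *\<^sub>R (\<integral>x. f (c *\<^sub>R x) \<partial>lborel)"
  using assms
  by (subst lborel_affine[OF assms(1), of 0]) (simp add: integral_density integral_distr)

lemma lborel_integrable_scale:
  fixes f :: "'a::euclidean_space \<Rightarrow> 'b::{banach, second_countable_topology}"
  assumes "c \<noteq> 0" "integrable lborel f"
  shows "integrable lborel (\<lambda>x. f (c *\<^sub>R x))"
proof -
  have [measurable]: "f \<in> borel_measurable borel" using assms(2) by simp
  have "integrable (density (distr lborel borel (\<lambda>x. 0 + c *\<^sub>R x)) (\<lambda>_. \<bar>c\<bar> ^ DIM('a))) f"
    using assms(2) by (subst (asm) lborel_affine[OF assms(1), of 0]) simp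
  then have "integrable lborel (\<lambda>x. \<bar>c\<bar> ^ DIM('a) *\<^sub>R f (c *\<^sub>R x))"
    by (simp add: integrable_density integrable_distr_eq)
  from integrable_scaleR_right[OF this, of "inverse (\<bar>c\<bar> ^ DIM('a))"] show ?thesis
    using assms(1) by simp
qed

text \<open>
  Translations are isometries of $L^1$, so continuity of translation is stable under approximation in
  norm.
\<close>

lemma L1_translation_approx:
  fixes f :: "'a::euclidean_space \<Rightarrow> complex"
  assumes f: "integrable lborel f"
    and approx: "\<And>e. e > 0 \<Longrightarrow> \<exists>g. integrable lborel g \<and> (\<integral>x. cmod (f x - g x) \<partial>lborel) \<le> e \<and>
        (\<lambda>n. \<integral>x. cmod (g (h n + x) - g x) \<partial>lborel) \<longlonglongrightarrow> 0"
  shows "(\<lambda>n. \<integral>x. cmod (f (h n + x) - f x) \<partial>lborel) \<longlonglongrightarrow> 0"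
proof (rule LIMSEQ_I)
  fix e :: real assume e: "e > 0"
  then obtain g where g: "integrable lborel g" "(\<integral>x. cmod (f x - g x) \<partial>lborel) \<le> e / 4"
    "(\<lambda>n. \<integral>x. cmod (g (h n + x) - g x) \<partial>lborel) \<longlonglongrightarrow> 0"
    using approx[of "e / 4"] by auto
  note [measurable] = borel_measurable_integrable[OF f] borel_measurable_integrable[OF g(1)]
  obtain N where N: "\<And>n. n \<ge> N \<Longrightarrow> norm ((\<integral>x. cmod (g (h n + x) - g x) \<partial>lborel) - 0) < e / 2"
    using LIMSEQ_D[OF g(3), of "e / 2"] e by auto
  show "\<exists>N. \<forall>n\<ge>N. norm ((\<integral>x. cmod (f (h n + x) - f x) \<partial>lborel) - 0) < e"
  proof (intro exI allI impI)
    fix n assume n: "n \<ge> N"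
    let ?a = "\<lambda>x. cmod (f x - g x)" and ?b = "\<lambda>x. cmod (g (h n + x) - g x)"
    have a: "integrable lborel ?a" using f g(1) by simp
    have a': "integrable lborel (\<lambda>x. ?a (h n + x))" by (rule lborel_integrable_shift[OF a])
    have b: "integrable lborel ?b" using g(1) lborel_integrable_shift[OF g(1)] by simp
    have "(\<integral>x. cmod (f (h n + x) - f x) \<partial>lborel) \<le> (\<integral>x. ?a (h n + x) + ?b x + ?a x \<partial>lborel)"
    proof (rule integral_mono)
      show "integrable lborel (\<lambda>x. cmod (f (h n + x) - f x))"
        using f lborel_integrable_shift[OF f] by simp
      show "integrable lborel (\<lambda>x. ?a (h n + x) + ?b x + ?a x)" using a a' b by simp
      fix x
      have "f (h n + x) - f x = (f (h n + x) - g (h n + x)) + (g (h n + x) - g x) + (g x - f x)" by simp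
      then show "cmod (f (h n + x) - f x) \<le> ?a (h n + x) + ?b x + ?a x"
        using norm_triangle_ineq[of "(f (h n + x) - g (h n + x)) + (g (h n + x) - g x)" "g x - f x"]
          norm_triangle_ineq[of "f (h n + x) - g (h n + x)" "g (h n + x) - g x"]
        by (simp add: norm_minus_commute)
    qed
    also have "\<dots> = (\<integral>x. ?a x \<partial>lborel) + (\<integral>x. ?b x \<partial>lborel) + (\<integral>x. ?a x \<partial>lborel)"
      using a a' b lborel_integral_shift[of ?a "h n"] by simp
    also have "\<dots> < e" using N[OF n] g(2) by simp
    finally show "norm ((\<integral>x. cmod (f (h n + x) - f x) \<partial>lborel) - 0) < e" by simp
  qed
qed

text \<open>
  At each point of an open set the indicator is eventually equal to its translates, which controls the
  positive part of the difference by dominated convergence. The difference has integral 0, so its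
  negative part has the same integral.
\<close>

lemma L1_translation_open:
  fixes U :: "'a::euclidean_space set" and c :: complex
  assumes U: "open U" "emeasure lborel U < \<infinity>" and h: "h \<longlonglongrightarrow> 0"
  shows "(\<lambda>n. \<integral>x. cmod (indicator U (h n + x) *\<^sub>R c - indicator U x *\<^sub>R c) \<partial>lborel) \<longlonglongrightarrow> 0"
proof -
  have [measurable]: "U \<in> sets borel" using U(1) by simp
  let ?i = "indicator U :: 'a \<Rightarrow> real"
  have i: "integrable lborel ?i" using U by (simp add: integrable_indicator_iff)
  have "(\<lambda>n. \<integral>x. max (?i x - ?i (h n + x)) 0 \<partial>lborel) \<longlonglongrightarrow> (\<integral>x. 0 \<partial>(lborel :: 'a measure))"
  proof (rule integral_dominated_convergence[where w = ?i])
    show "AE x in lborel. (\<lambda>n. max (?i x - ?i (h n + x)) 0) \<longlonglongrightarrow> 0"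
    proof (rule AE_I2)
      fix x :: 'a
      show "(\<lambda>n. max (?i x - ?i (h n + x)) 0) \<longlonglongrightarrow> 0"
      proof (cases "x \<in> U")
        case True
        have "(\<lambda>n. h n + x) \<longlonglongrightarrow> 0 + x" by (intro tendsto_intros h)
        then have "\<forall>\<^sub>F n in sequentially. h n + x \<in> U"
          using topological_tendstoD[OF _ U(1)] True by fastforce
        then show ?thesis
          using True by (intro tendsto_eventually) (auto elim!: eventually_mono)
      qed (auto simp: max_def split: split_indicator)
    qed
    show "AE x in lborel. norm (max (?i x - ?i (h n + x)) 0) \<le> ?i x" for n
      by (auto split: split_indicator)
  qed (use i in auto)
  then have "(\<lambda>n. cmod c * (2 * (\<integral>x. max (?i x - ?i (h n + x)) 0 \<partial>lborel))) \<longlonglongrightarrow> cmod c * (2 * 0)"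
    by (intro tendsto_intros) simp
  moreover have "(\<integral>x. cmod (indicator U (h n + x) *\<^sub>R c - indicator U x *\<^sub>R c) \<partial>lborel) =
      cmod c * (2 * (\<integral>x. max (?i x - ?i (h n + x)) 0 \<partial>lborel))" for n
  proof -
    have i': "integrable lborel (\<lambda>x. ?i (h n + x))" by (rule lborel_integrable_shift[OF i])
    have m: "integrable lborel (\<lambda>x. max (?i x - ?i (h n + x)) 0)"
      using i i' by (intro integrable_max) auto
    have "(\<integral>x. cmod (indicator U (h n + x) *\<^sub>R c - indicator U x *\<^sub>R c) \<partial>lborel) =
        (\<integral>x. cmod c * (2 * max (?i x - ?i (h n + x)) 0 - (?i x - ?i (h n + x))) \<partial>lborel)"
      by (intro Bochner_Integration.integral_cong refl) (auto split: split_indicator)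
    also have "\<dots> = cmod c * (2 * (\<integral>x. max (?i x - ?i (h n + x)) 0 \<partial>lborel) - ((\<integral>x. ?i x \<partial>lborel) - (\<integral>x. ?i (h n + x) \<partial>lborel)))"
      using i i' m by simp
    also have "(\<integral>x. ?i (h n + x) \<partial>lborel) = (\<integral>x. ?i x \<partial>lborel)"
      by (rule lborel_integral_shift) simp
    finally show ?thesis by simp
  qed
  ultimately show ?thesis by simp
qed

text \<open>
  Outer regularity of Lebesgue measure reduces indicators of Borel sets to those of open sets.
\<close>

lemma L1_translation:
  fixes f :: "'a::euclidean_space \<Rightarrow> complex"
  assumes "integrable lborel f" and h: "h \<longlonglongrightarrow> 0"
  shows "(\<lambda>n. \<integral>x. cmod (f (h n + x) - f x) \<partial>lborel) \<longlonglongrightarrow> 0"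
  using assms(1)
proof (induct rule: integrable_induct)
  case (base A c)
  have [measurable]: "A \<in> sets borel" using base by simp
  show ?case
  proof (rule L1_translation_approx)
    show "integrable lborel (\<lambda>x. indicator A x *\<^sub>R c)"
      using base by (intro integrable_scaleR_left) (simp add: integrable_indicator_iff)
    fix e :: real assume e: "e > 0"
    \<comment> \<open>The summand 1 covers the case c = 0.\<close>
    define d where "d = e / (cmod c + 1)"
    have d: "d > 0" using e by (simp add: d_def add_nonneg_pos)
    obtain U where U: "open U" "A \<subseteq> U" "emeasure lborel (U - A) < d"
      using outer_regular_lborel[OF _ d, of A] by auto
    have [measurable]: "U \<in> sets borel" using U(1) by simp
    have UA: "emeasure lborel (U - A) < \<infinity>" using U(3) by (metis ennreal_less_top infinity_ennreal_def order_less_trans)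
    have "emeasure lborel U \<le> emeasure lborel (U - A) + emeasure lborel A"
      using U(2) by (subst plus_emeasure) (auto simp: Un_absorb2)
    also have "\<dots> < \<infinity>" using UA base(2) by (simp add: less_top[symmetric])
    finally have Ufin: "emeasure lborel U < \<infinity>" .
    have "(\<integral>x. cmod (indicator A x *\<^sub>R c - indicator U x *\<^sub>R c) \<partial>lborel) = (\<integral>x. cmod c * indicator (U - A) x \<partial>lborel)"
      using U(2) by (intro Bochner_Integration.integral_cong refl) (auto split: split_indicator)
    also have "\<dots> = cmod c * measure lborel (U - A)" by simp
    also have "\<dots> \<le> (cmod c + 1) * d"
      using U(3) d by (intro mult_mono) (auto simp: measure_def enn2real_leI less_imp_le)
    also have "\<dots> = e" by (simp add: d_def add_nonneg_eq_0_iff)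
    finally have le: "(\<integral>x. cmod (indicator A x *\<^sub>R c - indicator U x *\<^sub>R c) \<partial>lborel) \<le> e" .
    show "\<exists>g. integrable lborel g \<and> (\<integral>x. cmod (indicator A x *\<^sub>R c - g x) \<partial>lborel) \<le> e \<and>
        (\<lambda>n. \<integral>x. cmod (g (h n + x) - g x) \<partial>lborel) \<longlonglongrightarrow> 0"
      using le L1_translation_open[OF U(1) Ufin h, of c] Ufin
      by (intro exI[of _ "\<lambda>x. indicator U x *\<^sub>R c"] conjI integrable_scaleR_left) (auto simp: integrable_indicator_iff)
  qed
next
  case (add f g)
  show ?case
  proof (rule Lim_null_comparison)
    show "(\<lambda>n. (\<integral>x. cmod (f (h n + x) - f x) \<partial>lborel) + (\<integral>x. cmod (g (h n + x) - g x) \<partial>lborel)) \<longlonglongrightarrow> 0"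
      using tendsto_add[OF add(2,4)] by simp
    show "\<forall>\<^sub>F n in sequentially. norm (\<integral>x. cmod (f (h n + x) + g (h n + x) - (f x + g x)) \<partial>lborel)
      \<le> (\<integral>x. cmod (f (h n + x) - f x) \<partial>lborel) + (\<integral>x. cmod (g (h n + x) - g x) \<partial>lborel)"
    proof (rule always_eventually, rule allI)
      fix n
      have i: "integrable lborel (\<lambda>x. cmod (f (h n + x) - f x))" "integrable lborel (\<lambda>x. cmod (g (h n + x) - g x))"
        using add(1,3) lborel_integrable_shift[OF add(1)] lborel_integrable_shift[OF add(3)] by auto
      have "(\<integral>x. cmod (f (h n + x) + g (h n + x) - (f x + g x)) \<partial>lborel) \<le>
          (\<integral>x. cmod (f (h n + x) - f x) + cmod (g (h n + x) - g x) \<partial>lborel)"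
      proof (rule integral_mono)
        show "integrable lborel (\<lambda>x. cmod (f (h n + x) + g (h n + x) - (f x + g x)))"
          using add(1,3) lborel_integrable_shift[OF add(1)] lborel_integrable_shift[OF add(3)] by auto
        fix x
        show "cmod (f (h n + x) + g (h n + x) - (f x + g x)) \<le> cmod (f (h n + x) - f x) + cmod (g (h n + x) - g x)"
          unfolding add_diff_add by (rule norm_triangle_ineq)
      qed (use i in auto)
      then show "norm (\<integral>x. cmod (f (h n + x) + g (h n + x) - (f x + g x)) \<partial>lborel)
        \<le> (\<integral>x. cmod (f (h n + x) - f x) \<partial>lborel) + (\<integral>x. cmod (g (h n + x) - g x) \<partial>lborel)"
        using i by simp
    qed
  qed
next
  case (lim f s)
  show ?case
  proof (rule L1_translation_approx[OF lim(5)])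
    fix e :: real assume e: "e > 0"
    note [measurable] = borel_measurable_integrable[OF lim(1)] borel_measurable_integrable[OF lim(5)]
    have "(\<lambda>i. \<integral>x. cmod (f x - s i x) \<partial>lborel) \<longlonglongrightarrow> (\<integral>x. 0 \<partial>(lborel :: 'a measure))"
    proof (rule integral_dominated_convergence[where w = "\<lambda>x. 3 * cmod (f x)"])
      show "AE x in lborel. (\<lambda>i. cmod (f x - s i x)) \<longlonglongrightarrow> 0"
      proof (rule AE_I2)
        fix x :: 'a
        have "(\<lambda>i. cmod (f x - s i x)) \<longlonglongrightarrow> cmod (f x - f x)"
          by (intro tendsto_intros lim(3)) simp
        then show "(\<lambda>i. cmod (f x - s i x)) \<longlonglongrightarrow> 0" by simp
      qed
      show "AE x in lborel. norm (cmod (f x - s i x)) \<le> 3 * cmod (f x)" for i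
      proof (rule AE_I2)
        fix x :: 'a
        show "norm (cmod (f x - s i x)) \<le> 3 * cmod (f x)"
          using lim(4)[of x i] norm_triangle_ineq4[of "f x" "s i x"] by simp
      qed
    qed (use lim(5) in auto)
    then have "\<forall>\<^sub>F i in sequentially. (\<integral>x. cmod (f x - s i x) \<partial>lborel) < e"
      by (intro order_tendstoD(2)) (auto simp: e)
    then obtain i where "(\<integral>x. cmod (f x - s i x) \<partial>lborel) < e"
      by (auto simp: eventually_sequentially)
    then show "\<exists>g. integrable lborel g \<and> (\<integral>x. cmod (f x - g x) \<partial>lborel) \<le> e \<and>
        (\<lambda>n. \<integral>x. cmod (g (h n + x) - g x) \<partial>lborel) \<longlonglongrightarrow> 0"
      using lim(1,2) by (intro exI[of _ "s i"]) auto
  qed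
qed

lemma L2_shift:
  assumes f: "f \<in> L2"
  shows "(\<lambda>x. f (h + x)) \<in> L2" "L2norm (\<lambda>x. f (h + x)) = L2norm f"
proof -
  note [measurable] = L2_measurable[OF f]
  show "(\<lambda>x. f (h + x)) \<in> L2"
    using lborel_integrable_shift[OF L2_integrable[OF f]] by (intro L2I) auto
  show "L2norm (\<lambda>x. f (h + x)) = L2norm f"
    unfolding L2norm_def by (subst lborel_integral_shift[of "\<lambda>x. (cmod (f x))\<^sup>2" h]) auto
qed

text \<open>
  For a bounded function the squared $L^2$ distance of two translates is controlled by their $L^1$
  distance.
\<close>

lemma L2_translation:
  fixes f :: "'a::euclidean_space \<Rightarrow> complex"
  assumes f: "f \<in> L2" and h: "h \<longlonglongrightarrow> 0"
  shows "(\<lambda>n. L2norm (\<lambda>x. f (h n + x) - f x)) \<longlonglongrightarrow> 0"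
proof (rule LIMSEQ_I)
  fix e :: real assume e: "e > 0"
  have "(\<lambda>k. L2norm (\<lambda>x. truncate k f x - f x)) \<longlonglongrightarrow> 0"
    using truncate_tendsto[OF f] by (simp add: L2_tendsto_def)
  then have "\<forall>\<^sub>F k in sequentially. L2norm (\<lambda>x. truncate k f x - f x) < e / 4"
    by (rule order_tendstoD(2)) (use e in simp)
  then obtain k where k: "L2norm (\<lambda>x. truncate k f x - f x) < e / 4"
    by (auto simp: eventually_sequentially)
  define g where "g = truncate k f"
  have g: "g \<in> L2" "integrable lborel g" "\<And>x. cmod (g x) \<le> real k + 1"
    unfolding g_def using truncate_L2 truncate_integrable truncate_le f by auto
  have k': "L2norm (\<lambda>x. g x - f x) < e / 4" using k by (simp add: g_def)
  define K where "K = 2 * (real k + 1)"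
  have K: "K > 0" by (simp add: K_def)
  have gn: "(L2norm (\<lambda>x. g (h n + x) - g x))\<^sup>2 \<le> K * (\<integral>x. cmod (g (h n + x) - g x) \<partial>lborel)" for n
  proof -
    have "(L2norm (\<lambda>x. g (h n + x) - g x))\<^sup>2 \<le> (\<integral>x. K * cmod (g (h n + x) - g x) \<partial>lborel)"
      unfolding L2norm_power2
    proof (rule integral_mono)
      show "integrable lborel (\<lambda>x. (cmod (g (h n + x) - g x))\<^sup>2)"
        by (intro L2_integrable L2_diff L2_shift g)
      show "integrable lborel (\<lambda>x. K * cmod (g (h n + x) - g x))"
        using g(2) lborel_integrable_shift[OF g(2)] by simp
      fix x
      have "cmod (g (h n + x) - g x) \<le> K"
        using norm_triangle_ineq4[of "g (h n + x)" "g x"] g(3)[of x] g(3)[of "h n + x"] by (simp add: K_def)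
      then show "(cmod (g (h n + x) - g x))\<^sup>2 \<le> K * cmod (g (h n + x) - g x)"
        by (simp add: power2_eq_square mult_right_mono)
    qed
    then show ?thesis by simp
  qed
  have "\<forall>\<^sub>F n in sequentially. (\<integral>x. cmod (g (h n + x) - g x) \<partial>lborel) < (e / 4)\<^sup>2 / K"
    by (rule order_tendstoD(2)[OF L1_translation[OF g(2) h]]) (use e K in simp)
  then obtain N where N: "\<And>n. n \<ge> N \<Longrightarrow> (\<integral>x. cmod (g (h n + x) - g x) \<partial>lborel) < (e / 4)\<^sup>2 / K"
    by (auto simp: eventually_sequentially)
  show "\<exists>N. \<forall>n\<ge>N. norm (L2norm (\<lambda>x. f (h n + x) - f x) - 0) < e"
  proof (intro exI allI impI)
    fix n assume n: "n \<ge> N"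
    have "(L2norm (\<lambda>x. g (h n + x) - g x))\<^sup>2 \<le> (e / 4)\<^sup>2"
      using gn[of n] N[OF n] K by (simp add: field_simps)
    then have 1: "L2norm (\<lambda>x. g (h n + x) - g x) \<le> e / 4"
      by (rule power2_le_imp_le) (use e in simp)
    have 2: "L2norm (\<lambda>x. f (h n + x) - g (h n + x)) = L2norm (\<lambda>x. g x - f x)"
      using L2_shift(2)[OF L2_diff[OF f g(1)], of "h n"] L2norm_minus_commute[of f g] by (rule trans)
    have "L2norm (\<lambda>x. f (h n + x) - f x) \<le> L2norm (\<lambda>x. f (h n + x) - g (h n + x)) + L2norm (\<lambda>x. g (h n + x) - f x)"
      by (intro L2norm_diff_triangle L2_shift f g)
    also have "L2norm (\<lambda>x. g (h n + x) - f x) \<le> L2norm (\<lambda>x. g (h n + x) - g x) + L2norm (\<lambda>x. g x - f x)"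
      by (intro L2norm_diff_triangle L2_shift f g)
    finally show "norm (L2norm (\<lambda>x. f (h n + x) - f x) - 0) < e" using 1 2 k' e by simp
  qed
qed

section \<open>Fourier integrals and Plancherel's identity\<close>

lemma fourier_integrand_integrable:
  fixes u :: "'a::euclidean_space \<Rightarrow> complex"
  assumes u: "integrable lborel u"
  shows "integrable lborel (\<lambda>y. exp (- (2 * pi * \<i> * of_real (\<zeta> \<bullet> y))) * u y)"
proof (rule Bochner_Integration.integrable_bound[OF u])
  note [measurable] = borel_measurable_integrable[OF u]
  show "(\<lambda>y. exp (- (2 * pi * \<i> * of_real (\<zeta> \<bullet> y))) * u y) \<in> borel_measurable lborel"
    by measurable
qed (simp add: norm_mult)

lemma fourier_integral_diff:
  "integrable lborel u \<Longrightarrow> integrable lborel v \<Longrightarrow>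
   fourier_integral (\<lambda>x. u x - v x) = (\<lambda>\<zeta>. fourier_integral u \<zeta> - fourier_integral v \<zeta>)"
  unfolding fourier_integral_def[abs_def] right_diff_distrib
  by (intro ext Bochner_Integration.integral_diff fourier_integrand_integrable)

lemma fourier_integral_add:
  "integrable lborel u \<Longrightarrow> integrable lborel v \<Longrightarrow>
   fourier_integral (\<lambda>x. u x + v x) = (\<lambda>\<zeta>. fourier_integral u \<zeta> + fourier_integral v \<zeta>)"
  unfolding fourier_integral_def[abs_def] distrib_left
  by (intro ext Bochner_Integration.integral_add fourier_integrand_integrable)

lemma fourier_integral_cmult:
  "fourier_integral (\<lambda>x. c * u x) = (\<lambda>\<zeta>. c * fourier_integral u \<zeta>)"
proof
  fix \<zeta>
  have "(\<lambda>y. exp (- (2 * pi * \<i> * of_real (\<zeta> \<bullet> y))) * (c * u y)) = (\<lambda>y. c * (exp (- (2 * pi * \<i> * of_real (\<zeta> \<bullet> y))) * u y))"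
    by (simp add: mult_ac)
  then show "fourier_integral (\<lambda>x. c * u x) \<zeta> = c * fourier_integral u \<zeta>"
    unfolding fourier_integral_def by simp
qed

lemma fourier_integral_bound:
  "cmod (fourier_integral u \<zeta>) \<le> (\<integral>x. cmod (u x) \<partial>lborel)"
proof -
  have "cmod (fourier_integral u \<zeta>) \<le> (\<integral>y. cmod (exp (- (2 * pi * \<i> * of_real (\<zeta> \<bullet> y))) * u y) \<partial>lborel)"
    unfolding fourier_integral_def by (rule integral_norm_bound)
  then show ?thesis by (simp add: norm_mult)
qed

lemma fourier_integral_measurable [measurable (raw)]:
  fixes u :: "'a::euclidean_space \<Rightarrow> complex"
  assumes [measurable]: "u \<in> borel_measurable borel"
  shows "fourier_integral u \<in> borel_measurable borel"
proof -
  have "(\<lambda>\<zeta>. \<integral>y. exp (- (2 * pi * \<i> * of_real (\<zeta> \<bullet> y))) * u y \<partial>lborel) \<in> borel_measurable (lborel :: 'a measure)"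
    by (intro lborel.borel_measurable_lebesgue_integral) simp
  then show ?thesis by (simp add: fourier_integral_def[abs_def])
qed

lemma lborel_pair_integrable_mult:
  fixes f :: "'a::euclidean_space \<Rightarrow> complex" and g :: "'b::euclidean_space \<Rightarrow> complex"
  assumes f: "integrable lborel f" and g: "integrable lborel g"
  shows "integrable (lborel \<Otimes>\<^sub>M lborel) (\<lambda>(x, y). f x * g y)"
proof (rule lborel_pair.Fubini_integrable)
  note [measurable] = borel_measurable_integrable[OF f] borel_measurable_integrable[OF g]
  show "(\<lambda>(x, y). f x * g y) \<in> borel_measurable (lborel \<Otimes>\<^sub>M lborel)" by measurable
  show "integrable lborel (\<lambda>x. \<integral>y. cmod (case (x, y) of (x, y) \<Rightarrow> f x * g y) \<partial>lborel)"
    using f by (simp add: norm_mult)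
qed (use g in auto)

text \<open>
  Both sides are the same double integral, since the kernel is symmetric in its two arguments.
\<close>

lemma fourier_integral_exchange:
  fixes f g :: "'a::euclidean_space \<Rightarrow> complex"
  assumes f: "integrable lborel f" and g: "integrable lborel g"
  shows "(\<integral>x. fourier_integral f x * g x \<partial>lborel) = (\<integral>x. f x * fourier_integral g x \<partial>lborel)"
proof -
  note [measurable] = borel_measurable_integrable[OF f] borel_measurable_integrable[OF g]
  let ?e = "\<lambda>x y. exp (- (2 * pi * \<i> * of_real (x \<bullet> y))) :: complex"
  have i: "integrable (lborel \<Otimes>\<^sub>M lborel) (\<lambda>(x, y). ?e x y * (f x * g y))"
    by (rule Bochner_Integration.integrable_bound[OF lborel_pair_integrable_mult[OF f g]])
      (auto simp: norm_mult)
  have "(\<integral>y. (\<integral>x. ?e x y * (f x * g y) \<partial>lborel) \<partial>lborel) = (\<integral>x. (\<integral>y. ?e x y * (f x * g y) \<partial>lborel) \<partial>lborel)"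
    by (rule lborel_pair.Fubini_integral[OF i])
  moreover have "(\<integral>x. ?e x y * (f x * g y) \<partial>lborel) = fourier_integral f y * g y" for y
  proof -
    have "(\<lambda>x. ?e x y * (f x * g y)) = (\<lambda>x. (?e y x * f x) * g y)" by (simp add: mult_ac inner_commute)
    then show ?thesis unfolding fourier_integral_def by simp
  qed
  moreover have "(\<integral>y. ?e x y * (f x * g y) \<partial>lborel) = f x * fourier_integral g x" for x
  proof -
    have "(\<lambda>y. ?e x y * (f x * g y)) = (\<lambda>y. f x * (?e x y * g y))" by (simp add: mult_ac)
    then show ?thesis unfolding fourier_integral_def by simp
  qed
  ultimately show ?thesis by simp
qed

text \<open>
  Its Fourier integral is the squared modulus of that of \<open>f\<close>, and its value at 0 is the squared norm of
  \<open>f\<close>. Plancherel's identity is thus Fourier inversion for this function at the single point 0.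
\<close>

definition autocorrelation :: "('a::euclidean_space \<Rightarrow> complex) \<Rightarrow> 'a \<Rightarrow> complex" where
  "autocorrelation f h = (\<integral>x. f (h + x) * cnj (f x) \<partial>lborel)"

lemma autocorrelation_pair_integrable:
  fixes f :: "'a::euclidean_space \<Rightarrow> complex"
  assumes f: "integrable lborel f"
  shows "integrable (lborel \<Otimes>\<^sub>M lborel) (\<lambda>(x, h). f (h + x) * cnj (f x))"
proof (rule lborel_pair.Fubini_integrable)
  note [measurable] = borel_measurable_integrable[OF f]
  show "(\<lambda>(x, h). f (h + x) * cnj (f x)) \<in> borel_measurable (lborel \<Otimes>\<^sub>M lborel)" by measurable
  have sh: "integrable lborel (\<lambda>h. f (h + x))" for x
    using lborel_integrable_shift[OF f, of x] by (simp add: add.commute)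
  have "(\<integral>h. cmod (f (h + x)) \<partial>lborel) = (\<integral>h. cmod (f h) \<partial>lborel)" for x
    using lborel_integral_shift[of "\<lambda>h. cmod (f h)" x] by (simp add: add.commute)
  then show "integrable lborel (\<lambda>x. \<integral>h. cmod (case (x, h) of (x, h) \<Rightarrow> f (h + x) * cnj (f x)) \<partial>lborel)"
    using f by (simp add: norm_mult)
  show "AE x in lborel. integrable lborel (\<lambda>h. case (x, h) of (x, h) \<Rightarrow> f (h + x) * cnj (f x))"
    using sh by simp
qed

lemma autocorrelation_integrable:
  fixes f :: "'a::euclidean_space \<Rightarrow> complex"
  assumes f: "integrable lborel f"
  shows "integrable lborel (autocorrelation f)"
proof -
  have "integrable (lborel \<Otimes>\<^sub>M lborel) (\<lambda>(h, x). f (h + x) * cnj (f x))"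
    using lborel_pair.integrable_product_swap[OF autocorrelation_pair_integrable[OF f]]
    by (simp add: split_beta')
  from lborel_pair.integrable_fst'[OF this] show ?thesis
    by (simp add: autocorrelation_def[abs_def])
qed

text \<open>
  After exchanging the integrals, the inner one is a translate of the Fourier integral of \<open>f\<close>, and the
  phase from the translation completes \<open>cnj (f x)\<close> to the conjugate integrand.
\<close>

lemma fourier_integral_autocorrelation:
  fixes f :: "'a::euclidean_space \<Rightarrow> complex"
  assumes f: "integrable lborel f"
  shows "fourier_integral (autocorrelation f) \<zeta> = of_real ((cmod (fourier_integral f \<zeta>))\<^sup>2)"
proof -
  note [measurable] = borel_measurable_integrable[OF f]
  let ?e = "\<lambda>y. exp (- (2 * pi * \<i> * of_real (\<zeta> \<bullet> y))) :: complex"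
  have i: "integrable (lborel \<Otimes>\<^sub>M lborel) (\<lambda>(x, h). ?e h * (f (h + x) * cnj (f x)))"
    by (rule Bochner_Integration.integrable_bound[OF autocorrelation_pair_integrable[OF f]])
      (auto simp: norm_mult)
  have "fourier_integral (autocorrelation f) \<zeta> = (\<integral>h. (\<integral>x. ?e h * (f (h + x) * cnj (f x)) \<partial>lborel) \<partial>lborel)"
    by (simp add: fourier_integral_def autocorrelation_def)
  also have "\<dots> = (\<integral>x. (\<integral>h. ?e h * (f (h + x) * cnj (f x)) \<partial>lborel) \<partial>lborel)"
    by (rule lborel_pair.Fubini_integral[OF i])
  also have "(\<lambda>x. \<integral>h. ?e h * (f (h + x) * cnj (f x)) \<partial>lborel) = (\<lambda>x. fourier_integral f \<zeta> * cnj (?e x * f x))"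
  proof
    fix x
    have "(\<lambda>h. ?e h * (f (h + x) * cnj (f x))) = (\<lambda>h. (?e (x + h) * f (x + h)) * (cnj (?e x) * cnj (f x)))"
    proof
      fix h
      have e: "?e (x + h) * cnj (?e x) = ?e h"
        by (simp add: exp_cnj inner_add_right algebra_simps flip: exp_add)
      have "?e h * (f (h + x) * cnj (f x)) = (?e (x + h) * cnj (?e x)) * (f (x + h) * cnj (f x))"
        unfolding e by (simp only: add.commute)
      then show "?e h * (f (h + x) * cnj (f x)) = (?e (x + h) * f (x + h)) * (cnj (?e x) * cnj (f x))"
        by (simp only: mult_ac)
    qed
    then have "(\<integral>h. ?e h * (f (h + x) * cnj (f x)) \<partial>lborel) = (\<integral>h. ?e (x + h) * f (x + h) \<partial>lborel) * (cnj (?e x) * cnj (f x))"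
      by (simp only: integral_mult_left_zero)
    also have "(\<integral>h. ?e (x + h) * f (x + h) \<partial>lborel) = fourier_integral f \<zeta>"
      unfolding fourier_integral_def by (rule lborel_integral_shift) simp
    finally show "(\<integral>h. ?e h * (f (h + x) * cnj (f x)) \<partial>lborel) = fourier_integral f \<zeta> * cnj (?e x * f x)"
      by simp
  qed
  also have "(\<integral>x. fourier_integral f \<zeta> * cnj (?e x * f x) \<partial>lborel) = fourier_integral f \<zeta> * cnj (fourier_integral f \<zeta>)"
    unfolding fourier_integral_def[of f] by (simp only: integral_mult_right_zero Bochner_Integration.integral_cnj)
  finally show ?thesis by (simp flip: complex_norm_square)
qed

lemma autocorrelation_bound:
  assumes f: "f \<in> L2"
  shows "cmod (autocorrelation f h) \<le> (L2norm f)\<^sup>2"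
  using L2_inner_le[OF L2_shift(1)[OF f, of h] f]
  by (simp add: autocorrelation_def L2_inner_def L2_shift(2)[OF f] power2_eq_square)

lemma autocorrelation_tendsto:
  assumes f: "f \<in> L2" and h: "h \<longlonglongrightarrow> 0"
  shows "(\<lambda>n. autocorrelation f (h n)) \<longlonglongrightarrow> of_real ((L2norm f)\<^sup>2)"
proof -
  have "L2_tendsto (\<lambda>n x. f (h n + x)) f sequentially"
    unfolding L2_tendsto_def using L2_translation[OF f h] L2_shift(1)[OF f] f by simp
  moreover have "L2_tendsto (\<lambda>n. f) f sequentially"
    using f by (simp add: L2_tendsto_def L2norm_def)
  ultimately have "(\<lambda>n. L2_inner (\<lambda>x. f (h n + x)) f) \<longlonglongrightarrow> L2_inner f f"
    by (rule L2_inner_tendsto)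
  then show ?thesis by (simp add: L2_inner_self[OF f]) (simp add: autocorrelation_def L2_inner_def)
qed

text \<open>
  With the normalisation of \<^const>\<open>fourier_integral\<close> this Gaussian is its own transform.
\<close>

definition gauss :: "'a::euclidean_space \<Rightarrow> real" where
  "gauss x = exp (- (pi * (norm x)\<^sup>2))"

lemma gauss_measurable [measurable]: "gauss \<in> borel_measurable borel"
  unfolding gauss_def[abs_def] by measurable

text \<open>
  The characteristic function of the standard normal distribution in the variable
  $\sqrt{2\pi}\, x$.
\<close>

lemma fourier_integral_gauss_real:
  fixes \<xi> :: real
  shows "integrable lborel (\<lambda>x::real. exp (- (pi * x\<^sup>2)))"
    and "(\<integral>x. exp (- (2 * pi * \<i> * of_real (\<xi> * x))) * of_real (exp (- (pi * x\<^sup>2))) \<partial>lborel) = of_real (exp (- (pi * \<xi>\<^sup>2)))"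
proof -
  define c where "c = sqrt (2 * pi)"
  have c: "c > 0" "c\<^sup>2 = 2 * pi" by (auto simp: c_def)
  have dens: "std_normal_density (c * x) = exp (- (pi * x\<^sup>2)) / c" for x
    unfolding std_normal_density_def by (simp add: power_mult_distrib c(2) flip: c_def)
  have i: "integrable lborel std_normal_density"
    using integrable_normal_moment[of 1 0 0] by simp
  have "integrable lborel (\<lambda>x. std_normal_density (0 + c * x))"
    by (rule lborel_integrable_real_affine[OF i]) (use c in simp)
  then have "integrable lborel (\<lambda>x. c * std_normal_density (0 + c * x))"
    by (rule integrable_mult_right)
  then show "integrable lborel (\<lambda>x::real. exp (- (pi * x\<^sup>2)))"
    using c(1) by (simp add: dens)
  define t where "t = - (c * \<xi>)"
  have "char std_normal_distribution t = (\<integral>x. std_normal_density x *\<^sub>R iexp (t * x) \<partial>lborel)"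
    unfolding char_def by (subst integral_density) (auto simp: normal_density_nonneg)
  also have "\<dots> = \<bar>c\<bar> *\<^sub>R (\<integral>x. std_normal_density (0 + c * x) *\<^sub>R iexp (t * (0 + c * x)) \<partial>lborel)"
    by (rule lborel_integral_real_affine) (use c in simp)
  also have "\<dots> = (\<integral>x. \<bar>c\<bar> *\<^sub>R (std_normal_density (0 + c * x) *\<^sub>R iexp (t * (0 + c * x))) \<partial>lborel)"
    by (simp only: integral_scaleR_right)
  also have "\<dots> = (\<integral>x. exp (- (2 * pi * \<i> * of_real (\<xi> * x))) * of_real (exp (- (pi * x\<^sup>2))) \<partial>lborel)"
  proof (intro Bochner_Integration.integral_cong refl)
    fix x
    have "t * (0 + c * x) = - (2 * pi * (\<xi> * x))"
      using c(2) by (simp add: t_def power2_eq_square algebra_simps)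
    then have "iexp (t * (0 + c * x)) = exp (- (2 * pi * \<i> * of_real (\<xi> * x)))"
      by (simp add: algebra_simps)
    then show "\<bar>c\<bar> *\<^sub>R (std_normal_density (0 + c * x) *\<^sub>R iexp (t * (0 + c * x))) =
       exp (- (2 * pi * \<i> * of_real (\<xi> * x))) * of_real (exp (- (pi * x\<^sup>2)))"
      using c(1) by (simp add: dens scaleR_conv_of_real)
  qed
  also have "char std_normal_distribution t = of_real (exp (- (pi * \<xi>\<^sup>2)))"
    unfolding char_std_normal_distribution by (simp add: t_def power_mult_distrib c(2))
  finally show "(\<integral>x. exp (- (2 * pi * \<i> * of_real (\<xi> * x))) * of_real (exp (- (pi * x\<^sup>2))) \<partial>lborel) = of_real (exp (- (pi * \<xi>\<^sup>2)))" ..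
qed

text \<open>
  Lebesgue measure is a product measure over the coordinates, and the integrand is a product.
\<close>

lemma fourier_integral_gauss:
  fixes \<xi> :: "'a::euclidean_space"
  shows "integrable lborel (gauss :: 'a \<Rightarrow> real)"
    and "fourier_integral (\<lambda>x. of_real (gauss x)) \<xi> = of_real (gauss \<xi>)"
proof -
  interpret P: product_sigma_finite "\<lambda>_::'a. lborel :: real measure" ..
  have norm: "(norm x)\<^sup>2 = (\<Sum>b\<in>Basis. (x \<bullet> b)\<^sup>2)" for x :: 'a
    unfolding power2_norm_eq_inner by (subst euclidean_inner) (simp add: power2_eq_square)
  have g: "gauss x = (\<Prod>b\<in>Basis. exp (- (pi * (x \<bullet> b)\<^sup>2)))" for x :: 'a
    by (simp add: gauss_def norm sum_distrib_left flip: exp_sum sum_negf)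
  have comp: "(\<Sum>b\<in>Basis. y b *\<^sub>R b) \<bullet> c = y c" if "c \<in> Basis" for y :: "'a \<Rightarrow> real" and c :: 'a
    using that by simp
  have m: "(\<lambda>y. \<Sum>b\<in>Basis. y b *\<^sub>R b) \<in> measurable (\<Pi>\<^sub>M b\<in>(Basis :: 'a set). lborel) borel"
    by measurable
  show int: "integrable lborel (gauss :: 'a \<Rightarrow> real)"
  proof (subst lborel_eq, subst integrable_distr_eq[OF m])
    have "integrable (\<Pi>\<^sub>M b\<in>(Basis :: 'a set). lborel) (\<lambda>y. \<Prod>b\<in>(Basis :: 'a set). exp (- (pi * (y b)\<^sup>2)))"
      by (intro P.product_integrable_prod fourier_integral_gauss_real) simp
    then show "integrable (\<Pi>\<^sub>M b\<in>(Basis :: 'a set). lborel) (\<lambda>y. gauss (\<Sum>b\<in>Basis. y b *\<^sub>R b :: 'a))"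
      unfolding g by (simp add: comp cong: prod.cong)
  qed simp
  let ?k = "\<lambda>b t. exp (- (2 * pi * \<i> * of_real (\<xi> \<bullet> b * t))) * of_real (exp (- (pi * t\<^sup>2))) :: complex"
  have k: "integrable lborel (?k b)" for b
    by (rule Bochner_Integration.integrable_bound[OF fourier_integral_gauss_real(1)]) (auto simp: norm_mult)
  have K: "exp (- (2 * pi * \<i> * of_real (\<xi> \<bullet> x))) * of_real (gauss x) = (\<Prod>b\<in>Basis. ?k b (x \<bullet> b))" for x
  proof -
    have "exp (- (2 * pi * \<i> * of_real (\<xi> \<bullet> x))) = (\<Prod>b\<in>Basis. exp (- (2 * pi * \<i> * of_real (\<xi> \<bullet> b * (x \<bullet> b)))))"
      by (subst euclidean_inner) (simp add: sum_distrib_left flip: exp_sum sum_negf)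
    then show ?thesis unfolding g by (simp add: prod.distrib)
  qed
  have "fourier_integral (\<lambda>x. of_real (gauss x)) \<xi> = (\<integral>x. (\<Prod>b\<in>Basis. ?k b (x \<bullet> b)) \<partial>lborel)"
    unfolding fourier_integral_def K ..
  also have "\<dots> = (\<integral>y. (\<Prod>b\<in>Basis. ?k b ((\<Sum>b\<in>Basis. y b *\<^sub>R b) \<bullet> b)) \<partial>(\<Pi>\<^sub>M b\<in>(Basis :: 'a set). lborel))"
    by (subst lborel_eq, subst integral_distr[OF m]) simp_all
  also have "\<dots> = (\<integral>y. (\<Prod>b\<in>Basis. ?k b (y b)) \<partial>(\<Pi>\<^sub>M b\<in>(Basis :: 'a set). lborel))"
    by (simp add: comp cong: prod.cong)
  also have "\<dots> = (\<Prod>b\<in>Basis. \<integral>t. ?k b t \<partial>lborel)"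
    by (rule P.product_integral_prod) (use k in auto)
  also have "\<dots> = of_real (gauss \<xi>)"
    unfolding fourier_integral_gauss_real(2) g by simp
  finally show "fourier_integral (\<lambda>x. of_real (gauss x)) \<xi> = of_real (gauss \<xi>)" .
qed

lemma integral_gauss: "(\<integral>x. gauss x \<partial>(lborel :: 'a::euclidean_space measure)) = 1"
proof -
  have "complex_of_real (\<integral>x. gauss x \<partial>(lborel :: 'a measure)) = 1"
    using fourier_integral_gauss(2)[of "0::'a"] by (simp add: fourier_integral_def gauss_def)
  then show ?thesis by simp
qed

text \<open>
  The multiplication formula, applied to the autocorrelation and a dilated Gaussian. The transform
  of the Gaussian is an approximate identity, whose dilation is moved onto the autocorrelation.
\<close>

lemma Plancherel_regularized:
  fixes f :: "'a::euclidean_space \<Rightarrow> complex"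
  assumes f: "integrable lborel f" and c: "c > 0"
  shows "integrable lborel (\<lambda>\<zeta>. (cmod (fourier_integral f \<zeta>))\<^sup>2 * gauss (c *\<^sub>R \<zeta>))"
    and "of_real (\<integral>\<zeta>. (cmod (fourier_integral f \<zeta>))\<^sup>2 * gauss (c *\<^sub>R \<zeta>) \<partial>lborel) =
      (\<integral>w. autocorrelation f (c *\<^sub>R w) * of_real (gauss w) \<partial>lborel)"
proof -
  note [measurable] = borel_measurable_integrable[OF f] borel_measurable_integrable[OF autocorrelation_integrable[OF f]]
  let ?g = "\<lambda>\<zeta>::'a. complex_of_real (gauss (c *\<^sub>R \<zeta>))"
  have gi: "integrable lborel (\<lambda>\<zeta>::'a. gauss (c *\<^sub>R \<zeta>))"
    by (rule lborel_integrable_scale[OF _ fourier_integral_gauss(1)]) (use c in simp)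
  show "integrable lborel (\<lambda>\<zeta>. (cmod (fourier_integral f \<zeta>))\<^sup>2 * gauss (c *\<^sub>R \<zeta>))"
  proof (rule Bochner_Integration.integrable_bound)
    show "integrable lborel (\<lambda>\<zeta>::'a. (\<integral>x. cmod (f x) \<partial>lborel)\<^sup>2 * gauss (c *\<^sub>R \<zeta>))"
      using gi by simp
    show "AE \<zeta> in lborel. norm ((cmod (fourier_integral f \<zeta>))\<^sup>2 * gauss (c *\<^sub>R \<zeta>)) \<le> norm ((\<integral>x. cmod (f x) \<partial>lborel)\<^sup>2 * gauss (c *\<^sub>R \<zeta>))"
      by (intro AE_I2) (auto simp: abs_mult gauss_def intro!: mult_right_mono power_mono fourier_integral_bound)
  qed simp
  have Fg: "fourier_integral ?g h = of_real (inverse (c ^ DIM('a)) * gauss (inverse c *\<^sub>R h))" for h :: 'a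
  proof -
    have "of_real (gauss (inverse c *\<^sub>R h)) = fourier_integral (\<lambda>x. of_real (gauss x)) (inverse c *\<^sub>R h)"
      by (simp only: fourier_integral_gauss(2))
    also have "\<dots> = \<bar>c\<bar> ^ DIM('a) *\<^sub>R (\<integral>x. exp (- (2 * pi * \<i> * of_real ((inverse c *\<^sub>R h) \<bullet> (c *\<^sub>R x)))) * of_real (gauss (c *\<^sub>R x)) \<partial>lborel)"
      unfolding fourier_integral_def by (rule lborel_integral_scale) (use c in auto)
    also have "(\<integral>x. exp (- (2 * pi * \<i> * of_real ((inverse c *\<^sub>R h) \<bullet> (c *\<^sub>R x)))) * of_real (gauss (c *\<^sub>R x)) \<partial>lborel) = fourier_integral ?g h"
    proof -
      have "(inverse c *\<^sub>R h) \<bullet> (c *\<^sub>R x) = h \<bullet> x" for x using c by simp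
      then show ?thesis unfolding fourier_integral_def by (simp only:)
    qed
    finally show ?thesis using c by (simp add: scaleR_conv_of_real)
  qed
  have "of_real (\<integral>\<zeta>. (cmod (fourier_integral f \<zeta>))\<^sup>2 * gauss (c *\<^sub>R \<zeta>) \<partial>lborel) =
      (\<integral>\<zeta>. fourier_integral (autocorrelation f) \<zeta> * ?g \<zeta> \<partial>lborel)"
    by (subst integral_complex_of_real[symmetric]) (simp add: fourier_integral_autocorrelation[OF f])
  also have "\<dots> = (\<integral>h. autocorrelation f h * fourier_integral ?g h \<partial>lborel)"
    by (rule fourier_integral_exchange) (use gi autocorrelation_integrable[OF f] in auto)
  also have "\<dots> = \<bar>c\<bar> ^ DIM('a) *\<^sub>R (\<integral>w. autocorrelation f (c *\<^sub>R w) * fourier_integral ?g (c *\<^sub>R w) \<partial>lborel)"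
    by (rule lborel_integral_scale) (use c in auto)
  also have "\<dots> = (\<integral>w. \<bar>c\<bar> ^ DIM('a) *\<^sub>R (autocorrelation f (c *\<^sub>R w) * fourier_integral ?g (c *\<^sub>R w)) \<partial>lborel)"
    by (simp only: integral_scaleR_right)
  also have "\<dots> = (\<integral>w. autocorrelation f (c *\<^sub>R w) * of_real (gauss w) \<partial>lborel)"
    using c by (intro Bochner_Integration.integral_cong refl) (simp add: Fg scaleR_conv_of_real)
  finally show "of_real (\<integral>\<zeta>. (cmod (fourier_integral f \<zeta>))\<^sup>2 * gauss (c *\<^sub>R \<zeta>) \<partial>lborel) =
      (\<integral>w. autocorrelation f (c *\<^sub>R w) * of_real (gauss w) \<partial>lborel)" .
qed

text \<open>
  As the dilation parameter tends to 0 the regularised integrals increase to the integral of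
  $|\hat f|^2$, and on the other side they converge to the value of the autocorrelation at 0.
  Monotone convergence yields the integrability of $|\hat f|^2$ together with its integral.
\<close>

lemma Plancherel:
  fixes f :: "'a::euclidean_space \<Rightarrow> complex"
  assumes f: "f \<in> L2" and fi: "integrable lborel f"
  shows "fourier_integral f \<in> L2" "L2norm (fourier_integral f) = L2norm f"
proof -
  note [measurable] = borel_measurable_integrable[OF fi] borel_measurable_integrable[OF autocorrelation_integrable[OF fi]]
  define c where "c n = inverse (real (Suc n))" for n
  have c: "c n > 0" "c \<longlonglongrightarrow> 0" for n
    using LIMSEQ_inverse_real_of_nat by (simp_all add: c_def[abs_def])
  have cmono: "c m \<le> c n" if "n \<le> m" for m n
    using that by (simp add: c_def le_imp_inverse_le)
  let ?F = "\<lambda>n \<zeta>. (cmod (fourier_integral f \<zeta>))\<^sup>2 * gauss (c n *\<^sub>R \<zeta>)"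
  have gauss_c: "gauss (r *\<^sub>R \<zeta>) = exp (- (pi * (r\<^sup>2 * (norm \<zeta>)\<^sup>2)))" for r and \<zeta> :: 'a
    by (simp add: gauss_def power_mult_distrib)
  have 1: "integrable lborel (?F n)" for n by (rule Plancherel_regularized(1)[OF fi c(1)])
  have 2: "AE \<zeta> in lborel. mono (\<lambda>n. ?F n \<zeta>)"
    unfolding gauss_c
    by (intro AE_I2 monoI mult_left_mono) (auto intro!: mult_left_mono mult_right_mono power_mono cmono less_imp_le[OF c(1)])
  have 3: "AE \<zeta> in lborel. (\<lambda>n. ?F n \<zeta>) \<longlonglongrightarrow> (cmod (fourier_integral f \<zeta>))\<^sup>2"
  proof (rule AE_I2)
    fix \<zeta> :: 'a
    have "(\<lambda>n. ?F n \<zeta>) \<longlonglongrightarrow> (cmod (fourier_integral f \<zeta>))\<^sup>2 * exp (- (pi * (0\<^sup>2 * (norm \<zeta>)\<^sup>2)))"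
      unfolding gauss_c by (intro tendsto_intros c)
    then show "(\<lambda>n. ?F n \<zeta>) \<longlonglongrightarrow> (cmod (fourier_integral f \<zeta>))\<^sup>2" by simp
  qed
  have "(\<lambda>n. \<integral>w. autocorrelation f (c n *\<^sub>R w) * of_real (gauss w) \<partial>lborel) \<longlonglongrightarrow>
      (\<integral>w. of_real ((L2norm f)\<^sup>2) * of_real (gauss w) \<partial>(lborel :: 'a measure))"
  proof (rule integral_dominated_convergence[where w = "\<lambda>w. (L2norm f)\<^sup>2 * gauss w"])
    show "integrable lborel (\<lambda>w::'a. (L2norm f)\<^sup>2 * gauss w)" by (intro integrable_mult_right fourier_integral_gauss(1))
    show "AE w in lborel. (\<lambda>n. autocorrelation f (c n *\<^sub>R w) * of_real (gauss w)) \<longlonglongrightarrow> of_real ((L2norm f)\<^sup>2) * of_real (gauss w)"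
    proof (rule AE_I2)
      fix w :: 'a
      have "(\<lambda>n. c n *\<^sub>R w) \<longlonglongrightarrow> 0 *\<^sub>R w" by (intro tendsto_intros c)
      then have "(\<lambda>n. c n *\<^sub>R w) \<longlonglongrightarrow> 0" by simp
      from autocorrelation_tendsto[OF f this]
      show "(\<lambda>n. autocorrelation f (c n *\<^sub>R w) * of_real (gauss w)) \<longlonglongrightarrow> of_real ((L2norm f)\<^sup>2) * of_real (gauss w)"
        by (intro tendsto_intros)
    qed
    show "AE w in lborel. norm (autocorrelation f (c n *\<^sub>R w) * of_real (gauss w)) \<le> (L2norm f)\<^sup>2 * gauss w" for n
      by (intro AE_I2) (auto simp: norm_mult gauss_def intro!: mult_right_mono autocorrelation_bound[OF f])
  qed measurable
  also have "(\<integral>w. of_real ((L2norm f)\<^sup>2) * of_real (gauss w) \<partial>(lborel :: 'a measure)) = complex_of_real ((L2norm f)\<^sup>2)"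
    using integral_gauss[where 'a = 'a] by simp
  finally have "(\<lambda>n. complex_of_real (\<integral>\<zeta>. ?F n \<zeta> \<partial>lborel)) \<longlonglongrightarrow> of_real ((L2norm f)\<^sup>2)"
    by (simp only: Plancherel_regularized(2)[OF fi c(1)])
  then have 4: "(\<lambda>n. \<integral>\<zeta>. ?F n \<zeta> \<partial>lborel) \<longlonglongrightarrow> (L2norm f)\<^sup>2"
    by (simp only: tendsto_of_real_iff)
  have m: "(\<lambda>\<zeta>. (cmod (fourier_integral f \<zeta>))\<^sup>2) \<in> borel_measurable lborel" by measurable
  show "fourier_integral f \<in> L2"
    using integrable_monotone_convergence[OF 1 2 3 4 m] by (intro L2I) auto
  have "(L2norm (fourier_integral f))\<^sup>2 = (L2norm f)\<^sup>2"
    unfolding L2norm_power2[of "fourier_integral f"] by (rule integral_monotone_convergence[OF 1 2 3 4 m])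
  then show "L2norm (fourier_integral f) = L2norm f" by simp
qed

section \<open>The Fourier transform on square integrable functions\<close>

lemma has_fourier_L2:
  assumes "has_fourier u v"
  shows "u \<in> L2" "v \<in> L2"
  using assms by (auto simp: has_fourier_def L2_tendsto_def)

lemma has_fourier_norm:
  assumes "has_fourier u v"
  shows "L2norm v = L2norm u"
proof -
  obtain f where f: "\<And>n. f n \<in> L2 \<and> integrable lborel (f n)" "L2_tendsto f u sequentially"
    "L2_tendsto (\<lambda>n. fourier_integral (f n)) v sequentially"
    using assms by (auto simp: has_fourier_def)
  have "(\<lambda>n. L2norm (f n)) \<longlonglongrightarrow> L2norm v"
    using L2_tendsto_norm[OF f(3)] f(1) by (simp add: Plancherel)
  then show ?thesis using L2_tendsto_norm[OF f(2)] LIMSEQ_unique by blast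
qed

lemma has_fourier_add:
  assumes "has_fourier u v" "has_fourier u' v'"
  shows "has_fourier (\<lambda>x. u x + u' x) (\<lambda>x. v x + v' x)"
proof -
  obtain f where f: "\<And>n. f n \<in> L2" "\<And>n. integrable lborel (f n)" "L2_tendsto f u sequentially"
    "L2_tendsto (\<lambda>n. fourier_integral (f n)) v sequentially"
    using assms(1) by (auto simp: has_fourier_def)
  obtain g where g: "\<And>n. g n \<in> L2" "\<And>n. integrable lborel (g n)" "L2_tendsto g u' sequentially"
    "L2_tendsto (\<lambda>n. fourier_integral (g n)) v' sequentially"
    using assms(2) by (auto simp: has_fourier_def)
  show ?thesis
    unfolding has_fourier_def
  proof (intro exI[of _ "\<lambda>n x. f n x + g n x"] conjI allI)
    show "L2_tendsto (\<lambda>n x. f n x + g n x) (\<lambda>x. u x + u' x) sequentially"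
      by (rule L2_tendsto_add[OF f(3) g(3)])
    show "L2_tendsto (\<lambda>n. fourier_integral (\<lambda>x. f n x + g n x)) (\<lambda>x. v x + v' x) sequentially"
      using L2_tendsto_add[OF f(4) g(4)] by (simp add: fourier_integral_add f(2) g(2))
  qed (use f g in auto)
qed

lemma has_fourier_cmult:
  assumes "has_fourier u v"
  shows "has_fourier (\<lambda>x. c * u x) (\<lambda>x. c * v x)"
proof -
  obtain f where f: "\<And>n. f n \<in> L2" "\<And>n. integrable lborel (f n)" "L2_tendsto f u sequentially"
    "L2_tendsto (\<lambda>n. fourier_integral (f n)) v sequentially"
    using assms(1) by (auto simp: has_fourier_def)
  show ?thesis
    unfolding has_fourier_def
  proof (intro exI[of _ "\<lambda>n x. c * f n x"] conjI allI)
    show "L2_tendsto (\<lambda>n x. c * f n x) (\<lambda>x. c * u x) sequentially"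
      by (rule L2_tendsto_cmult[OF f(3)])
    show "L2_tendsto (\<lambda>n. fourier_integral (\<lambda>x. c * f n x)) (\<lambda>x. c * v x) sequentially"
      using L2_tendsto_cmult[OF f(4)] by (simp add: fourier_integral_cmult)
  qed (use f in auto)
qed

lemma has_fourier_diff:
  assumes "has_fourier u v" "has_fourier u' v'"
  shows "has_fourier (\<lambda>x. u x - u' x) (\<lambda>x. v x - v' x)"
  using has_fourier_add[OF assms(1) has_fourier_cmult[OF assms(2), of "-1"]] by simp

lemma has_fourier_cong_AE:
  assumes uv: "has_fourier u v" and v': "v' \<in> borel_measurable borel" "AE x in lborel. v x = v' x"
  shows "has_fourier u v'"
  using uv L2_tendsto_cong_AE[OF _ v'] unfolding has_fourier_def by blast

lemma L2_AE_eq_iff: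
  fixes u v :: "'a::euclidean_space \<Rightarrow> complex"
  assumes "u \<in> L2" "v \<in> L2"
  shows "(AE x in lborel. u x = v x) \<longleftrightarrow> L2norm (\<lambda>x. u x - v x) = 0"
proof
  note [measurable] = L2_measurable[OF assms(1)] L2_measurable[OF assms(2)]
  assume uv: "AE x in lborel. u x = v x"
  have "L2norm (\<lambda>x. u x - v x) = L2norm (\<lambda>x::'a. 0 :: complex)"
    by (rule L2norm_cong_AE) (use uv in auto)
  then show "L2norm (\<lambda>x. u x - v x) = 0" by (simp add: L2norm_def)
next
  assume "L2norm (\<lambda>x. u x - v x) = 0"
  from L2norm_eq_0_imp_AE[OF L2_diff[OF assms] this] show "AE x in lborel. u x = v x" by simp
qed

text \<open>
  The relation is linear and isometric, so null functions correspond to null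
  functions. This gives uniqueness of the transform and its injectivity at the same time.
\<close>

lemma has_fourier_AE_eq_iff:
  assumes "has_fourier u v" "has_fourier u' v'"
  shows "(AE x in lborel. u x = u' x) \<longleftrightarrow> (AE x in lborel. v x = v' x)"
  using has_fourier_norm[OF has_fourier_diff[OF assms]] has_fourier_L2[OF assms(1)] has_fourier_L2[OF assms(2)]
  by (simp add: L2_AE_eq_iff)

lemma L2_tendsto_imp_Cauchy:
  assumes f: "\<And>n. f n \<in> L2" and lim: "L2_tendsto f u sequentially" and e: "e > 0"
  shows "\<exists>N. \<forall>m\<ge>N. \<forall>n\<ge>N. L2norm (\<lambda>x. f m x - f n x) \<le> e"
proof -
  have u: "u \<in> L2" and 0: "(\<lambda>n. L2norm (\<lambda>x. f n x - u x)) \<longlonglongrightarrow> 0"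
    using lim by (auto simp: L2_tendsto_def)
  obtain N where N: "\<And>n. n \<ge> N \<Longrightarrow> L2norm (\<lambda>x. f n x - u x) < e / 2"
    using order_tendstoD(2)[OF 0, of "e / 2"] e by (auto simp: eventually_sequentially)
  show ?thesis
  proof (intro exI[of _ N] allI impI)
    fix m n assume "m \<ge> N" "n \<ge> N"
    then show "L2norm (\<lambda>x. f m x - f n x) \<le> e"
      using L2norm_diff_triangle[OF f u f, of m n] N[of m] N[of n] by (simp add: L2norm_minus_commute[of u])
  qed
qed

lemma fourier_integral_truncate_diff:
  assumes u: "u \<in> L2"
  shows "L2norm (\<lambda>x. fourier_integral (truncate m u) x - fourier_integral (truncate n u) x) =
    L2norm (\<lambda>x. truncate m u x - truncate n u x)"
  using Plancherel(2)[of "\<lambda>x. truncate m u x - truncate n u x"] truncate_L2[OF u] truncate_integrable[OF u]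
  by (simp add: fourier_integral_diff L2_diff)

text \<open>
  The transforms of the truncations form a Cauchy sequence because the transform is isometric.
\<close>

lemma has_fourier_exists:
  assumes u: "u \<in> L2"
  obtains v where "has_fourier u v"
proof -
  obtain v where v: "L2_tendsto (\<lambda>n. fourier_integral (truncate n u)) v sequentially"
  proof (rule L2_complete)
    show "fourier_integral (truncate n u) \<in> L2" for n
      by (intro Plancherel(1) truncate_L2 truncate_integrable u)
    show "\<exists>N. \<forall>m\<ge>N. \<forall>n\<ge>N. L2norm (\<lambda>x. fourier_integral (truncate m u) x - fourier_integral (truncate n u) x) \<le> e"
      if "e > 0" for e
      unfolding fourier_integral_truncate_diff[OF u]
      by (rule L2_tendsto_imp_Cauchy[OF truncate_L2[OF u] truncate_tendsto[OF u] that])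
  qed
  have "has_fourier u v"
    unfolding has_fourier_def
    by (intro exI[of _ "\<lambda>n. truncate n u"] conjI allI truncate_L2 truncate_integrable truncate_tendsto u v)
  then show thesis by (rule that)
qed

text \<open>
  The inverse Fourier integral, written with conjugations so that the properties of
  \<^const>\<open>fourier_integral\<close> carry over.
\<close>

definition inv_fourier_integral :: "('a::euclidean_space \<Rightarrow> complex) \<Rightarrow> 'a \<Rightarrow> complex" where
  "inv_fourier_integral g x = cnj (fourier_integral (\<lambda>y. cnj (g y)) x)"

lemma inv_fourier_integral_Plancherel:
  assumes "g \<in> L2" "integrable lborel g"
  shows "inv_fourier_integral g \<in> L2" "L2norm (inv_fourier_integral g) = L2norm g"
proof -
  have "(\<lambda>y. cnj (g y)) \<in> L2" "integrable lborel (\<lambda>y. cnj (g y))"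
    using assms by auto
  from Plancherel[OF this] show "inv_fourier_integral g \<in> L2" "L2norm (inv_fourier_integral g) = L2norm g"
    unfolding inv_fourier_integral_def[abs_def] by (auto simp: L2norm_cnj)
qed

lemma inv_fourier_integral_adjoint:
  assumes "integrable lborel f" "integrable lborel g"
  shows "L2_inner (fourier_integral f) g = L2_inner f (inv_fourier_integral g)"
  unfolding L2_inner_def inv_fourier_integral_def complex_cnj_cnj
  by (rule fourier_integral_exchange) (use assms in auto)

text \<open>
  Let \<open>u\<close> be the limit of the inverse transforms of truncations of \<open>v\<close>, and \<open>v'\<close> the transform of
  \<open>u\<close>. All three functions have the same norm, and the adjoint relation gives
  $\langle v', v \rangle = \langle u, u \rangle$. Expanding $\|v' - v\|^2$ shows that
  \<open>v'\<close> and \<open>v\<close> agree almost everywhere.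
\<close>

lemma has_fourier_surj:
  assumes v: "v \<in> L2"
  obtains u where "has_fourier u v"
proof -
  let ?g = "\<lambda>n. truncate n v"
  note g = truncate_L2[OF v] truncate_integrable[OF v]
  have diff: "inv_fourier_integral (?g m) x - inv_fourier_integral (?g n) x =
      inv_fourier_integral (\<lambda>x. ?g m x - ?g n x) x" for m n x
    using fourier_integral_diff[of "\<lambda>y. cnj (?g m y)" "\<lambda>y. cnj (?g n y)"] g(2)
    by (simp add: inv_fourier_integral_def)
  obtain u where u: "L2_tendsto (\<lambda>n. inv_fourier_integral (?g n)) u sequentially"
  proof (rule L2_complete)
    show "inv_fourier_integral (?g n) \<in> L2" for n
      by (intro inv_fourier_integral_Plancherel(1) g)
    show "\<exists>N. \<forall>m\<ge>N. \<forall>n\<ge>N. L2norm (\<lambda>x. inv_fourier_integral (?g m) x - inv_fourier_integral (?g n) x) \<le> e"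
      if "e > 0" for e
    proof -
      have "L2norm (\<lambda>x. inv_fourier_integral (?g m) x - inv_fourier_integral (?g n) x) = L2norm (\<lambda>x. ?g m x - ?g n x)" for m n
        unfolding diff using inv_fourier_integral_Plancherel(2)[of "\<lambda>x. ?g m x - ?g n x"] g by (simp add: L2_diff)
      then show ?thesis
        using L2_tendsto_imp_Cauchy[OF g(1) truncate_tendsto[OF v] that] by simp
    qed
  qed
  have uL2: "u \<in> L2" using u by (simp add: L2_tendsto_def)
  obtain v' where v': "has_fourier u v'" using has_fourier_exists[OF uL2] .
  obtain f where f: "\<And>n. f n \<in> L2" "\<And>n. integrable lborel (f n)" "L2_tendsto f u sequentially"
    "L2_tendsto (\<lambda>n. fourier_integral (f n)) v' sequentially"
    using v' by (auto simp: has_fourier_def)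
  have nu: "L2norm u = L2norm v"
  proof -
    have "(\<lambda>n. L2norm (?g n)) \<longlonglongrightarrow> L2norm u"
      using L2_tendsto_norm[OF u] by (simp add: inv_fourier_integral_Plancherel(2)[OF g])
    then show ?thesis using L2_tendsto_norm[OF truncate_tendsto[OF v]] LIMSEQ_unique by blast
  qed
  have "L2_inner v' v = L2_inner u u"
  proof (rule LIMSEQ_unique)
    show "(\<lambda>n. L2_inner (fourier_integral (f n)) (?g n)) \<longlonglongrightarrow> L2_inner v' v"
      by (rule L2_inner_tendsto[OF f(4) truncate_tendsto[OF v]])
    show "(\<lambda>n. L2_inner (fourier_integral (f n)) (?g n)) \<longlonglongrightarrow> L2_inner u u"
      unfolding inv_fourier_integral_adjoint[OF f(2) g(2)] by (rule L2_inner_tendsto[OF f(3) u])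
  qed
  then have "(L2norm (\<lambda>x. v' x - v x))\<^sup>2 = 0"
    using L2norm_diff_power2[OF has_fourier_L2(2)[OF v'] v]
    by (simp add: L2_inner_self[OF uL2] has_fourier_norm[OF v'] nu)
  then have "AE x in lborel. v' x = v x"
    using L2_AE_eq_iff[OF has_fourier_L2(2)[OF v'] v] by simp
  then have "has_fourier u v"
    using has_fourier_cong_AE[OF v' L2_measurable[OF v]] by simp
  then show thesis by (rule that)
qed

lemma has_fourier_fourier:
  assumes "u \<in> L2"
  shows "has_fourier u (fourier u)"
proof -
  obtain v where "has_fourier u v" using has_fourier_exists[OF assms] .
  then show ?thesis unfolding fourier_def by (rule someI[of "has_fourier u"])
qed

lemma fourier_L2: "u \<in> L2 \<Longrightarrow> fourier u \<in> L2"
  by (rule has_fourier_L2(2)[OF has_fourier_fourier])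

lemma L2norm_fourier: "u \<in> L2 \<Longrightarrow> L2norm (fourier u) = L2norm u"
  by (rule has_fourier_norm[OF has_fourier_fourier])

lemma fourier_AE_eqI:
  assumes "has_fourier u v"
  shows "AE x in lborel. fourier u x = v x"
  using has_fourier_AE_eq_iff[OF has_fourier_fourier[OF has_fourier_L2(1)[OF assms]] assms] by simp

lemma has_fourier_multiplier:
  assumes "(\<lambda>\<zeta>. m \<zeta> * fourier u \<zeta>) \<in> L2"
  shows "has_fourier (fourier_multiplier m u) (\<lambda>\<zeta>. m \<zeta> * fourier u \<zeta>)"
proof -
  obtain U where "has_fourier U (\<lambda>\<zeta>. m \<zeta> * fourier u \<zeta>)" using has_fourier_surj[OF assms] .
  then show ?thesis
    unfolding fourier_multiplier_def by (rule someI[of "\<lambda>U. has_fourier U (\<lambda>\<zeta>. m \<zeta> * fourier u \<zeta>)"])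
qed

section \<open>Fourier multipliers\<close>

text \<open>
  The case \<open>q = 0\<close> is $L^2$, and \<open>q\<close> the modulus of the symbol of $\mathcal L^s$ gives its domain, so
  that both parts of the theorem become instances of one statement.
\<close>

definition multiplier_domain :: "('a::euclidean_space \<Rightarrow> complex) \<Rightarrow> ('a \<Rightarrow> complex) set" where
  "multiplier_domain q = {u \<in> L2. (\<lambda>\<zeta>. q \<zeta> * fourier u \<zeta>) \<in> L2}"

lemma multiplier_domain_zero: "multiplier_domain (\<lambda>\<zeta>. 0) = L2"
  by (simp add: multiplier_domain_def)

lemma multiplier_domainI:
  assumes q: "q \<in> borel_measurable borel" and uv: "has_fourier u v" and L: "(\<lambda>\<zeta>. q \<zeta> * v \<zeta>) \<in> L2"
  shows "u \<in> multiplier_domain q"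
proof -
  note [measurable] = q
  have [measurable]: "fourier u \<in> borel_measurable borel"
    using has_fourier_L2(1)[OF uv] by (intro L2_measurable fourier_L2)
  have "(\<lambda>\<zeta>. q \<zeta> * fourier u \<zeta>) \<in> L2"
    by (rule L2_bounded(1)[OF L, of _ 1]) (use fourier_AE_eqI[OF uv] in \<open>auto elim!: eventually_mono\<close>)
  then show ?thesis using has_fourier_L2(1)[OF uv] by (simp add: multiplier_domain_def)
qed

lemma multiplier_domain_add:
  assumes q: "q \<in> borel_measurable borel" and "u \<in> multiplier_domain q" "v \<in> multiplier_domain q"
  shows "(\<lambda>x. u x + v x) \<in> multiplier_domain q"
proof (rule multiplier_domainI[OF q])
  show "has_fourier (\<lambda>x. u x + v x) (\<lambda>x. fourier u x + fourier v x)"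
    using assms by (intro has_fourier_add has_fourier_fourier) (auto simp: multiplier_domain_def)
  show "(\<lambda>\<zeta>. q \<zeta> * (fourier u \<zeta> + fourier v \<zeta>)) \<in> L2"
    unfolding distrib_left using assms by (intro L2_add) (auto simp: multiplier_domain_def)
qed

lemma multiplier_domain_cmult:
  assumes q: "q \<in> borel_measurable borel" and "u \<in> multiplier_domain q"
  shows "(\<lambda>x. c * u x) \<in> multiplier_domain q"
proof (rule multiplier_domainI[OF q])
  show "has_fourier (\<lambda>x. c * u x) (\<lambda>x. c * fourier u x)"
    using assms by (intro has_fourier_cmult has_fourier_fourier) (auto simp: multiplier_domain_def)
  have "(\<lambda>\<zeta>. c * (q \<zeta> * fourier u \<zeta>)) \<in> L2"
    using assms by (intro L2_cmult) (auto simp: multiplier_domain_def)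
  then show "(\<lambda>\<zeta>. q \<zeta> * (c * fourier u \<zeta>)) \<in> L2" by (simp add: mult.left_commute)
qed

lemma multiplier_domain_cong_AE:
  assumes q: "q \<in> borel_measurable borel" and u: "u \<in> multiplier_domain q"
    and v: "v \<in> L2" "AE x in lborel. u x = v x"
  shows "v \<in> multiplier_domain q"
proof (rule multiplier_domainI[OF q])
  have uL: "u \<in> L2" using u by (simp add: multiplier_domain_def)
  have "AE x in lborel. fourier u x = fourier v x"
    using has_fourier_AE_eq_iff[OF has_fourier_fourier[OF uL] has_fourier_fourier[OF v(1)]] v(2) by simp
  then have "AE x in lborel. fourier v x = fourier u x" by auto
  then show "has_fourier v (fourier u)"
    by (rule has_fourier_cong_AE[OF has_fourier_fourier[OF v(1)] L2_measurable[OF fourier_L2[OF uL]]])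
  show "(\<lambda>\<zeta>. q \<zeta> * fourier u \<zeta>) \<in> L2" using u by (simp add: multiplier_domain_def)
qed

lemma multiplier_L2:
  assumes [measurable]: "m \<in> borel_measurable borel"
    and le: "\<And>\<zeta>. cmod (m \<zeta>) \<le> C * (1 + cmod (q \<zeta>))" and C: "C \<ge> 0" and u: "u \<in> multiplier_domain q"
  shows "(\<lambda>\<zeta>. m \<zeta> * fourier u \<zeta>) \<in> L2"
    "L2norm (\<lambda>\<zeta>. m \<zeta> * fourier u \<zeta>) \<le> C * (L2norm u + L2norm (\<lambda>\<zeta>. q \<zeta> * fourier u \<zeta>))"
proof -
  have uL: "u \<in> L2" "(\<lambda>\<zeta>. q \<zeta> * fourier u \<zeta>) \<in> L2" using u by (auto simp: multiplier_domain_def)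
  note [measurable] = L2_measurable[OF fourier_L2[OF uL(1)]] L2_measurable[OF uL(2)]
  let ?a = "\<lambda>\<zeta>. complex_of_real (cmod (fourier u \<zeta>))" and ?b = "\<lambda>\<zeta>. complex_of_real (cmod (q \<zeta> * fourier u \<zeta>))"
  have a: "?a \<in> L2" by (rule L2_bounded(1)[OF fourier_L2[OF uL(1)], of _ 1]) auto
  have b: "?b \<in> L2" by (rule L2_bounded(1)[OF uL(2), of _ 1]) auto
  have ab: "AE \<zeta> in lborel. cmod (m \<zeta> * fourier u \<zeta>) \<le> C * cmod (?a \<zeta> + ?b \<zeta>)"
  proof (rule AE_I2)
    fix \<zeta>
    have "cmod (m \<zeta> * fourier u \<zeta>) \<le> C * (1 + cmod (q \<zeta>)) * cmod (fourier u \<zeta>)"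
      unfolding norm_mult by (intro mult_right_mono le) simp
    also have "\<dots> = C * (cmod (fourier u \<zeta>) + cmod (q \<zeta> * fourier u \<zeta>))"
      by (simp add: norm_mult algebra_simps)
    also have "cmod (fourier u \<zeta>) + cmod (q \<zeta> * fourier u \<zeta>) = cmod (?a \<zeta> + ?b \<zeta>)"
      unfolding of_real_add[symmetric] norm_of_real by simp
    finally show "cmod (m \<zeta> * fourier u \<zeta>) \<le> C * cmod (?a \<zeta> + ?b \<zeta>)" .
  qed
  show "(\<lambda>\<zeta>. m \<zeta> * fourier u \<zeta>) \<in> L2"
    by (rule L2_bounded(1)[OF L2_add[OF a b] _ ab C]) simp
  have "L2norm (\<lambda>\<zeta>. m \<zeta> * fourier u \<zeta>) \<le> C * L2norm (\<lambda>\<zeta>. ?a \<zeta> + ?b \<zeta>)"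
    by (rule L2_bounded(2)[OF L2_add[OF a b] _ ab C]) simp
  also have "\<dots> \<le> C * (L2norm ?a + L2norm ?b)"
    by (intro mult_left_mono L2norm_triangle a b C)
  also have "L2norm ?a = L2norm u"
    using L2norm_fourier[OF uL(1)] by (simp add: L2norm_def)
  also have "L2norm ?b = L2norm (\<lambda>\<zeta>. q \<zeta> * fourier u \<zeta>)" by (simp add: L2norm_def)
  finally show "L2norm (\<lambda>\<zeta>. m \<zeta> * fourier u \<zeta>) \<le> C * (L2norm u + L2norm (\<lambda>\<zeta>. q \<zeta> * fourier u \<zeta>))" .
qed

text \<open>
  The multiplier operator is defined by choice of representatives. This is the rule for identifying
  its values from any transform of the argument.
\<close>

lemma fourier_multiplier_AE_eqI:
  assumes [measurable]: "m \<in> borel_measurable borel"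
    and m: "(\<lambda>\<zeta>. m \<zeta> * fourier u \<zeta>) \<in> L2" and u: "u \<in> L2"
    and uv: "has_fourier u v" and W: "has_fourier W (\<lambda>\<zeta>. m \<zeta> * v \<zeta>)"
  shows "AE x in lborel. fourier_multiplier m u x = W x"
  using has_fourier_AE_eq_iff[OF has_fourier_multiplier[OF m] W] fourier_AE_eqI[OF uv] by auto

lemma fourier_multiplier_bounded_L2_operator:
  fixes m q :: "'a::euclidean_space \<Rightarrow> complex"
  assumes m: "m \<in> borel_measurable borel" and q: "q \<in> borel_measurable borel"
    and le: "\<And>\<zeta>. cmod (m \<zeta>) \<le> C * (1 + cmod (q \<zeta>))" and C: "C \<ge> 0"
    and N: "\<And>u. u \<in> multiplier_domain q \<Longrightarrow> N u = L2norm u + L2norm (\<lambda>\<zeta>. q \<zeta> * fourier u \<zeta>)"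
  shows "bounded_L2_operator (multiplier_domain q) N (fourier_multiplier m)"
proof -
  let ?D = "multiplier_domain q"
  have D: "u \<in> L2" if "u \<in> ?D" for u using that by (simp add: multiplier_domain_def)
  note mL = multiplier_L2[OF m le C]
  note T = has_fourier_multiplier[OF mL(1)]
  show ?thesis
    unfolding bounded_L2_operator_def
  proof (intro conjI ballI allI impI)
    show "?D \<subseteq> L2" using D by blast
    show "(\<lambda>x. 0) \<in> ?D"
      by (rule multiplier_domainI[OF q, of _ "\<lambda>x. 0"])
        (use has_fourier_cmult[OF has_fourier_fourier[OF L2_zero], of 0] in auto)
    fix u v assume u: "u \<in> ?D"
    show "(\<lambda>x. c * u x) \<in> ?D" for c by (rule multiplier_domain_cmult[OF q u])
    show "fourier_multiplier m u \<in> L2" by (rule has_fourier_L2(1)[OF T[OF u]])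
    show "AE x in lborel. fourier_multiplier m (\<lambda>y. c * u y) x = c * fourier_multiplier m u x" for c
    proof (rule fourier_multiplier_AE_eqI[OF m mL(1)])
      show cu: "(\<lambda>x. c * u x) \<in> ?D" by (rule multiplier_domain_cmult[OF q u])
      show "(\<lambda>x. c * u x) \<in> L2" by (rule D[OF cu])
      show "has_fourier (\<lambda>x. c * u x) (\<lambda>x. c * fourier u x)"
        by (intro has_fourier_cmult has_fourier_fourier D u)
      show "has_fourier (\<lambda>x. c * fourier_multiplier m u x) (\<lambda>\<zeta>. m \<zeta> * (c * fourier u \<zeta>))"
        using has_fourier_cmult[OF T[OF u], of c] by (simp add: mult.left_commute)
    qed
    {
      assume v: "v \<in> L2" "AE x in lborel. u x = v x"
      show "v \<in> ?D" by (rule multiplier_domain_cong_AE[OF q u v])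
    }
    assume v: "v \<in> ?D"
    show "(\<lambda>x. u x + v x) \<in> ?D" by (rule multiplier_domain_add[OF q u v])
    show "AE x in lborel. fourier_multiplier m (\<lambda>y. u y + v y) x = fourier_multiplier m u x + fourier_multiplier m v x"
    proof (rule fourier_multiplier_AE_eqI[OF m mL(1)])
      show uv: "(\<lambda>x. u x + v x) \<in> ?D" by (rule multiplier_domain_add[OF q u v])
      show "(\<lambda>x. u x + v x) \<in> L2" by (rule D[OF uv])
      show "has_fourier (\<lambda>x. u x + v x) (\<lambda>x. fourier u x + fourier v x)"
        by (intro has_fourier_add has_fourier_fourier D u v)
      show "has_fourier (\<lambda>x. fourier_multiplier m u x + fourier_multiplier m v x) (\<lambda>\<zeta>. m \<zeta> * (fourier u \<zeta> + fourier v \<zeta>))"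
        using has_fourier_add[OF T[OF u] T[OF v]] by (simp add: distrib_left)
    qed
    assume "AE x in lborel. u x = v x"
    then have "AE x in lborel. fourier u x = fourier v x"
      using has_fourier_AE_eq_iff[OF has_fourier_fourier[OF D[OF u]] has_fourier_fourier[OF D[OF v]]] by simp
    then show "AE x in lborel. fourier_multiplier m u x = fourier_multiplier m v x"
      using has_fourier_AE_eq_iff[OF T[OF u] T[OF v]] by auto
  next
    show "\<exists>C. \<forall>u\<in>?D. L2norm (fourier_multiplier m u) \<le> C * N u"
      using has_fourier_norm[OF T] mL(2) N by (intro exI[of _ C] ballI) simp
  qed
qed

text \<open>
  The norm of the difference is computed on the Fourier side, where the bound on the multipliers
  provides the dominating function $C (|\hat u| + |q \hat u|)$.
\<close>

lemma fourier_multiplier_tendsto_identity: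
  fixes m :: "real \<Rightarrow> 'a::euclidean_space \<Rightarrow> complex"
  assumes m: "\<And>z. 0 < z \<Longrightarrow> z < 1 \<Longrightarrow> m z \<in> borel_measurable borel"
    and le: "\<And>z \<zeta>. 0 < z \<Longrightarrow> z < 1 \<Longrightarrow> cmod (m z \<zeta>) \<le> C * (1 + cmod (q \<zeta>))" and C: "C \<ge> 0"
    and lim: "AE \<zeta> in lborel. ((\<lambda>z. m z \<zeta>) \<longlongrightarrow> 1) (at_right 0)"
    and u: "u \<in> multiplier_domain q"
  shows "L2_tendsto (\<lambda>z. fourier_multiplier (m z) u) u (at_right 0)"
proof -
  have uL: "u \<in> L2" "(\<lambda>\<zeta>. q \<zeta> * fourier u \<zeta>) \<in> L2" using u by (auto simp: multiplier_domain_def)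
  note [measurable] = L2_measurable[OF fourier_L2[OF uL(1)]] L2_measurable[OF uL(2)]
  have T: "has_fourier (fourier_multiplier (m z) u) (\<lambda>\<zeta>. m z \<zeta> * fourier u \<zeta>)" if "0 < z" "z < 1" for z
    by (intro has_fourier_multiplier multiplier_L2(1)[OF m[OF that] le[OF that] C u])
  have nT: "L2norm (\<lambda>x. fourier_multiplier (m z) u x - u x) = L2norm (\<lambda>\<zeta>. m z \<zeta> * fourier u \<zeta> - fourier u \<zeta>)"
    if "0 < z" "z < 1" for z
    using has_fourier_norm[OF has_fourier_diff[OF T[OF that] has_fourier_fourier[OF uL(1)]]] by simp
  have ev: "\<forall>\<^sub>F z::real in at_right 0. 0 < z \<and> z < 1"
    by (rule eventually_at_rightI[of 0 1]) auto
  have "\<forall>\<^sub>F z in at_right 0. fourier_multiplier (m z) u \<in> L2"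
    using ev by eventually_elim (use has_fourier_L2(1)[OF T] in blast)
  moreover have "((\<lambda>z. L2norm (\<lambda>x. fourier_multiplier (m z) u x - u x)) \<longlongrightarrow> 0) (at_right 0)"
  proof (rule tendsto_at_right_sequentially[of 0 1])
    fix S :: "nat \<Rightarrow> real"
    assume S: "\<And>n. 0 < S n" "\<And>n. S n < 1" "S \<longlonglongrightarrow> 0"
    have [measurable]: "m (S n) \<in> borel_measurable borel" for n by (rule m[OF S(1,2)])
    have S0: "filterlim S (at_right 0) sequentially"
      using S(3) by (auto simp: filterlim_at S(1) less_imp_neq[OF S(1), symmetric])
    let ?w = "\<lambda>\<zeta>. C * (cmod (fourier u \<zeta>) + cmod (q \<zeta> * fourier u \<zeta>))"
    have "L2_tendsto (\<lambda>n \<zeta>. m (S n) \<zeta> * fourier u \<zeta>) (fourier u) sequentially"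
    proof (rule L2_dominated_convergence[where w = ?w])
      let ?a = "\<lambda>\<zeta>. complex_of_real (cmod (fourier u \<zeta>))" and ?b = "\<lambda>\<zeta>. complex_of_real (cmod (q \<zeta> * fourier u \<zeta>))"
      have a: "?a \<in> L2" by (rule L2_bounded(1)[OF fourier_L2[OF uL(1)], of _ 1]) auto
      have b: "?b \<in> L2" by (rule L2_bounded(1)[OF uL(2), of _ 1]) auto
      have "cmod (complex_of_real C * (?a \<zeta> + ?b \<zeta>)) = ?w \<zeta>" for \<zeta>
        unfolding of_real_add[symmetric] of_real_mult[symmetric] norm_of_real using C by simp
      then show "integrable lborel (\<lambda>\<zeta>. (?w \<zeta>)\<^sup>2)"
        using L2_integrable[OF L2_cmult[OF L2_add[OF a b], of "of_real C"]] by (simp only:)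
      show "AE \<zeta> in lborel. cmod (m (S n) \<zeta> * fourier u \<zeta>) \<le> ?w \<zeta>" for n
      proof (rule AE_I2)
        fix \<zeta>
        have "cmod (m (S n) \<zeta> * fourier u \<zeta>) \<le> C * (1 + cmod (q \<zeta>)) * cmod (fourier u \<zeta>)"
          unfolding norm_mult by (intro mult_right_mono le S) simp
        then show "cmod (m (S n) \<zeta> * fourier u \<zeta>) \<le> ?w \<zeta>" by (simp add: norm_mult algebra_simps)
      qed
      show "AE \<zeta> in lborel. (\<lambda>n. m (S n) \<zeta> * fourier u \<zeta>) \<longlonglongrightarrow> fourier u \<zeta>"
        using lim
      proof eventually_elim
        case (elim \<zeta>)
        have "(\<lambda>n. m (S n) \<zeta> * fourier u \<zeta>) \<longlonglongrightarrow> 1 * fourier u \<zeta>"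
          by (intro tendsto_intros filterlim_compose[OF elim S0])
        then show ?case by simp
      qed
    qed measurable
    then show "(\<lambda>n. L2norm (\<lambda>x. fourier_multiplier (m (S n)) u x - u x)) \<longlonglongrightarrow> 0"
      using S by (simp add: nT L2_tendsto_def)
  qed simp
  ultimately show ?thesis using uL by (simp add: L2_tendsto_def)
qed

section \<open>The operators of the theorem\<close>

lemma measurable_symb [measurable]: "symb \<in> borel_measurable (borel :: ('a::euclidean_space \<times> real) measure)"
proof -
  have "symb = (\<lambda>\<zeta>::'a \<times> real. 2 * pi * snd \<zeta> + 4 * pi\<^sup>2 * (norm (fst \<zeta>))\<^sup>2)"
    by (auto simp: fun_eq_iff)
  moreover have "(\<lambda>\<zeta>::'a \<times> real. 2 * pi * snd \<zeta> + 4 * pi\<^sup>2 * (norm (fst \<zeta>))\<^sup>2) \<in> borel_measurable borel"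
    by (intro borel_measurable_continuous_onI continuous_intros)
  ultimately show ?thesis by (simp only:)
qed

text \<open>
  For fixed $\xi$, $p$ vanishes at one value of $\tau$ only.
\<close>

lemma AE_symb_nonzero: "AE \<zeta> in (lborel :: ('a::euclidean_space \<times> real) measure). symb \<zeta> \<noteq> 0"
proof -
  have "AE x in (lborel :: 'a measure). AE y in lborel. symb (x, y) \<noteq> 0"
  proof (rule AE_I2)
    fix x :: 'a
    have "AE y in lborel. y \<noteq> - (2 * pi * (norm x)\<^sup>2)" by (rule AE_lborel_singleton)
    then show "AE y in lborel. symb (x, y) \<noteq> 0"
    proof eventually_elim
      case (elim y)
      have "symb (x, y) = 2 * pi * (y + 2 * pi * (norm x)\<^sup>2)"
        by (simp add: algebra_simps power2_eq_square)
      with elim show ?case by auto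
    qed
  qed
  moreover have S: "{\<zeta> \<in> space borel. symb \<zeta> \<noteq> 0} \<in> sets (borel :: ('a \<times> real) measure)"
    by measurable
  ultimately have "AE \<zeta> in (lborel :: 'a measure) \<Otimes>\<^sub>M (lborel :: real measure). symb \<zeta> \<noteq> 0"
    by (intro lborel_pair.AE_pair_measure) (simp_all only: lborel_prod space_lborel sets_lborel S)
  then show ?thesis unfolding lborel_prod .
qed

text \<open>
  At a zero of \<^const>\<open>symb\<close> the argument $w$ is 0, and so is its principal power.
\<close>

lemma msym_altdef:
  assumes "0 < s" "s < 1" "z > 0"
  shows "msym s z = (\<lambda>\<zeta>. if symb \<zeta> = 0 then 0 else msym_profile s (z\<^sup>2 * symb \<zeta> / 4))"
  using msym_eq_profile[OF assms] by (auto simp: fun_eq_iff msym_def)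

lemma measurable_msym:
  assumes "0 < s" "s < 1" "z > 0"
  shows "msym s z \<in> borel_measurable (borel :: ('a::euclidean_space \<times> real) measure)"
  unfolding msym_altdef[OF assms] by measurable

text \<open>
  The principal power on the imaginary axis in polar form, from which its measurability in \<open>p\<close> can be
  read off.
\<close>

lemma ii_symb_powr:
  "(\<i> * of_real p) powr of_real s =
    (if p = 0 then 0 else of_real (\<bar>p\<bar> powr s) * exp (\<i> * of_real (sgn p * (pi / 2) * s)))"
proof (cases "p = 0")
  case False
  have "Ln (\<i> * of_real p) = of_real (ln \<bar>p\<bar>) + \<i> * of_real (sgn p * (pi / 2))"
  proof -
    have "\<i> * of_real p = of_real \<bar>p\<bar> * (of_real (sgn p) * \<i>)" by (simp add: sgn_if)
    also have "Ln \<dots> = of_real (ln \<bar>p\<bar>) + Ln (of_real (sgn p) * \<i>)"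
      using False Ln_of_real[of "\<bar>p\<bar>"] by (subst Ln_times_of_real) (auto simp: sgn_if)
    finally show ?thesis using False by (simp add: sgn_if)
  qed
  then show ?thesis
    using False by (simp add: powr_def distrib_left exp_add exp_of_real[symmetric] mult_ac)
qed simp

lemma msym_tendsto:
  assumes s: "0 < s" "s < 1" and p: "symb \<zeta> \<noteq> 0"
  shows "((\<lambda>z. msym s z \<zeta>) \<longlongrightarrow> 1) (at_right 0)"
proof -
  have "((\<lambda>z::real. z\<^sup>2 * symb \<zeta> / 4) \<longlongrightarrow> 0) (at_right 0)"
    by (auto intro!: tendsto_eq_intros)
  moreover have pos: "\<forall>\<^sub>F z::real in at_right 0. z > 0" by (rule eventually_at_right_less)
  then have "\<forall>\<^sub>F z::real in at_right 0. z\<^sup>2 * symb \<zeta> / 4 \<noteq> 0"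
    by eventually_elim (use p in auto)
  ultimately have "filterlim (\<lambda>z::real. z\<^sup>2 * symb \<zeta> / 4) (at 0) (at_right 0)"
    by (simp add: filterlim_at)
  from filterlim_compose[OF msym_profile_tendsto[OF s] this]
  have "((\<lambda>z. msym_profile s (z\<^sup>2 * symb \<zeta> / 4)) \<longlongrightarrow> 1) (at_right 0)" .
  moreover have "\<forall>\<^sub>F z in at_right 0. msym_profile s (z\<^sup>2 * symb \<zeta> / 4) = msym s z \<zeta>"
    using pos by eventually_elim (simp add: msym_altdef[OF s] p)
  ultimately show ?thesis by (rule Lim_transform_eventually)
qed

text \<open>
  The bound may grow with \<open>z\<close>, but for \<open>z < 1\<close> it is uniform, as the passage to the limit requires.
\<close>

lemma T_op_on_multiplier_domain:
  fixes q :: "'a::euclidean_space \<times> real \<Rightarrow> complex"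
  assumes s: "0 < s" "s < 1" and q: "q \<in> borel_measurable borel" and C: "C \<ge> 0"
    and le: "\<And>z \<zeta>. z > 0 \<Longrightarrow> cmod (msym s z \<zeta>) \<le> C * (1 + (z\<^sup>2 / 4) powr s) * (1 + cmod (q \<zeta>))"
    and N: "\<And>u. u \<in> multiplier_domain q \<Longrightarrow> N u = L2norm u + L2norm (\<lambda>\<zeta>. q \<zeta> * fourier u \<zeta>)"
  shows "(\<forall>z>0. \<forall>u \<in> multiplier_domain q. has_fourier (T_op s z u) (\<lambda>\<zeta>. msym s z \<zeta> * fourier u \<zeta>)) \<and>
    (\<forall>z>0. bounded_L2_operator (multiplier_domain q) N (T_op s z)) \<and>
    (\<forall>u \<in> multiplier_domain q. L2_tendsto (\<lambda>z. T_op s z u) u (at_right 0))"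
proof (intro conjI allI impI ballI)
  have C': "C * (1 + (z\<^sup>2 / 4) powr s) \<ge> 0" for z using C by (intro mult_nonneg_nonneg add_nonneg_nonneg) auto
  fix z :: real assume z: "z > 0"
  show "has_fourier (T_op s z u) (\<lambda>\<zeta>. msym s z \<zeta> * fourier u \<zeta>)" if "u \<in> multiplier_domain q" for u
    unfolding T_op_def
    by (intro has_fourier_multiplier multiplier_L2(1)[OF measurable_msym[OF s z] le[OF z] C' that])
  show "bounded_L2_operator (multiplier_domain q) N (T_op s z)"
    unfolding T_op_def
    by (rule fourier_multiplier_bounded_L2_operator[OF measurable_msym[OF s z] q le[OF z] C' N])
next
  fix u assume u: "u \<in> multiplier_domain q"
  show "L2_tendsto (\<lambda>z. T_op s z u) u (at_right 0)"
    unfolding T_op_def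
  proof (rule fourier_multiplier_tendsto_identity[OF measurable_msym[OF s] _ _ _ u])
    fix z :: real and \<zeta> :: "'a \<times> real" assume z: "0 < z" "z < 1"
    have "z\<^sup>2 / 4 \<le> 1" using z power_le_one[of z 2] by simp
    then have "(z\<^sup>2 / 4) powr s \<le> 1" using s by (intro powr_le1) auto
    then have "C * (1 + (z\<^sup>2 / 4) powr s) * (1 + cmod (q \<zeta>)) \<le> (C * 2) * (1 + cmod (q \<zeta>))"
      using C by (intro mult_right_mono mult_left_mono) auto
    then show "cmod (msym s z \<zeta>) \<le> (C * 2) * (1 + cmod (q \<zeta>))" using le[OF z(1)] by (rule order_trans[rotated])
  next
    show "C * 2 \<ge> 0" using C by simp
    show "AE \<zeta> in lborel. ((\<lambda>z. msym s z \<zeta>) \<longlongrightarrow> 1) (at_right 0)"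
      using AE_symb_nonzero by eventually_elim (rule msym_tendsto[OF s])
  qed
qed

lemma msym_bound:
  assumes s: "0 < s" "s < 1"
  obtains C where "C \<ge> 0"
    "\<And>z (\<zeta> :: 'a::euclidean_space \<times> real). z > 0 \<Longrightarrow> s \<le> 1/2 \<Longrightarrow> cmod (msym s z \<zeta>) \<le> C"
    "\<And>z (\<zeta> :: 'a \<times> real). z > 0 \<Longrightarrow> cmod (msym s z \<zeta>) \<le> C * (1 + (z\<^sup>2 / 4) powr s * \<bar>symb \<zeta>\<bar> powr s)"
proof -
  obtain C where C: "C \<ge> 1" "\<And>x. norm (msym_profile s x) \<le> C * (max 1 \<bar>x\<bar>) powr (max 0 (s / 2 - 1 / 4))"
    using msym_profile_growth[OF s] by blast
  show thesis
  proof (rule that[of C])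
    fix z :: real and \<zeta> :: "'a \<times> real" assume z: "z > 0"
    let ?x = "z\<^sup>2 * symb \<zeta> / 4"
    have m: "cmod (msym s z \<zeta>) \<le> C * (max 1 \<bar>?x\<bar>) powr (max 0 (s / 2 - 1 / 4))"
    proof (cases "symb \<zeta> = 0")
      case True
      then show ?thesis using C(1) by (simp add: msym_altdef[OF s z])
    next
      case False
      then show ?thesis using C(2)[of ?x] by (simp add: msym_altdef[OF s z])
    qed
    show "cmod (msym s z \<zeta>) \<le> C" if "s \<le> 1/2"
    proof -
      have "max 0 (s / 2 - 1 / 4) = 0" using that by simp
      with m show ?thesis using C(1) by (simp split: if_splits)
    qed
    have x: "\<bar>?x\<bar> powr s = (z\<^sup>2 / 4) powr s * \<bar>symb \<zeta>\<bar> powr s"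
      unfolding powr_mult[symmetric] by (simp add: abs_mult)
    have "(max 1 \<bar>?x\<bar>) powr (max 0 (s / 2 - 1 / 4)) \<le> (max 1 \<bar>?x\<bar>) powr s"
      using s by (intro powr_mono) auto
    also have "\<dots> \<le> 1 + \<bar>?x\<bar> powr s" by (auto simp: max_def)
    finally have "C * (max 1 \<bar>?x\<bar>) powr (max 0 (s / 2 - 1 / 4)) \<le> C * (1 + (z\<^sup>2 / 4) powr s * \<bar>symb \<zeta>\<bar> powr s)"
      unfolding x using C(1) by (intro mult_left_mono) auto
    with m show "cmod (msym s z \<zeta>) \<le> C * (1 + (z\<^sup>2 / 4) powr s * \<bar>symb \<zeta>\<bar> powr s)" by (rule order_trans)
  qed (use C in simp)
qed

lemma Dom_Ls_eq: "Dom_Ls s = multiplier_domain (\<lambda>\<zeta>. of_real (\<bar>symb \<zeta>\<bar> powr s))"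
  by (simp add: Dom_Ls_def multiplier_domain_def)

text \<open>
  The symbol of $\mathcal L^s$ has modulus $|p|^s$, and the transform is isometric.
\<close>

lemma graph_norm_eq:
  fixes u :: "'a::euclidean_space \<times> real \<Rightarrow> complex"
  assumes u: "u \<in> Dom_Ls s"
  shows "graph_norm s u = L2norm u + L2norm (\<lambda>\<zeta>. of_real (\<bar>symb \<zeta>\<bar> powr s) * fourier u \<zeta>)"
proof -
  let ?m = "\<lambda>\<zeta>::'a \<times> real. (\<i> * of_real (symb \<zeta>)) powr of_real s"
  have uL: "u \<in> L2" "(\<lambda>\<zeta>. of_real (\<bar>symb \<zeta>\<bar> powr s) * fourier u \<zeta>) \<in> L2"
    using u by (auto simp: Dom_Ls_def)
  note [measurable] = L2_measurable[OF fourier_L2[OF uL(1)]]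
  have norm: "cmod (?m \<zeta>) = \<bar>symb \<zeta>\<bar> powr s" for \<zeta>
    by (subst norm_powr_real_powr') (auto simp: norm_mult)
  have [measurable]: "?m \<in> borel_measurable borel" unfolding ii_symb_powr by measurable
  have "(\<lambda>\<zeta>. ?m \<zeta> * fourier u \<zeta>) \<in> L2"
    by (rule L2_bounded(1)[OF uL(2), of _ 1]) (auto simp: norm_mult norm)
  from has_fourier_norm[OF has_fourier_multiplier[OF this]]
  have "L2norm (Ls s u) = L2norm (\<lambda>\<zeta>. ?m \<zeta> * fourier u \<zeta>)" by (simp add: Ls_def)
  also have "\<dots> = L2norm (\<lambda>\<zeta>. of_real (\<bar>symb \<zeta>\<bar> powr s) * fourier u \<zeta>)"
    by (simp add: L2norm_def norm_mult norm)
  finally show ?thesis by (simp add: graph_norm_def)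
qed

theorem theorem6p2:
  fixes s :: real
  assumes "0 < s" and "s < 1"
  shows
    "(s \<le> 1/2 \<longrightarrow>
        (\<forall>z>0. \<forall>u \<in> (L2 :: ((real ^ 'd) \<times> real \<Rightarrow> complex) set).
            has_fourier (T_op s z u) (\<lambda>\<zeta>. msym s z \<zeta> * fourier u \<zeta>)) \<and>
        (\<forall>z>0. bounded_L2_operator (L2 :: ((real ^ 'd) \<times> real \<Rightarrow> complex) set) L2norm (T_op s z)) \<and>
        (\<forall>u \<in> (L2 :: ((real ^ 'd) \<times> real \<Rightarrow> complex) set).
            L2_tendsto (\<lambda>z. T_op s z u) u (at_right 0))) \<and>
     (1/2 < s \<longrightarrow>
        (\<forall>z>0. \<forall>u \<in> (Dom_Ls s :: ((real ^ 'd) \<times> real \<Rightarrow> complex) set).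
            has_fourier (T_op s z u) (\<lambda>\<zeta>. msym s z \<zeta> * fourier u \<zeta>)) \<and>
        (\<forall>z>0. bounded_L2_operator (Dom_Ls s :: ((real ^ 'd) \<times> real \<Rightarrow> complex) set)
            (graph_norm s) (T_op s z)) \<and>
        (\<forall>u \<in> (Dom_Ls s :: ((real ^ 'd) \<times> real \<Rightarrow> complex) set).
            L2_tendsto (\<lambda>z. T_op s z u) u (at_right 0)))"
proof (intro conjI[of "_ \<longrightarrow> _"] impI)
  note s = assms
  obtain C where C: "C \<ge> 0"
    "\<And>z (\<zeta> :: (real ^ 'd) \<times> real). z > 0 \<Longrightarrow> s \<le> 1/2 \<Longrightarrow> cmod (msym s z \<zeta>) \<le> C"
    "\<And>z (\<zeta> :: (real ^ 'd) \<times> real). z > 0 \<Longrightarrow> cmod (msym s z \<zeta>) \<le> C * (1 + (z\<^sup>2 / 4) powr s * \<bar>symb \<zeta>\<bar> powr s)"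
    using msym_bound[OF s, where 'a = "real ^ 'd"] by blast
  {
    assume half: "s \<le> 1/2"
    show "        (\<forall>z>0. \<forall>u \<in> (L2 :: ((real ^ 'd) \<times> real \<Rightarrow> complex) set).
            has_fourier (T_op s z u) (\<lambda>\<zeta>. msym s z \<zeta> * fourier u \<zeta>)) \<and>
        (\<forall>z>0. bounded_L2_operator (L2 :: ((real ^ 'd) \<times> real \<Rightarrow> complex) set) L2norm (T_op s z)) \<and>
        (\<forall>u \<in> (L2 :: ((real ^ 'd) \<times> real \<Rightarrow> complex) set).
            L2_tendsto (\<lambda>z. T_op s z u) u (at_right 0))"
      unfolding multiplier_domain_zero[symmetric]
    proof (rule T_op_on_multiplier_domain[OF s _ C(1)])
      fix z :: real and \<zeta> :: "(real ^ 'd) \<times> real" assume z: "z > 0"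
      have "C * 1 \<le> C * (1 + (z\<^sup>2 / 4) powr s)" using C(1) by (intro mult_left_mono) auto
      then show "cmod (msym s z \<zeta>) \<le> C * (1 + (z\<^sup>2 / 4) powr s) * (1 + cmod 0)"
        using C(2)[OF z half, of \<zeta>] by simp
    qed (auto simp: L2norm_def)
  }
  {
    assume "1/2 < s"
    show "        (\<forall>z>0. \<forall>u \<in> (Dom_Ls s :: ((real ^ 'd) \<times> real \<Rightarrow> complex) set).
            has_fourier (T_op s z u) (\<lambda>\<zeta>. msym s z \<zeta> * fourier u \<zeta>)) \<and>
        (\<forall>z>0. bounded_L2_operator (Dom_Ls s :: ((real ^ 'd) \<times> real \<Rightarrow> complex) set) (graph_norm s) (T_op s z)) \<and>
        (\<forall>u \<in> (Dom_Ls s :: ((real ^ 'd) \<times> real \<Rightarrow> complex) set).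
            L2_tendsto (\<lambda>z. T_op s z u) u (at_right 0))"
      unfolding Dom_Ls_eq
    proof (rule T_op_on_multiplier_domain[OF s _ C(1)])
      fix z :: real and \<zeta> :: "(real ^ 'd) \<times> real" assume z: "z > 0"
      let ?a = "(z\<^sup>2 / 4) powr s" and ?b = "\<bar>symb \<zeta>\<bar> powr s"
      have "C * (1 + ?a * ?b) \<le> C * ((1 + ?a) * (1 + ?b))"
        using C(1) by (intro mult_left_mono) (auto simp: algebra_simps)
      then show "cmod (msym s z \<zeta>) \<le> C * (1 + ?a) * (1 + cmod (of_real ?b))"
        using C(3)[OF z, of \<zeta>] by (simp add: mult.assoc)
    qed (auto simp: graph_norm_eq Dom_Ls_eq)
  }
qed

end
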